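(* Let $\phi(x,y,z)$ be a ternary cubic form over $\mathbb{C}$ defining a smooth plane cubic curve $C_\phi$. Let $M\in GL_3(\mathbb{C})$ and $g_2,g_3\in\mathbb{C}$ be such that $$\phi\big(M\,(X,Y,Z)^T\big)=Y^2Z-4X^3+g_2XZ^2+g_3Z^3,$$ let $\Lambda=\omega_1\mathbb{Z}+\omega_2\mathbb{Z}$ with $\operatorname{Im}(\omega_2/\omega_1)>0$ be the lattice with $g_2=60\sum_{\omega\in\Lambda\setminus\{0\}}\omega^{-4}$, $g_3=140\sum_{\omega\in\Lambda\setminus\{0\}}\omega^{-6}$, and let $\tau=\omega_2/\omega_1$, $a=\theta_2(0,\tau)$, $b=\theta_3(0,\tau)$, $c=\theta_4(0,\tau)$. Then $$\Delta_\phi=\frac{2^{16}}{\det(M)^{12}}\left(\frac{\pi}{\omega_1}\right)^{12}(abc)^8.$$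
   Context: The discriminant of a ternary cubic form is $\Delta_\phi=-\operatorname{Res}(\phi_x,\phi_y,\phi_z)/27$, where $\operatorname{Res}$ is the multivariate resultant of three ternary quadratic forms (normalized as in Gelfand–Kapranov–Zelevinsky, $\operatorname{Res}(x^2,y^2,z^2)=1$). Theta functions: $\theta_3(z,\tau)=\sum_{n\in\mathbb{Z}}\exp(\pi i n^2\tau+2\pi i nz)$, $\theta_2(z,\tau)=\exp(\pi i\tau/4+\pi i z)\theta_3(z+\tau/2,\tau)$, $\theta_4(z,\tau)=\theta_3(z+1/2,\tau)$. *)

theory Defs
  imports "HOL-Analysis.Analysis" "HOL-Library.Poly_Mapping"
    "HOL-Computational_Algebra.Factorial_Ring"
begin

section \<open>Polynomials and forms\<close>

text \<open>
  A polynomial with coefficients in \<open>'a\<close> and variables indexed by \<open>'v\<close> is a finitely supported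
  map from exponents to coefficients; its ring structure is that of the library theory
  \<open>Poly_Mapping\<close>.
\<close>

type_synonym ('v, 'a) mpoly = "('v \<Rightarrow>\<^sub>0 nat) \<Rightarrow>\<^sub>0 'a"

definition mono_deg :: "('v \<Rightarrow>\<^sub>0 nat) \<Rightarrow> nat" where
  "mono_deg \<alpha> = (\<Sum>v\<in>Poly_Mapping.keys \<alpha>. Poly_Mapping.lookup \<alpha> v)"

definition homogeneous :: "nat \<Rightarrow> ('v, 'a::zero) mpoly \<Rightarrow> bool" where
  "homogeneous d p \<longleftrightarrow> (\<forall>\<alpha>\<in>Poly_Mapping.keys p. mono_deg \<alpha> = d)"

definition mpoly_eval :: "('v \<Rightarrow> 'a) \<Rightarrow> ('v, 'a::comm_semiring_1) mpoly \<Rightarrow> 'a" where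
  "mpoly_eval x p =
     (\<Sum>\<alpha>\<in>Poly_Mapping.keys p. Poly_Mapping.lookup p \<alpha> *
        (\<Prod>v\<in>Poly_Mapping.keys \<alpha>. x v ^ Poly_Mapping.lookup \<alpha> v))"

text \<open>
  In the next definition, the exponent subtraction is truncated at \<open>0\<close>, but the terms in which
  truncation occurs have coefficient \<open>0\<close>.
\<close>

definition mpoly_pderiv :: "'v \<Rightarrow> ('v, 'a::comm_semiring_1) mpoly \<Rightarrow> ('v, 'a) mpoly" where
  "mpoly_pderiv v p =
     (\<Sum>\<alpha>\<in>Poly_Mapping.keys p.
        Poly_Mapping.single (\<alpha> - Poly_Mapping.single v 1)
          (of_nat (Poly_Mapping.lookup \<alpha> v) * Poly_Mapping.lookup p \<alpha>))"


section \<open>The multivariate resultant\<close>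

text \<open>
  Let \<open>n\<close> be the number of elements of \<open>'n\<close>. The resultant of \<open>n\<close> forms \<open>F i\<close> in \<open>n\<close> variables,
  of degrees \<open>d i\<close>, is a polynomial in their coefficients. The indeterminate indexed by \<open>(i, \<alpha>)\<close>
  stands for the coefficient of the monomial with exponent \<open>\<alpha>\<close> in the \<open>i\<close>-th form. Following
  Gelfand, Kapranov and Zelevinsky, the resultant is the irreducible polynomial whose zeros are the
  tuples of forms with a common zero in projective space; this determines it up to a constant factor,
  which is fixed by requiring the value \<open>1\<close> at the tuple of pure powers \<open>x\<^sub>i\<^bsup>d i\<^esup>\<close>.

  The index type of the indeterminates also contains pairs \<open>(i, \<alpha>)\<close> with \<open>\<alpha>\<close> not of degree \<open>d i\<close>;
  the second condition says that they do not occur. It does not matter whether irreducibility is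
  taken in the larger or in the smaller polynomial ring.
\<close>

definition is_resultant ::
    "('n::finite \<Rightarrow> nat) \<Rightarrow> ('n \<times> ('n \<Rightarrow>\<^sub>0 nat), complex) mpoly \<Rightarrow> bool" where
  "is_resultant d R \<longleftrightarrow>
     irreducible R \<and>
     (\<forall>m\<in>Poly_Mapping.keys R. \<forall>(i, \<alpha>)\<in>Poly_Mapping.keys m. mono_deg \<alpha> = d i) \<and>
     (\<forall>F :: 'n \<Rightarrow> ('n, complex) mpoly. (\<forall>i. homogeneous (d i) (F i)) \<longrightarrow>
        (mpoly_eval (\<lambda>(i, \<alpha>). Poly_Mapping.lookup (F i) \<alpha>) R = 0 \<longleftrightarrow>
         (\<exists>p :: complex^'n. p \<noteq> 0 \<and> (\<forall>i. mpoly_eval (($) p) (F i) = 0)))) \<and>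
     mpoly_eval
       (\<lambda>(i, \<alpha>). Poly_Mapping.lookup
          (Poly_Mapping.single (Poly_Mapping.single i (d i)) (1::complex)) \<alpha>) R = 1"

definition resultant :: "('n::finite \<Rightarrow> nat) \<Rightarrow> ('n \<Rightarrow> ('n, complex) mpoly) \<Rightarrow> complex" where
  "resultant d F =
     mpoly_eval (\<lambda>(i, \<alpha>). Poly_Mapping.lookup (F i) \<alpha>) (THE R. is_resultant d R)"


section \<open>Ternary cubic forms\<close>

text \<open>
  The variables \<open>x\<close>, \<open>y\<close>, \<open>z\<close> of a ternary form are indexed by \<open>1\<close>, \<open>2\<close>, \<open>3\<close> of the type \<open>3\<close>
  (in which \<open>3 = 0\<close>), in accordance with the library's \<open>vector [x, y, z]\<close>.
\<close>

type_synonym ternary_form = "(3, complex) mpoly"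

definition smooth_plane_curve :: "ternary_form \<Rightarrow> bool" where
  "smooth_plane_curve \<phi> \<longleftrightarrow>
     (\<forall>p :: complex^3. p \<noteq> 0 \<and> mpoly_eval (($) p) \<phi> = 0 \<longrightarrow>
        (\<exists>v. mpoly_eval (($) p) (mpoly_pderiv v \<phi>) \<noteq> 0))"

definition cubic_discriminant :: "ternary_form \<Rightarrow> complex" where
  "cubic_discriminant \<phi> = - resultant (\<lambda>_. 2) (\<lambda>v. mpoly_pderiv v \<phi>) / 27"


section \<open>Lattices and theta functions\<close>

definition period_lattice :: "complex \<Rightarrow> complex \<Rightarrow> complex set" where
  "period_lattice \<omega>\<^sub>1 \<omega>\<^sub>2 = {of_int m * \<omega>\<^sub>1 + of_int n * \<omega>\<^sub>2 | m n. True}"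

definition theta3 :: "complex \<Rightarrow> complex \<Rightarrow> complex" where
  "theta3 z \<tau> =
     (\<Sum>\<^sub>\<infinity>n\<in>(UNIV :: int set). exp (pi * \<i> * of_int n ^ 2 * \<tau> + 2 * pi * \<i> * of_int n * z))"

definition theta2 :: "complex \<Rightarrow> complex \<Rightarrow> complex" where
  "theta2 z \<tau> = exp (pi * \<i> * \<tau> / 4 + pi * \<i> * z) * theta3 (z + \<tau> / 2) \<tau>"

definition theta4 :: "complex \<Rightarrow> complex \<Rightarrow> complex" where
  "theta4 z \<tau> = theta3 (z + 1 / 2) \<tau>"

end

theory Submission
  imports Defs "HOL-Complex_Analysis.Complex_Analysis"
    "HOL-Computational_Algebra.Computational_Algebra" "Jordan_Normal_Form.Determinant"
begin

text \<open>
  Up to the factor \<open>512\<close>, the resultant of three ternary quadratic forms is Sylvester's \<open>6 \<times> 6\<close>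
  determinant, whose rows are the coefficients of the three forms and of the partial derivatives of
  their Jacobian determinant. It vanishes exactly if the forms have a common zero: coordinate changes
  reduce this to forms \<open>x\<^sup>2 + b y z + c z\<^sup>2\<close>, \<open>y\<^sup>2 + a x z + d z\<^sup>2\<close>, \<open>e x y + l x z + m y z + n z\<^sup>2\<close>, where it
  becomes the determinant of the multiplication by the third form modulo the first two. It is
  irreducible because this zero set is irreducible and the determinant, of degree \<open>12\<close>, has \<open>12\<close>
  distinct zeros on some line. Its behaviour under linear substitutions then gives
  \<open>\<Delta>\<^sub>\<phi> = 2\<^sup>1\<^sup>2 (g\<^sub>2\<^sup>3 - 27 g\<^sub>3\<^sup>2) / det M\<^sup>1\<^sup>2\<close>.

  For \<open>i = 2, 3, 4\<close>, the function \<open>(\<theta>\<^sub>1'(0) \<theta>\<^sub>i(z) / (\<theta>\<^sub>i(0) \<theta>\<^sub>1(z)))\<^sup>2\<close> is even and elliptic with principal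
  part \<open>1 / z\<^sup>2\<close>, so by Liouville's theorem it is \<open>\<wp>(z) - e\<close> with \<open>e\<close> the value of \<open>\<wp>\<close> at the half period
  where \<open>\<theta>\<^sub>i\<close> vanishes. Values at the other half periods, together with
  \<open>\<theta>\<^sub>1'(0) = \<pi> \<theta>\<^sub>2(0) \<theta>\<^sub>3(0) \<theta>\<^sub>4(0)\<close> from the triple product, show that the differences of the roots of
  \<open>4 x\<^sup>3 - g\<^sub>2 x - g\<^sub>3\<close> are \<open>\<pi>\<^sup>2 a\<^sup>4\<close>, \<open>\<pi>\<^sup>2 b\<^sup>4\<close>, \<open>\<pi>\<^sup>2 c\<^sup>4\<close> for the lattice \<open>\<int> + \<tau>\<int>\<close>.
\<close>

hide_const (open) Determinant.det Matrix.mat Matrix.vec Matrix.row Matrix.col Matrix.transpose_mat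
no_notation vec_index (infixl "$" 100)

section \<open>Evaluation of polynomials\<close>

text \<open>The resultant is fixed by a definite description, so an explicit polynomial must be
  shown irreducible and unique among the polynomials with its zeros. This is done by restriction to
  lines and curves, where polynomials become univariate: in a pencil through the triple of squares
  the determinant is monic in the parameter, because its value at that triple is the normalization
  \<open>1\<close>, and so division with remainder is possible. The factor 512 is the cube of 8: for
  \<open>x^2, y^2, z^2\<close> the Jacobian determinant is \<open>8 x y z\<close>. The exponent 12
  of \<open>det M\<close> is 4 + 8, since the gradient of the composed cubic is the transpose of
  \<open>M\<close> applied to the composed gradient: recombining three forms contributes
  \<open>det M ^ 4\<close>, substituting in them \<open>det M ^ 8\<close>. On the analytic side the
  Weierstrass function is never summed as a series. The theta quotients take its place, and only the
  absolutely convergent cube sum for its derivative is used; it yields the Laurent expansion at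
  \<open>0\<close> to the order that the cubic equation needs.\<close>

definition monomial_eval :: "('v \<Rightarrow> 'a::comm_semiring_1) \<Rightarrow> ('v \<Rightarrow>\<^sub>0 nat) \<Rightarrow> 'a" where
  "monomial_eval x \<alpha> = (\<Prod>v\<in>Poly_Mapping.keys \<alpha>. x v ^ Poly_Mapping.lookup \<alpha> v)"

lemma mpoly_eval_monomial_eval:
  "mpoly_eval x p = (\<Sum>\<alpha>\<in>Poly_Mapping.keys p. Poly_Mapping.lookup p \<alpha> * monomial_eval x \<alpha>)"
  by (simp add: mpoly_eval_def monomial_eval_def)

lemma monomial_eval_superset:
  assumes "finite A" "Poly_Mapping.keys \<alpha> \<subseteq> A"
  shows "monomial_eval x \<alpha> = (\<Prod>v\<in>A. x v ^ Poly_Mapping.lookup \<alpha> v)"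
  unfolding monomial_eval_def using assms
  by (intro prod.mono_neutral_left) (auto simp: in_keys_iff)

lemma monomial_eval_0 [simp]: "monomial_eval x 0 = 1"
  by (simp add: monomial_eval_def)

lemma monomial_eval_single [simp]: "monomial_eval x (Poly_Mapping.single v n) = x v ^ n"
  by (simp add: monomial_eval_def)

lemma monomial_eval_add: "monomial_eval x (\<alpha> + \<beta>) = monomial_eval x \<alpha> * monomial_eval x \<beta>"
proof -
  let ?A = "Poly_Mapping.keys \<alpha> \<union> Poly_Mapping.keys \<beta>"
  have "monomial_eval x (\<alpha> + \<beta>) = (\<Prod>v\<in>?A. x v ^ Poly_Mapping.lookup (\<alpha> + \<beta>) v)"
    by (intro monomial_eval_superset) (auto simp: in_keys_iff lookup_add)
  also have "\<dots> = (\<Prod>v\<in>?A. x v ^ Poly_Mapping.lookup \<alpha> v) * (\<Prod>v\<in>?A. x v ^ Poly_Mapping.lookup \<beta> v)"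
    by (simp add: lookup_add power_add prod.distrib)
  also have "\<dots> = monomial_eval x \<alpha> * monomial_eval x \<beta>"
    by (simp add: monomial_eval_superset[of ?A])
  finally show ?thesis .
qed

lemma mpoly_eval_superset:
  assumes "finite A" "Poly_Mapping.keys p \<subseteq> A"
  shows "mpoly_eval x p = (\<Sum>\<alpha>\<in>A. Poly_Mapping.lookup p \<alpha> * monomial_eval x \<alpha>)"
  unfolding mpoly_eval_monomial_eval using assms
  by (intro sum.mono_neutral_left) (auto simp: in_keys_iff)

lemma mpoly_eval_0 [simp]: "mpoly_eval x 0 = 0"
  by (simp add: mpoly_eval_def)

lemma mpoly_eval_single [simp]: "mpoly_eval x (Poly_Mapping.single \<alpha> c) = c * monomial_eval x \<alpha>"
  by (subst mpoly_eval_superset[of "{\<alpha>}"]) auto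

lemma mpoly_eval_1 [simp]: "mpoly_eval x 1 = 1"
  using mpoly_eval_single[of x 0 1] by simp

lemma mpoly_eval_add [simp]: "mpoly_eval x (p + q) = mpoly_eval x p + mpoly_eval x q"
proof -
  let ?A = "Poly_Mapping.keys p \<union> Poly_Mapping.keys q"
  have "mpoly_eval x (p + q) = (\<Sum>\<alpha>\<in>?A. Poly_Mapping.lookup (p + q) \<alpha> * monomial_eval x \<alpha>)"
    by (intro mpoly_eval_superset) (auto simp: keys_add)
  also have "\<dots> = mpoly_eval x p + mpoly_eval x q"
    by (simp add: mpoly_eval_superset[of ?A] lookup_add ring_distribs sum.distrib)
  finally show ?thesis .
qed

lemma mpoly_eval_sum [simp]: "mpoly_eval x (sum f A) = (\<Sum>a\<in>A. mpoly_eval x (f a))"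
  by (induction A rule: infinite_finite_induct) auto

lemma mpoly_as_sum:
  "p = (\<Sum>\<alpha>\<in>Poly_Mapping.keys p. Poly_Mapping.single \<alpha> (Poly_Mapping.lookup p \<alpha>))"
  by (rule poly_mapping_eqI) (auto simp: lookup_sum lookup_single when_def in_keys_iff)

lemma mpoly_eval_mult [simp]: "mpoly_eval x (p * q) = mpoly_eval x p * mpoly_eval x q"
proof -
  let ?c = "Poly_Mapping.lookup"
  have "p * q = (\<Sum>\<alpha>\<in>Poly_Mapping.keys p. \<Sum>\<beta>\<in>Poly_Mapping.keys q.
      Poly_Mapping.single (\<alpha> + \<beta>) (?c p \<alpha> * ?c q \<beta>))"
    by (subst mpoly_as_sum[of p], subst mpoly_as_sum[of q])
       (simp add: sum_product mult_single)
  then show ?thesis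
    by (simp add: mpoly_eval_monomial_eval[of x p] mpoly_eval_monomial_eval[of x q] sum_product
        monomial_eval_add mult_ac)
qed

lemma mpoly_eval_uminus [simp]: "mpoly_eval x (- p) = - mpoly_eval x (p :: ('v, 'a::comm_ring_1) mpoly)"
proof -
  have "mpoly_eval x p + mpoly_eval x (- p) = 0"
    by (simp flip: mpoly_eval_add)
  then show ?thesis by (simp add: eq_neg_iff_add_eq_0 add.commute)
qed

lemma mpoly_eval_diff [simp]:
  "mpoly_eval x (p - q) = mpoly_eval x p - mpoly_eval x (q :: ('v, 'a::comm_ring_1) mpoly)"
  using mpoly_eval_add[of x p "- q"] by simp

lemma mpoly_eval_power [simp]: "mpoly_eval x (p ^ n) = mpoly_eval x p ^ n"
  by (induction n) auto

lemma mpoly_eval_cong: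
  assumes "\<And>m v. m \<in> Poly_Mapping.keys p \<Longrightarrow> v \<in> Poly_Mapping.keys m \<Longrightarrow> x v = y v"
  shows "mpoly_eval x p = mpoly_eval y p"
  unfolding mpoly_eval_def using assms by (intro sum.cong prod.cong arg_cong2[where f="(*)"]) auto

text \<open>Uniqueness of base-\<open>B\<close> expansions; it keeps the exponents of the Kronecker
  substitution distinct.\<close>

lemma digits_unique:
  fixes a b :: "nat \<Rightarrow> nat"
  assumes "\<And>i. i < n \<Longrightarrow> a i < B" "\<And>i. i < n \<Longrightarrow> b i < B"
    and "(\<Sum>i<n. a i * B ^ i) = (\<Sum>i<n. b i * B ^ i)" "i < n"
  shows "a i = b i"
  using assms
proof (induction n arbitrary: a b i)
  case (Suc n)
  have shift: "(\<Sum>i<Suc n. c i * B ^ i) = c 0 + B * (\<Sum>i<n. c (Suc i) * B ^ i)" for c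
    by (subst sum.lessThan_Suc_shift) (simp add: sum_distrib_left mult_ac)
  have eq: "a 0 + B * (\<Sum>i<n. a (Suc i) * B ^ i) = b 0 + B * (\<Sum>i<n. b (Suc i) * B ^ i)"
    using Suc.prems(3) unfolding shift .
  have lt: "a 0 < B" "b 0 < B" using Suc.prems by auto
  have 0: "a 0 = b 0" using arg_cong[OF eq, of "\<lambda>k. k mod B"] lt by simp
  have "(\<Sum>i<n. a (Suc i) * B ^ i) = (\<Sum>i<n. b (Suc i) * B ^ i)"
    using eq 0 lt by simp
  then have "a (Suc j) = b (Suc j)" if "j < n" for j
    using Suc.IH[of "\<lambda>i. a (Suc i)" "\<lambda>i. b (Suc i)" j] Suc.prems(1,2) that by auto
  with 0 show ?case using Suc.prems(4) by (cases i) auto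
qed simp

text \<open>Kronecker substitution \<open>x\<^sub>v = t\<^bsup>B\<^sup>k\<^esup>\<close>, where \<open>k\<close> numbers the variables, separates the
  monomials of a given polynomial.\<close>

lemma mpoly_eval_nonzero:
  fixes p :: "('v, complex) mpoly"
  assumes "p \<noteq> 0"
  shows "\<exists>x. mpoly_eval x p \<noteq> 0"
proof -
  define V where "V = \<Union> (Poly_Mapping.keys ` Poly_Mapping.keys p)"
  have finV: "finite V" by (auto simp: V_def)
  obtain k where k: "bij_betw k V {..<card V}"
    using ex_bij_betw_finite_nat[OF finV] by (auto simp: atLeast0LessThan)
  \<comment> \<open>\<open>B\<close> exceeds all exponents that occur, so these are the
    base-\<open>B\<close> digits of \<open>N\<close>; \<open>insert 0\<close> keeps
    \<open>Max\<close> meaningful for empty \<open>E\<close>.\<close>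
  define E where "E = (\<lambda>(\<alpha>, v). Poly_Mapping.lookup \<alpha> v) ` (Poly_Mapping.keys p \<times> V)"
  define B where "B = Suc (Max (insert 0 E))"
  have B: "Poly_Mapping.lookup \<alpha> v < B" if "\<alpha> \<in> Poly_Mapping.keys p" "v \<in> V" for \<alpha> v
  proof -
    have "Poly_Mapping.lookup \<alpha> v \<in> E" using that by (force simp: E_def)
    moreover have "finite E" using finV by (simp add: E_def)
    ultimately show ?thesis by (simp add: B_def less_Suc_eq_le)
  qed
  define N where "N \<alpha> = (\<Sum>v\<in>V. Poly_Mapping.lookup \<alpha> v * B ^ k v)" for \<alpha>
  have N_alt: "N \<alpha> = (\<Sum>i<card V. Poly_Mapping.lookup \<alpha> (the_inv_into V k i) * B ^ i)" for \<alpha>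
    unfolding N_def
    by (rule sum.reindex_bij_betw[OF k, where g="\<lambda>i. Poly_Mapping.lookup \<alpha> (the_inv_into V k i) * B ^ i", symmetric, THEN trans, symmetric])
       (use k in \<open>auto intro!: sum.cong simp: bij_betw_def the_inv_into_f_f\<close>)
  have inj: "inj_on N (Poly_Mapping.keys p)"
  proof (rule inj_onI)
    fix \<alpha> \<beta> assume ab: "\<alpha> \<in> Poly_Mapping.keys p" "\<beta> \<in> Poly_Mapping.keys p" "N \<alpha> = N \<beta>"
    have mem: "the_inv_into V k i \<in> V" if "i < card V" for i
      using k that by (auto simp: bij_betw_def intro!: the_inv_into_into)
    have "Poly_Mapping.lookup \<alpha> v = Poly_Mapping.lookup \<beta> v" if "v \<in> V" for v
    proof -
      have "k v < card V" using k that by (auto simp: bij_betw_def)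
      then have "Poly_Mapping.lookup \<alpha> (the_inv_into V k (k v)) = Poly_Mapping.lookup \<beta> (the_inv_into V k (k v))"
        using digits_unique[of "card V" "\<lambda>i. Poly_Mapping.lookup \<alpha> (the_inv_into V k i)" B
          "\<lambda>i. Poly_Mapping.lookup \<beta> (the_inv_into V k i)" "k v"] ab B mem
        by (auto simp: N_alt)
      then show ?thesis using k that by (simp add: bij_betw_def the_inv_into_f_f)
    qed
    moreover have "Poly_Mapping.lookup \<alpha> v = Poly_Mapping.lookup \<beta> v" if "v \<notin> V" for v
      using that ab by (auto simp: V_def in_keys_iff)
    ultimately show "\<alpha> = \<beta>" by (intro poly_mapping_eqI) blast
  qed
  define P where "P = (\<Sum>\<alpha>\<in>Poly_Mapping.keys p. monom (Poly_Mapping.lookup p \<alpha>) (N \<alpha>))"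
  have evalP: "poly P t = mpoly_eval (\<lambda>v. t ^ B ^ k v) p" for t
  proof -
    have "monomial_eval (\<lambda>v. t ^ B ^ k v) \<alpha> = t ^ N \<alpha>"
      if "\<alpha> \<in> Poly_Mapping.keys p" for \<alpha>
      using that finV
      by (subst monomial_eval_superset[of V])
         (auto simp: V_def N_def power_sum simp flip: power_mult intro!: prod.cong simp: mult.commute)
    then show ?thesis
      unfolding P_def mpoly_eval_monomial_eval by (simp add: poly_sum poly_monom)
  qed
  obtain \<alpha> where \<alpha>: "\<alpha> \<in> Poly_Mapping.keys p"
    using assms by (metis equals0I keys_eq_empty)
  have "coeff P (N \<alpha>) = (\<Sum>\<beta>\<in>Poly_Mapping.keys p. if \<beta> = \<alpha> then Poly_Mapping.lookup p \<beta> else 0)"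
    unfolding P_def coeff_sum using inj \<alpha> by (intro sum.cong) (auto dest: inj_onD)
  also have "\<dots> \<noteq> 0" using \<alpha> by (simp add: in_keys_iff)
  finally have "P \<noteq> 0" by auto
  then obtain t where "poly P t \<noteq> 0" using poly_all_0_iff_0 by blast
  then show ?thesis using evalP by metis
qed

lemma mpoly_eval_eqI:
  fixes p q :: "('v, complex) mpoly"
  assumes "\<And>x. mpoly_eval x p = mpoly_eval x q"
  shows "p = q"
  using mpoly_eval_nonzero[of "p - q"] assms by auto


section \<open>Polynomial functions in many variables and in one\<close>

definition polynomial_on :: "'v set \<Rightarrow> (('v \<Rightarrow> complex) \<Rightarrow> complex) \<Rightarrow> bool" where
  "polynomial_on X f \<longleftrightarrow>
     (\<exists>p. (\<forall>m\<in>Poly_Mapping.keys p. Poly_Mapping.keys m \<subseteq> X) \<and> (\<forall>x. f x = mpoly_eval x p))"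

named_theorems polynomial_intros

lemma polynomial_on_const [polynomial_intros]: "polynomial_on X (\<lambda>x. c)"
  unfolding polynomial_on_def by (rule exI[of _ "Poly_Mapping.single 0 c"]) auto

lemma polynomial_on_var [polynomial_intros]: "v \<in> X \<Longrightarrow> polynomial_on X (\<lambda>x. x v)"
  unfolding polynomial_on_def
  by (rule exI[of _ "Poly_Mapping.single (Poly_Mapping.single v 1) 1"]) auto

lemma polynomial_on_add [polynomial_intros]:
  "polynomial_on X f \<Longrightarrow> polynomial_on X g \<Longrightarrow> polynomial_on X (\<lambda>x. f x + g x)"
  unfolding polynomial_on_def
proof (elim exE conjE)
  fix p q :: "('a, complex) mpoly"
  assume *: "\<forall>m\<in>Poly_Mapping.keys p. Poly_Mapping.keys m \<subseteq> X" "\<forall>m\<in>Poly_Mapping.keys q. Poly_Mapping.keys m \<subseteq> X"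
    "\<forall>x. f x = mpoly_eval x p" "\<forall>x. g x = mpoly_eval x q"
  show "\<exists>p. (\<forall>m\<in>Poly_Mapping.keys p. Poly_Mapping.keys m \<subseteq> X) \<and> (\<forall>x. f x + g x = mpoly_eval x p)"
    using * keys_add[of p q] by (intro exI[of _ "p + q"]) (auto dest!: subsetD)
qed

lemma polynomial_on_mult [polynomial_intros]:
  "polynomial_on X f \<Longrightarrow> polynomial_on X g \<Longrightarrow> polynomial_on X (\<lambda>x. f x * g x)"
  unfolding polynomial_on_def
proof (elim exE conjE)
  fix p q :: "('a, complex) mpoly"
  assume *: "\<forall>m\<in>Poly_Mapping.keys p. Poly_Mapping.keys m \<subseteq> X" "\<forall>m\<in>Poly_Mapping.keys q. Poly_Mapping.keys m \<subseteq> X"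
    "\<forall>x. f x = mpoly_eval x p" "\<forall>x. g x = mpoly_eval x q"
  have "Poly_Mapping.keys m \<subseteq> X" if m: "m \<in> Poly_Mapping.keys (p * q)" for m
  proof -
    obtain a b where "m = a + b" "a \<in> Poly_Mapping.keys p" "b \<in> Poly_Mapping.keys q"
      using subsetD[OF keys_mult m] by blast
    with * keys_add[of a b] show ?thesis by blast
  qed
  then show "\<exists>p. (\<forall>m\<in>Poly_Mapping.keys p. Poly_Mapping.keys m \<subseteq> X) \<and> (\<forall>x. f x * g x = mpoly_eval x p)"
    using * by (intro exI[of _ "p * q"]) auto
qed

lemma polynomial_on_uminus [polynomial_intros]: "polynomial_on X f \<Longrightarrow> polynomial_on X (\<lambda>x. - f x)"
  using polynomial_on_mult[OF polynomial_on_const[of X "-1"]] by simp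

lemma polynomial_on_diff [polynomial_intros]:
  "polynomial_on X f \<Longrightarrow> polynomial_on X g \<Longrightarrow> polynomial_on X (\<lambda>x. f x - g x)"
  using polynomial_on_add[OF _ polynomial_on_uminus] by fastforce

lemma polynomial_on_sum [polynomial_intros]:
  "(\<And>i. i \<in> A \<Longrightarrow> polynomial_on X (f i)) \<Longrightarrow> polynomial_on X (\<lambda>x. \<Sum>i\<in>A. f i x)"
  by (induction A rule: infinite_finite_induct) (auto intro!: polynomial_intros)

lemma polynomial_on_prod [polynomial_intros]:
  "(\<And>i. i \<in> A \<Longrightarrow> polynomial_on X (f i)) \<Longrightarrow> polynomial_on X (\<lambda>x. \<Prod>i\<in>A. f i x)"
  by (induction A rule: infinite_finite_induct) (auto intro!: polynomial_intros)


text \<open>Restrictions to lines and curves are of this kind; vanishing and divisibility in many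
  variables are tested on them.\<close>

definition univariate :: "(complex \<Rightarrow> complex) \<Rightarrow> bool" where
  "univariate f \<longleftrightarrow> (\<exists>p. \<forall>s. f s = poly p s)"

lemma univariate_const [polynomial_intros]: "univariate (\<lambda>s. c)"
  unfolding univariate_def by (rule exI[of _ "[:c:]"]) simp

lemma univariate_id [polynomial_intros]: "univariate (\<lambda>s. s)"
  unfolding univariate_def by (rule exI[of _ "[:0, 1:]"]) simp

lemma univariate_add [polynomial_intros]: "univariate f \<Longrightarrow> univariate g \<Longrightarrow> univariate (\<lambda>s. f s + g s)"
  unfolding univariate_def by (metis poly_add)

lemma univariate_mult [polynomial_intros]: "univariate f \<Longrightarrow> univariate g \<Longrightarrow> univariate (\<lambda>s. f s * g s)"
  unfolding univariate_def by (metis poly_mult)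

lemma univariate_diff [polynomial_intros]: "univariate f \<Longrightarrow> univariate g \<Longrightarrow> univariate (\<lambda>s. f s - g s)"
  unfolding univariate_def by (metis poly_diff)

lemma univariate_sum [polynomial_intros]:
  "(\<And>i. i \<in> A \<Longrightarrow> univariate (f i)) \<Longrightarrow> univariate (\<lambda>s. \<Sum>i\<in>A. f i s)"
  by (induction A rule: infinite_finite_induct) (auto intro!: polynomial_intros)

lemma univariate_prod [polynomial_intros]:
  "(\<And>i. i \<in> A \<Longrightarrow> univariate (f i)) \<Longrightarrow> univariate (\<lambda>s. \<Prod>i\<in>A. f i s)"
  by (induction A rule: infinite_finite_induct) (auto intro!: polynomial_intros)

lemma univariate_power [polynomial_intros]: "univariate f \<Longrightarrow> univariate (\<lambda>s. f s ^ n)"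
  by (induction n) (auto intro!: polynomial_intros)

lemma univariate_mpoly_eval [polynomial_intros]:
  "(\<And>v. univariate (\<lambda>s. x s v)) \<Longrightarrow> univariate (\<lambda>s. mpoly_eval (x s) p)"
  unfolding mpoly_eval_def by (intro polynomial_intros)

lemma univariate_zero:
  assumes "univariate f" "infinite {s. f s = 0}"
  shows "f s = 0"
proof -
  obtain p where p: "\<And>s. f s = poly p s" using assms unfolding univariate_def by blast
  then have "p = 0" using assms(2) poly_roots_finite[of p] by auto
  then show ?thesis using p by simp
qed

lemma univariate_mult_eq_0:
  assumes "univariate f" "univariate g" "\<And>s. f s * g s = 0" "f s \<noteq> 0"
  shows "g t = 0"
proof -
  obtain p q where p: "\<And>s. f s = poly p s" and q: "\<And>s. g s = poly q s"
    using assms unfolding univariate_def by metis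
  have "p * q = 0" using assms(3) p q by (subst poly_all_0_iff_0[symmetric]) simp
  moreover have "p \<noteq> 0" using assms(4) p by auto
  ultimately show ?thesis using q by simp
qed


section \<open>The Sylvester determinant of three ternary quadratic forms\<close>

lemma laplace_first_column:
  fixes f :: "nat \<times> nat \<Rightarrow> 'a::comm_ring_1"
  shows "Determinant.det (Matrix.mat (Suc n) (Suc n) f) =
    (\<Sum>i<Suc n. (- 1) ^ i * (f (i, 0) * Determinant.det (Matrix.mat n n (\<lambda>(k, j). f (if k < i then k else Suc k, Suc j)))))"
proof -
  let ?A = "Matrix.mat (Suc n) (Suc n) f"
  have "Determinant.det ?A = (\<Sum>i<Suc n. ?A $$ (i, 0) * cofactor ?A i 0)"
    by (rule laplace_expansion_column) auto
  also have "\<dots> = (\<Sum>i<Suc n. (- 1) ^ i * (f (i, 0) * Determinant.det (Matrix.mat n n (\<lambda>(k, j). f (if k < i then k else Suc k, Suc j)))))"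
  proof (intro sum.cong refl)
    fix i assume i: "i \<in> {..<Suc n}"
    have "mat_delete ?A i 0 = Matrix.mat n n (\<lambda>(k, j). f (if k < i then k else Suc k, Suc j))"
      using i by (intro eq_matI) (auto simp: mat_delete_def)
    then show "?A $$ (i, 0) * cofactor ?A i 0 = (- 1) ^ i * (f (i, 0) * Determinant.det (Matrix.mat n n (\<lambda>(k, j). f (if k < i then k else Suc k, Suc j))))"
      using i by (simp add: cofactor_def)
  qed
  finally show ?thesis .
qed

definition delete_nth :: "nat \<Rightarrow> 'a list \<Rightarrow> 'a list" where
  "delete_nth j xs = take j xs @ drop (Suc j) xs"

lemma nth_delete_nth:
  "j < length xs \<Longrightarrow> k < length xs - 1 \<Longrightarrow> delete_nth j xs ! k = xs ! (if k < j then k else Suc k)"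
  by (auto simp: delete_nth_def nth_append)

lemma length_delete_nth [simp]: "j < length xs \<Longrightarrow> length (delete_nth j xs) = length xs - 1"
  by (auto simp: delete_nth_def)

lemma set_delete_nth: "set (delete_nth j xs) \<subseteq> set xs"
  by (auto simp: delete_nth_def dest: in_set_takeD in_set_dropD)

text \<open>Expansion along the first column of a determinant given by its rows; \<open>expand_col pre rs\<close> is
  the part of it that belongs to the rows \<open>rs\<close>, up to the sign of the first of them.\<close>

function list_det :: "'a::comm_ring_1 list list \<Rightarrow> 'a" where
  "list_det rs = (if rs = [] then 1 else
     (\<Sum>i<length rs. (- 1) ^ i * (hd (rs ! i) * list_det (map tl (delete_nth i rs)))))"
  by auto
termination by (relation "Wellfounded.measure length") auto

declare list_det.simps [simp del]

definition expand_col :: "'a::comm_ring_1 list list \<Rightarrow> 'a list list \<Rightarrow> 'a" where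
  "expand_col pre rs =
     (\<Sum>i<length rs. (- 1) ^ i * (hd (rs ! i) * list_det (map tl (pre @ delete_nth i rs))))"

lemma list_det_Nil: "list_det [] = 1"
  by (subst list_det.simps) simp

lemma list_det_Cons: "list_det (r # rs) = expand_col [] (r # rs)"
  by (subst list_det.simps) (simp add: expand_col_def)

lemma expand_col_Nil: "expand_col pre [] = 0"
  by (simp add: expand_col_def)

lemma expand_col_Cons:
  "expand_col pre ((a # r) # rs) = a * list_det (map tl (pre @ rs)) - expand_col (pre @ [a # r]) rs"
  unfolding expand_col_def
  by (simp add: sum.lessThan_Suc_shift delete_nth_def del: sum.lessThan_Suc flip: sum_negf)

text \<open>Spares the minor of a zero entry; the matrices below are sparse.\<close>

lemma expand_col_0: "expand_col pre ((0 # r) # rs) = - expand_col (pre @ [0 # r]) rs"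
  by (simp add: expand_col_Cons)

lemmas list_det_eval = list_det_Nil list_det_Cons expand_col_Nil expand_col_Cons expand_col_0

lemma det_mat_eq_list_det:
  assumes "length xss = n" "\<And>xs. xs \<in> set xss \<Longrightarrow> length xs = n"
  shows "Determinant.det (Matrix.mat n n (\<lambda>(i, j). xss ! i ! j)) = list_det xss"
  using assms
proof (induction n arbitrary: xss)
  case 0
  then show ?case by (simp add: Determinant.det_def list_det_Nil)
next
  case (Suc n)
  have len: "length (xss ! i) = Suc n" if "i < Suc n" for i
    using Suc.prems that by auto
  have minor: "Determinant.det (Matrix.mat n n (\<lambda>(k, j). xss ! (if k < i then k else Suc k) ! Suc j)) =
      list_det (map tl (delete_nth i xss))" if "i < Suc n" for i
  proof -
    have "Determinant.det (Matrix.mat n n (\<lambda>(k, j). map tl (delete_nth i xss) ! k ! j)) =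
      list_det (map tl (delete_nth i xss))"
      using Suc.prems that set_delete_nth[of i xss] by (intro Suc.IH) auto
    moreover have "Matrix.mat n n (\<lambda>(k, j). map tl (delete_nth i xss) ! k ! j) =
        Matrix.mat n n (\<lambda>(k, j). xss ! (if k < i then k else Suc k) ! Suc j)"
      using Suc.prems that len by (intro eq_matI) (auto simp: nth_delete_nth nth_tl)
    ultimately show ?thesis by simp
  qed
  have hd: "hd (xss ! i) = xss ! i ! 0" if "i < Suc n" for i
    using len[OF that] by (metis hd_conv_nth list.size(3) nat.distinct(1))
  have "list_det xss = (\<Sum>i<Suc n. (- 1) ^ i * (hd (xss ! i) * list_det (map tl (delete_nth i xss))))"
    using Suc.prems by (subst list_det.simps) (auto simp del: sum.lessThan_Suc)
  then show ?case
    unfolding laplace_first_column using minor hd by (simp del: sum.lessThan_Suc)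
qed

text \<open>A form \<open>c 0 x\<^sup>2 + c 1 x y + c 2 x z + c 3 y\<^sup>2 + c 4 y z + c 5 z\<^sup>2\<close> is given by its
  coefficients; \<open>sym_index a b\<close> is the position of the product of the variables numbered \<open>a\<close>
  and \<open>b\<close>.\<close>

definition sym_index :: "nat \<Rightarrow> nat \<Rightarrow> nat" where
  "sym_index a b = [[0, 1, 2], [1, 3, 4], [2, 4, 5]] ! a ! b"

definition quad :: "(nat \<Rightarrow> 'a::comm_ring_1) \<Rightarrow> 'a \<Rightarrow> 'a \<Rightarrow> 'a \<Rightarrow> 'a" where
  "quad c x y z = c 0 * x\<^sup>2 + c 1 * x * y + c 2 * x * z + c 3 * y\<^sup>2 + c 4 * y * z + c 5 * z\<^sup>2"

text \<open>The Hessian matrix of the form, so that \<open>hess_vec c p\<close> below is the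
  gradient at \<open>p\<close>.\<close>

definition hess :: "(nat \<Rightarrow> 'a::comm_ring_1) \<Rightarrow> nat \<Rightarrow> nat \<Rightarrow> 'a" where
  "hess c a b = (if a = b then 2 * c (sym_index a b) else c (sym_index a b))"

definition det3 :: "(nat \<Rightarrow> nat \<Rightarrow> 'a::comm_ring_1) \<Rightarrow> 'a" where
  "det3 A = A 0 0 * (A 1 1 * A 2 2 - A 1 2 * A 2 1) - A 0 1 * (A 1 0 * A 2 2 - A 1 2 * A 2 0)
     + A 0 2 * (A 1 0 * A 2 1 - A 1 1 * A 2 0)"

text \<open>The Jacobian determinant \<open>J\<close> of three forms is the cubic form attached to the trilinear form
  \<open>jac_tri\<close>, and \<open>jac_pd j k l\<close> is the coefficient of the \<open>k\<close>-th times the \<open>l\<close>-th variable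
  in its \<open>j\<close>-th partial derivative.\<close>

definition jac_tri :: "(nat \<Rightarrow> nat \<Rightarrow> 'a::comm_ring_1) \<Rightarrow> nat \<Rightarrow> nat \<Rightarrow> nat \<Rightarrow> 'a" where
  "jac_tri C a b d = det3 (\<lambda>i. hess (C i) ([a, b, d] ! i))"

definition jac_pd :: "(nat \<Rightarrow> nat \<Rightarrow> 'a::comm_ring_1) \<Rightarrow> nat \<Rightarrow> nat \<Rightarrow> nat \<Rightarrow> 'a" where
  "jac_pd C j k l = jac_tri C j k l + jac_tri C k j l + jac_tri C k l j"

text \<open>The coefficients of the quadratic form \<open>B p p\<close> in the order of
  \<open>sym_index\<close>; \<open>B\<close> need not be symmetric.\<close>

definition bilin_coeffs :: "(nat \<Rightarrow> nat \<Rightarrow> 'a::comm_ring_1) \<Rightarrow> nat \<Rightarrow> 'a" where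
  "bilin_coeffs B m = [B 0 0, B 0 1 + B 1 0, B 0 2 + B 2 0, B 1 1, B 1 2 + B 2 1, B 2 2] ! m"

definition sylv_entry :: "(nat \<Rightarrow> nat \<Rightarrow> 'a::comm_ring_1) \<Rightarrow> nat \<Rightarrow> nat \<Rightarrow> 'a" where
  "sylv_entry C r = (if r < 3 then C r else bilin_coeffs (jac_pd C (r - 3)))"

definition sylv_det :: "(nat \<Rightarrow> nat \<Rightarrow> 'a::comm_ring_1) \<Rightarrow> 'a" where
  "sylv_det C = Determinant.det (Matrix.mat 6 6 (\<lambda>(r, m). sylv_entry C r m))"

lemma less_6_cases: "(i::nat) < 6 \<Longrightarrow> i = 0 \<or> i = 1 \<or> i = 2 \<or> i = 3 \<or> i = 4 \<or> i = 5"
  by presburger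

lemma less_3_cases: "(i::nat) < 3 \<Longrightarrow> i = 0 \<or> i = 1 \<or> i = 2"
  by presburger

lemma sylv_det_list:
  "sylv_det C = list_det (map (\<lambda>r. map (sylv_entry C r) [0,1,2,3,4,5]) [0,1,2,3,4,5])"
  unfolding sylv_det_def
proof (subst det_mat_eq_list_det[symmetric])
  show "Determinant.det (Matrix.mat 6 6 (\<lambda>(x, y). sylv_entry C x y)) =
    Determinant.det (Matrix.mat 6 6 (\<lambda>(i, j). map (\<lambda>r. map (sylv_entry C r) [0,1,2,3,4,5]) [0,1,2,3,4,5] ! i ! j))"
    by (intro arg_cong[where f=Determinant.det] eq_matI) (auto dest!: less_6_cases)
qed auto

lemmas sylv_eval = sylv_entry_def bilin_coeffs_def jac_pd_def jac_tri_def det3_def hess_def sym_index_def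

lemma sylv_det_squares:
  "sylv_det (\<lambda>i. (!) ([[1, 0, 0, 0, 0, 0], [0, 0, 0, 1, 0, 0], [0, 0, 0, 0, 0, 1]] ! i)) = (512 :: complex)"
  unfolding sylv_det_list by (simp add: sylv_eval, simp add: list_det_eval)

text \<open>The rows are the partial derivatives of
  \<open>Y^2 Z - 4 X^3 + g2 X Z^2 + g3 Z^3\<close>.\<close>

lemma sylv_det_weierstrass:
  fixes g2 g3 :: complex
  shows "sylv_det (\<lambda>i. (!) ([[-12, 0, 0, 0, 0, g2], [0, 0, 0, 0, 2, 0], [0, 0, 2 * g2, 1, 0, 3 * g3]] ! i)) =
    - (512 * 27 * 4096) * (g2 ^ 3 - 27 * g3\<^sup>2)"
  unfolding sylv_det_list
  by (simp add: sylv_eval, simp add: list_det_eval,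
      simp add: algebra_simps power2_eq_square power3_eq_cube)

text \<open>The triples are \<open>t\<close> times \<open>x^2, y^2, z^2\<close> plus the fixed
  triple \<open>x z - y^2\<close>, \<open>z^2\<close>, \<open>x^2 + y z\<close>, a sparse choice for
  which all twelve zeros in \<open>t\<close> are simple.\<close>

lemma sylv_det_pencil:
  fixes t :: complex
  shows "sylv_det (\<lambda>i. (!) ([[t, 0, 1, -1, 0, 0], [0, 0, 0, t, 0, 1], [1, 0, 0, 0, 1, t]] ! i)) =
    512 * (t ^ 12 + 2 * t ^ 6 - 3 * t ^ 3 + 1)"
proof -
  have powers: "t ^ 6 = t*(t*(t*(t*(t*t))))" "t ^ 12 = t*(t*(t*(t*(t*(t*(t*(t*(t*(t*(t*t))))))))))"
    by (simp_all add: numeral_eq_Suc)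
  show ?thesis
    unfolding sylv_det_list
    by (simp add: sylv_eval, simp add: list_det_eval, simp add: algebra_simps,
        simp only: powers power3_eq_cube, simp add: algebra_simps)
qed

text \<open>The \<open>4 \<times> 4\<close> matrix is that of the multiplication by the third form, with \<open>z = 1\<close>, in the basis
  \<open>1\<close>, \<open>x\<close>, \<open>y\<close>, \<open>x y\<close> of the polynomials modulo the first two forms.\<close>

lemma sylv_det_normal_form:
  fixes a b c d e l m n :: complex
  shows "sylv_det (\<lambda>i. (!) ([[1, 0, 0, 0, b, c], [0, 0, a, 1, 0, d], [0, e, l, 0, m, n]] ! i)) =
    512 * list_det [[n, l, m, e],
      [e*b*d - l*c, n + e*b*a, - l*b - e*c, m],
      [e*a*c - m*d, - m*a - e*d, n + e*a*b, l],
      [l*b*d + m*a*c + e*c*d, l*a*b - m*d + e*a*c, m*a*b - l*c + e*b*d, n + e*a*b]]"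
  unfolding sylv_det_list
  by (simp add: sylv_eval, simp add: list_det_eval,
      simp add: algebra_simps power2_eq_square power3_eq_cube)

lemma bilin_coeffs_cong:
  assumes "\<And>a b. a < 3 \<Longrightarrow> b < 3 \<Longrightarrow> B a b = B' a b"
  shows "bilin_coeffs B = bilin_coeffs B'"
  by (rule ext) (simp add: bilin_coeffs_def assms)

lemma sylv_entry_cong:
  assumes "\<And>i m. i < 3 \<Longrightarrow> m < 6 \<Longrightarrow> C i m = C' i m" "r < 6" "m < 6"
  shows "sylv_entry C r m = sylv_entry C' r m"
proof -
  have sym: "sym_index a b < 6" if "a < 3" "b < 3" for a b
    using that by (auto dest!: less_3_cases simp: sym_index_def)
  have h: "hess (C i) a b = hess (C' i) a b" if "i < 3" "a < 3" "b < 3" for i a b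
    using that assms(1)[OF that(1) sym] by (simp add: hess_def)
  have t: "jac_tri C a b d = jac_tri C' a b d" if "a < 3" "b < 3" "d < 3" for a b d
    using that by (simp add: jac_tri_def det3_def h)
  have "bilin_coeffs (jac_pd C j) = bilin_coeffs (jac_pd C' j)" if "j < 3" for j
    using that by (intro bilin_coeffs_cong) (simp add: jac_pd_def t)
  with assms show ?thesis by (simp add: sylv_entry_def)
qed

lemma sylv_det_cong:
  assumes "\<And>i m. i < 3 \<Longrightarrow> m < 6 \<Longrightarrow> C i m = C' i m"
  shows "sylv_det C = sylv_det C'"
  unfolding sylv_det_def using sylv_entry_cong[OF assms]
  by (intro arg_cong[where f=Determinant.det] eq_matI) auto

lemma det_mat_univariate [polynomial_intros]:
  assumes "\<And>i j. i < n \<Longrightarrow> j < n \<Longrightarrow> univariate (\<lambda>s. f s i j)"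
  shows "univariate (\<lambda>s. Determinant.det (Matrix.mat n n (\<lambda>(i, j). f s i j)))"
proof -
  have "univariate (\<lambda>s. \<Sum>p\<in>{p. p permutes {0..<n}}. signof p * (\<Prod>i = 0..<n. f s i (p i)))"
    using assms by (intro polynomial_intros) (auto dest!: permutes_in_image)
  also have "(\<lambda>s. \<Sum>p\<in>{p. p permutes {0..<n}}. signof p * (\<Prod>i = 0..<n. f s i (p i))) =
      (\<lambda>s. Determinant.det (Matrix.mat n n (\<lambda>(i, j). f s i j)))"
    by (rule ext) (auto simp: Determinant.det_def intro!: sum.cong prod.cong dest!: permutes_in_image)
  finally show ?thesis .
qed

lemma det_mat_polynomial_on [polynomial_intros]:
  assumes "\<And>i j. i < n \<Longrightarrow> j < n \<Longrightarrow> polynomial_on X (\<lambda>x. f x i j)"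
  shows "polynomial_on X (\<lambda>x. Determinant.det (Matrix.mat n n (\<lambda>(i, j). f x i j)))"
proof -
  have "polynomial_on X (\<lambda>s. \<Sum>p\<in>{p. p permutes {0..<n}}. signof p * (\<Prod>i = 0..<n. f s i (p i)))"
    using assms by (intro polynomial_intros) (auto dest!: permutes_in_image)
  also have "(\<lambda>s. \<Sum>p\<in>{p. p permutes {0..<n}}. signof p * (\<Prod>i = 0..<n. f s i (p i))) =
      (\<lambda>s. Determinant.det (Matrix.mat n n (\<lambda>(i, j). f s i j)))"
    by (rule ext) (auto simp: Determinant.det_def intro!: sum.cong prod.cong dest!: permutes_in_image)
  finally show ?thesis .
qed

lemma sum_less_3: "(\<Sum>k<3. f k) = f 0 + f 1 + f (2::nat)"
  by (simp add: numeral_3_eq_3 numeral_2_eq_2)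

lemma sum_less_6: "(\<Sum>k<6. f k) = f 0 + f 1 + f 2 + f 3 + f 4 + f (5::nat)"
  by (simp add: eval_nat_numeral add.assoc)

section \<open>Vanishing of the determinant at a common zero\<close>

definition cross :: "(nat \<Rightarrow> 'a::comm_ring_1) \<Rightarrow> (nat \<Rightarrow> 'a) \<Rightarrow> nat \<Rightarrow> 'a" where
  "cross v w k = [v 1 * w 2 - v 2 * w 1, v 2 * w 0 - v 0 * w 2, v 0 * w 1 - v 1 * w 0] ! k"

definition dot :: "(nat \<Rightarrow> 'a::comm_ring_1) \<Rightarrow> (nat \<Rightarrow> 'a) \<Rightarrow> 'a" where
  "dot v w = v 0 * w 0 + v 1 * w 1 + v 2 * w 2"

definition triple :: "(nat \<Rightarrow> 'a::comm_ring_1) \<Rightarrow> (nat \<Rightarrow> 'a) \<Rightarrow> (nat \<Rightarrow> 'a) \<Rightarrow> 'a" where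
  "triple u v w = det3 (\<lambda>i. [u, v, w] ! i)"

text \<open>Cramer's rule for the linear system with rows \<open>u, v, w\<close> and solution
  \<open>p\<close>.\<close>

lemma triple_expand:
  assumes "k < 3"
  shows "p k * triple u v w = dot u p * cross v w k + dot v p * cross w u k + dot w p * cross u v k"
  using less_3_cases[OF assms]
  by (elim disjE) (simp_all add: triple_def det3_def dot_def cross_def algebra_simps)

lemma triple_columns:
  assumes "k < 3" "j < 3"
  shows "u j * cross v w k + v j * cross w u k + w j * cross u v k = (if j = k then triple u v w else 0)"
  using less_3_cases[OF assms(1)] less_3_cases[OF assms(2)]
  by (elim disjE) (simp_all add: triple_def det3_def cross_def algebra_simps)

text \<open>The condition \<open>a \<le> b\<close> counts each product of two variables
  once.\<close>

definition quad_monom :: "(nat \<Rightarrow> 'a::comm_ring_1) \<Rightarrow> nat \<Rightarrow> 'a" where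
  "quad_monom p m = bilin_coeffs (\<lambda>a b. if a \<le> b then p a * p b else 0) m"

lemma quad_eq_sum: "quad c (p 0) (p 1) (p 2) = (\<Sum>m<6. c m * quad_monom p m)"
  by (simp add: sum_less_6 quad_def quad_monom_def bilin_coeffs_def power2_eq_square mult_ac)

definition hess_vec :: "(nat \<Rightarrow> 'a::comm_ring_1) \<Rightarrow> (nat \<Rightarrow> 'a) \<Rightarrow> nat \<Rightarrow> 'a" where
  "hess_vec c p k = hess c 0 k * p 0 + hess c 1 k * p 1 + hess c 2 k * p 2"

lemma dot_hess_vec: "dot (hess_vec c p) p = 2 * quad c (p 0) (p 1) (p 2)"
  by (simp add: dot_def hess_vec_def hess_def sym_index_def quad_def algebra_simps power2_eq_square)

lemma dot_hess: "j < 3 \<Longrightarrow> dot (hess c j) p = hess_vec c p j"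
  by (drule less_3_cases) (auto simp: dot_def hess_vec_def hess_def sym_index_def)

lemma jac_pd_contract:
  "(\<Sum>m<6. bilin_coeffs (jac_pd C j) m * quad_monom p m) =
    triple (hess (C 0) j) (hess_vec (C 1) p) (hess_vec (C 2) p) +
    triple (hess_vec (C 0) p) (hess (C 1) j) (hess_vec (C 2) p) +
    triple (hess_vec (C 0) p) (hess_vec (C 1) p) (hess (C 2) j)"
  unfolding sum_less_6
  by (simp add: quad_monom_def bilin_coeffs_def jac_pd_def jac_tri_def triple_def det3_def hess_vec_def algebra_simps)

text \<open>By Euler's identity the gradients at \<open>p\<close> are orthogonal to
  \<open>p\<close>, so the Jacobian determinant vanishes at \<open>p\<close>, and Cramer's rule
  shows that its partial derivatives vanish there too. Hence the quadratic monomials of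
  \<open>p\<close> form a kernel vector of the Sylvester matrix.\<close>

lemma sylv_det_common_zero:
  fixes C :: "nat \<Rightarrow> nat \<Rightarrow> complex" and p :: "nat \<Rightarrow> complex"
  assumes zero: "\<And>i. i < 3 \<Longrightarrow> quad (C i) (p 0) (p 1) (p 2) = 0"
    and k: "k < 3" "p k \<noteq> 0"
  shows "sylv_det C = 0"
proof -
  let ?a = "\<lambda>i. hess_vec (C i) p"
  have da: "dot (?a i) p = 0" if "i < 3" for i
    using zero[OF that] by (simp add: dot_hess_vec)
  have "p k * triple (?a 0) (?a 1) (?a 2) = 0"
    using k by (simp add: triple_expand da)
  then have t0: "triple (?a 0) (?a 1) (?a 2) = 0" using k by simp
  have J: "(\<Sum>m<6. bilin_coeffs (jac_pd C j) m * quad_monom p m) = 0" if j: "j < 3" for j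
  proof -
    \<comment> \<open>In each of the three determinants only the row without \<open>p\<close> has a
      nonzero product with \<open>p\<close>. What remains is a column expansion of the vanishing
      determinant, or one of a determinant with a repeated column.\<close>
    have "p k * (\<Sum>m<6. bilin_coeffs (jac_pd C j) m * quad_monom p m) =
       ?a 0 j * cross (?a 1) (?a 2) k + ?a 1 j * cross (?a 2) (?a 0) k + ?a 2 j * cross (?a 0) (?a 1) k"
      unfolding jac_pd_contract ring_distribs triple_expand[OF k(1)] using j
      by (simp add: da dot_hess)
    also have "\<dots> = 0" by (simp only: triple_columns[OF k(1) j] t0 if_cancel)
    finally show ?thesis using k by simp
  qed
  let ?A = "Matrix.mat 6 6 (\<lambda>(r, m). sylv_entry C r m)"
  let ?v = "Matrix.vec 6 (quad_monom p)"
  have row: "(\<Sum>m<6. sylv_entry C r m * quad_monom p m) = 0" if "r < 6" for r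
  proof (cases "r < 3")
    case True
    then show ?thesis using zero[OF True] unfolding quad_eq_sum by (simp add: sylv_entry_def)
  next
    case False
    then show ?thesis using J[of "r - 3"] that by (simp add: sylv_entry_def)
  qed
  have "?A *\<^sub>v ?v = 0\<^sub>v 6"
    by (rule eq_vecI) (simp_all add: scalar_prod_def row flip: atLeast0LessThan[symmetric])
  moreover have "?v \<noteq> 0\<^sub>v 6"
  proof
    assume "?v = 0\<^sub>v 6"
    then have "vec_index ?v (sym_index k k) = vec_index (0\<^sub>v 6) (sym_index k k)" by simp
    then have "p k * p k = 0"
      using less_3_cases[OF k(1)] by (auto simp: sym_index_def quad_monom_def bilin_coeffs_def)
    with k show False by simp
  qed
  ultimately show ?thesis
    unfolding sylv_det_def by (subst det_0_iff_vec_prod_zero_field[of _ 6]) (auto intro!: exI[of _ ?v])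
qed

section \<open>Linear recombination of the three forms\<close>

definition net :: "(nat \<Rightarrow> nat \<Rightarrow> 'a::comm_ring_1) \<Rightarrow> (nat \<Rightarrow> nat \<Rightarrow> 'a) \<Rightarrow> nat \<Rightarrow> nat \<Rightarrow> 'a" where
  "net N C i m = N i 0 * C 0 m + N i 1 * C 1 m + N i 2 * C 2 m"

lemma hess_net: "hess (net N C i) a b = N i 0 * hess (C 0) a b + N i 1 * hess (C 1) a b + N i 2 * hess (C 2) a b"
  by (simp add: hess_def net_def algebra_simps)

lemma det3_multilinear:
  fixes g :: "nat \<Rightarrow> nat \<Rightarrow> 'a::comm_ring_1"
  shows "det3 (\<lambda>i l. \<Sum>k<3. g i k * H i k l) =
     (\<Sum>k<3. \<Sum>l<3. \<Sum>m<3. g 0 k * g 1 l * g 2 m * triple (H 0 k) (H 1 l) (H 2 m))"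
  by (simp add: triple_def det3_def sum_less_3 algebra_simps)

text \<open>Symmetrized over \<open>a, b, d\<close>, the determinant becomes alternating in the
  forms \<open>x, y, z\<close>, which a single summand is not.\<close>

definition polar_jac :: "(nat \<Rightarrow> nat \<Rightarrow> nat \<Rightarrow> 'a::comm_ring_1) \<Rightarrow> nat \<Rightarrow> nat \<Rightarrow> nat \<Rightarrow> nat \<Rightarrow> nat \<Rightarrow> nat \<Rightarrow> 'a" where
  "polar_jac h a b d x y z =
     triple (h x a) (h y b) (h z d) + triple (h x b) (h y a) (h z d) + triple (h x b) (h y d) (h z a) +
     triple (h x a) (h y d) (h z b) + triple (h x d) (h y a) (h z b) + triple (h x d) (h y b) (h z a)"

lemma polar_jac_swap:
  "polar_jac h a b d x y z = - polar_jac h a b d y x z"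
  "polar_jac h a b d x y z = - polar_jac h a b d x z y"
  unfolding polar_jac_def
  by (simp_all add: triple_def det3_def algebra_simps)

lemma polar_jac_eq_0:
  fixes h :: "nat \<Rightarrow> nat \<Rightarrow> nat \<Rightarrow> complex"
  shows "polar_jac h a b d x x z = 0" "polar_jac h a b d x z z = 0" "polar_jac h a b d x z x = 0"
proof -
  show 1: "polar_jac h a b d x x z = 0" for x z
    using polar_jac_swap(1)[of h a b d x x z] by simp
  show "polar_jac h a b d x z z = 0"
    using polar_jac_swap(2)[of h a b d x z z] by simp
  show "polar_jac h a b d x z x = 0"
    using polar_jac_swap(2)[of h a b d x z x] 1[of x z] by simp
qed

lemma polar_jac_perm:
  "polar_jac h a b d 0 2 1 = - polar_jac h a b d 0 1 2"
  "polar_jac h a b d 1 0 2 = - polar_jac h a b d 0 1 2"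
  "polar_jac h a b d 1 2 0 = polar_jac h a b d 0 1 2"
  "polar_jac h a b d 2 0 1 = polar_jac h a b d 0 1 2"
  "polar_jac h a b d 2 1 0 = - polar_jac h a b d 0 1 2"
  by (metis polar_jac_swap add.inverse_inverse)+

lemma jac_tri_net:
  "jac_tri (net N C) a b d =
     (\<Sum>x<3. \<Sum>y<3. \<Sum>z<3. N 0 x * N 1 y * N 2 z * triple (hess (C x) a) (hess (C y) b) (hess (C z) d))"
proof -
  have "jac_tri (net N C) a b d = det3 (\<lambda>i l. \<Sum>k<3. N i k * hess (C k) ([a, b, d] ! i) l)"
    by (simp add: jac_tri_def det3_def hess_net sum_less_3)
  also have "\<dots> = (\<Sum>x<3. \<Sum>y<3. \<Sum>z<3. N 0 x * N 1 y * N 2 z * triple (hess (C x) a) (hess (C y) b) (hess (C z) d))"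
    by (subst det3_multilinear) simp
  finally show ?thesis .
qed

lemma jac_pd_polar: "jac_pd C j k l + jac_pd C j l k = polar_jac (\<lambda>i. hess (C i)) j k l 0 1 2"
proof -
  have "jac_tri C a b d = triple (hess (C 0) a) (hess (C 1) b) (hess (C 2) d)" for a b d
    by (simp add: jac_tri_def triple_def det3_def)
  then show ?thesis by (simp add: jac_pd_def polar_jac_def)
qed

text \<open>Of the 27 terms of the multilinear expansion, alternation leaves the six of
  \<open>det3 N\<close>. The sum over both orders of \<open>k\<close> and \<open>l\<close> is what
  makes the expression symmetric enough for this.\<close>

lemma jac_pd_net:
  fixes C :: "nat \<Rightarrow> nat \<Rightarrow> complex"
  shows "jac_pd (net N C) j k l + jac_pd (net N C) j l k = det3 N * (jac_pd C j k l + jac_pd C j l k)"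
proof -
  let ?P = "polar_jac (\<lambda>i. hess (C i)) j k l"
  have "jac_pd (net N C) j k l + jac_pd (net N C) j l k =
      (\<Sum>x<3. \<Sum>y<3. \<Sum>z<3. N 0 x * N 1 y * N 2 z * ?P x y z)"
    unfolding jac_pd_def jac_tri_net polar_jac_def ring_distribs sum.distrib by simp
  also have "\<dots> = det3 N * ?P 0 1 2"
    by (simp add: sum_less_3 polar_jac_eq_0 polar_jac_perm[simplified] det3_def algebra_simps)
  finally show ?thesis by (simp add: jac_pd_polar)
qed

lemma bilin_coeffs_jac_pd_net:
  fixes C :: "nat \<Rightarrow> nat \<Rightarrow> complex"
  assumes "m < 6"
  shows "bilin_coeffs (jac_pd (net N C) j) m = det3 N * bilin_coeffs (jac_pd C j) m"
proof -
  have "jac_pd (net N C) j k k = det3 N * jac_pd C j k k" for k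
    using jac_pd_net[of N C j k k] by simp
  then show ?thesis
    using less_6_cases[OF assms] by (elim disjE) (simp_all add: bilin_coeffs_def jac_pd_net)
qed

lemma det_list6:
  "Determinant.det (Matrix.mat 6 6 (\<lambda>(i, j). f i j)) = list_det (map (\<lambda>r. map (f r) [0,1,2,3,4,5]) [0,1,2,3,4,5])"
proof (subst det_mat_eq_list_det[symmetric])
  show "Determinant.det (Matrix.mat 6 6 (\<lambda>(x, y). f x y)) =
    Determinant.det (Matrix.mat 6 6 (\<lambda>(i, j). map (\<lambda>r. map (f r) [0,1,2,3,4,5]) [0,1,2,3,4,5] ! i ! j))"
    by (intro arg_cong[where f=Determinant.det] eq_matI) (auto dest!: less_6_cases)
qed auto

lemma det_mat_mult6:
  fixes f g h :: "nat \<Rightarrow> nat \<Rightarrow> 'a::comm_ring_1"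
  assumes "\<And>i j. i < 6 \<Longrightarrow> j < 6 \<Longrightarrow> h i j = (\<Sum>k<6. f i k * g k j)"
  shows "Determinant.det (Matrix.mat 6 6 (\<lambda>(i, j). h i j)) =
    Determinant.det (Matrix.mat 6 6 (\<lambda>(i, j). f i j)) * Determinant.det (Matrix.mat 6 6 (\<lambda>(i, j). g i j))"
proof -
  have "Matrix.mat 6 6 (\<lambda>(i, j). h i j) = Matrix.mat 6 6 (\<lambda>(i, j). f i j) * Matrix.mat 6 6 (\<lambda>(i, j). g i j)"
    by (rule eq_matI) (auto simp: assms scalar_prod_def atLeast0LessThan)
  then show ?thesis by (simp add: Determinant.det_mult[of _ 6])
qed

text \<open>The rows of the forms contribute one factor \<open>det3 N\<close>. The Jacobian
  determinant is multiplied by \<open>det3 N\<close> as well, which gives one factor for each of the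
  three rows of derivatives.\<close>

lemma sylv_det_net:
  fixes C :: "nat \<Rightarrow> nat \<Rightarrow> complex"
  shows "sylv_det (net N C) = det3 N ^ 4 * sylv_det C"
proof -
  define t where "t = det3 N"
  define B where "B r s = (if r < 3 then (if s < 3 then N r s else 0) else if r = s then t else 0)" for r s :: nat
  have "sylv_entry (net N C) r m = (\<Sum>s<6. B r s * sylv_entry C s m)" if "r < 6" "m < 6" for r m
    unfolding sum_less_6 using less_6_cases[OF that(1)]
    by (elim disjE) (simp_all add: B_def t_def sylv_entry_def net_def bilin_coeffs_jac_pd_net[OF that(2)])
  then have "sylv_det (net N C) = Determinant.det (Matrix.mat 6 6 (\<lambda>(i, j). B i j)) * sylv_det C"
    unfolding sylv_det_def by (rule det_mat_mult6)
  also have "Determinant.det (Matrix.mat 6 6 (\<lambda>(i, j). B i j)) = t ^ 3 * det3 N"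
    unfolding det_list6
    by (simp add: B_def, simp add: list_det_eval) (simp add: det3_def algebra_simps power3_eq_cube)
  finally show ?thesis by (simp add: t_def power4_eq_xxxx power3_eq_cube)
qed

section \<open>Linear substitution in the three forms\<close>

definition subst_quad :: "(nat \<Rightarrow> nat \<Rightarrow> 'a::comm_ring_1) \<Rightarrow> (nat \<Rightarrow> 'a) \<Rightarrow> nat \<Rightarrow> 'a" where
  "subst_quad g c = bilin_coeffs (\<lambda>a b. \<Sum>k<3. \<Sum>l<3. (if k \<le> l then c (sym_index k l) else 0) * g k a * g l b)"

text \<open>The symmetric square of \<open>g\<close>: row \<open>n\<close> contains the coefficients
  of the product of the two linear forms substituted for the factors of the \<open>n\<close>-th
  monomial.\<close>

definition sym_square :: "(nat \<Rightarrow> nat \<Rightarrow> 'a::comm_ring_1) \<Rightarrow> nat \<Rightarrow> nat \<Rightarrow> 'a" where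
  "sym_square g n = bilin_coeffs (\<lambda>a b. g ([0,0,0,1,1,2] ! n) a * g ([0,1,2,1,2,2] ! n) b)"

definition mat_app :: "(nat \<Rightarrow> nat \<Rightarrow> 'a::comm_ring_1) \<Rightarrow> (nat \<Rightarrow> 'a) \<Rightarrow> nat \<Rightarrow> 'a" where
  "mat_app g p k = g k 0 * p 0 + g k 1 * p 1 + g k 2 * p 2"

lemma quad_subst_quad:
  "quad (subst_quad g c) (p 0) (p 1) (p 2) = quad c (mat_app g p 0) (mat_app g p 1) (mat_app g p 2)"
  by (simp add: quad_def subst_quad_def bilin_coeffs_def sum_less_3 sym_index_def mat_app_def algebra_simps power2_eq_square)

lemma bilin_coeffs_transform:
  assumes "m < 6"
  shows "bilin_coeffs (\<lambda>a b. \<Sum>k<3. \<Sum>l<3. X k l * g k a * g l b) m = (\<Sum>n<6. bilin_coeffs X n * sym_square g n m)"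
  unfolding sum_less_6 using less_6_cases[OF assms]
  by (elim disjE) (simp_all add: bilin_coeffs_def sym_square_def sum_less_3 algebra_simps)

lemma hess_subst_quad:
  assumes "a < 3" "b < 3"
  shows "hess (subst_quad g c) a b = (\<Sum>l<3. (\<Sum>k<3. g k a * hess c k l) * g l b)"
  using less_3_cases[OF assms(1)] less_3_cases[OF assms(2)]
  by (elim disjE) (simp_all add: hess_def subst_quad_def bilin_coeffs_def sum_less_3 sym_index_def algebra_simps)

lemma det3_mult: "det3 (\<lambda>i k. \<Sum>l<3. P i l * g l k) = det3 P * det3 g"
  by (simp add: det3_def sum_less_3 algebra_simps)

lemma jac_tri_subst:
  assumes "a < 3" "b < 3" "d < 3"
  shows "jac_tri (\<lambda>i. subst_quad g (C i)) a b d =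
    det3 g * (\<Sum>k<3. \<Sum>l<3. \<Sum>m<3. g k a * g l b * g m d * jac_tri C k l m)"
proof -
  have "jac_tri (\<lambda>i. subst_quad g (C i)) a b d =
      det3 (\<lambda>i k. \<Sum>l<3. (\<Sum>k<3. g k ([a, b, d] ! i) * hess (C i) k l) * g l k)"
    using assms by (simp add: jac_tri_def det3_def hess_subst_quad)
  also have "\<dots> = det3 (\<lambda>i l. \<Sum>k<3. g k ([a, b, d] ! i) * hess (C i) k l) * det3 g"
    by (rule det3_mult)
  also have "\<dots> = det3 g * (\<Sum>k<3. \<Sum>l<3. \<Sum>m<3. g k a * g l b * g m d * jac_tri C k l m)"
    by (subst det3_multilinear[where g="\<lambda>i k. g k ([a, b, d] ! i)"]) (simp add: jac_tri_def triple_def det3_def)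
  finally show ?thesis .
qed

lemma jac_pd_subst:
  assumes "a < 3" "b < 3" "d < 3"
  shows "jac_pd (\<lambda>i. subst_quad g (C i)) a b d =
    (\<Sum>l<3. \<Sum>m<3. (\<Sum>k<3. det3 g * g k a * jac_pd C k l m) * g l b * g m d)"
  unfolding jac_pd_def using assms by (simp add: jac_tri_subst sum_less_3 algebra_simps)

lemma bilin_coeffs_sum:
  fixes c :: "nat \<Rightarrow> 'a::comm_ring_1"
  shows "m < 6 \<Longrightarrow> bilin_coeffs (\<lambda>a b. \<Sum>k<3. c k * X k a b) m = (\<Sum>k<3. c k * bilin_coeffs (X k) m)"
  by (drule less_6_cases, elim disjE) (simp_all add: bilin_coeffs_def sum_less_3 algebra_simps)

lemma bilin_coeffs_upper:
  assumes "m < 6"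
  shows "bilin_coeffs (\<lambda>k l. if k \<le> l then c (sym_index k l) else 0) m = c m"
  using less_6_cases[OF assms] by (elim disjE) (simp_all add: bilin_coeffs_def sym_index_def)

text \<open>Composition with \<open>g\<close> multiplies the Jacobian determinant by
  \<open>det3 g\<close>, and by the chain rule its partial derivatives are mixed by the transpose of
  \<open>g\<close>: three factors \<open>det3 g\<close> from the scaling and one from the mixing.
  The substitution itself acts on all rows as the right factor \<open>sym_square g\<close>.\<close>

lemma sylv_det_subst:
  fixes C :: "nat \<Rightarrow> nat \<Rightarrow> complex"
  shows "sylv_det (\<lambda>i. subst_quad g (C i)) =
    det3 g ^ 4 * sylv_det C * Determinant.det (Matrix.mat 6 6 (\<lambda>(i, j). sym_square g i j))"
proof -
  define t where "t = det3 g"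
  define B where "B r s = (if r < 3 then (if r = s then 1 else 0) else if s < 3 then 0 else t * g (s - 3) (r - 3))" for r s :: nat
  define H where "H r m = (\<Sum>n<6. sylv_entry C r n * sym_square g n m)" for r m
  have H1: "sylv_entry (\<lambda>i. subst_quad g (C i)) r m = H r m" if "r < 3" "m < 6" for r m
    unfolding H_def using that
    by (simp add: sylv_entry_def subst_quad_def bilin_coeffs_transform bilin_coeffs_upper)
  have H2: "sylv_entry (\<lambda>i. subst_quad g (C i)) (3 + j) m = (\<Sum>k<3. det3 g * g k j * H (3 + k) m)"
    if "j < 3" "m < 6" for j m
  proof -
    have "sylv_entry (\<lambda>i. subst_quad g (C i)) (3 + j) m = bilin_coeffs (jac_pd (\<lambda>i. subst_quad g (C i)) j) m"
      by (simp add: sylv_entry_def)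
    also have "\<dots> = bilin_coeffs (\<lambda>a b. \<Sum>l<3. \<Sum>m<3. (\<Sum>k<3. det3 g * g k j * jac_pd C k l m) * g l a * g m b) m"
      using that by (intro fun_cong[OF bilin_coeffs_cong] jac_pd_subst)
    also have "\<dots> = (\<Sum>n<6. bilin_coeffs (\<lambda>l m. \<Sum>k<3. det3 g * g k j * jac_pd C k l m) n * sym_square g n m)"
      using that by (intro bilin_coeffs_transform)
    also have "\<dots> = (\<Sum>n<6. (\<Sum>k<3. det3 g * g k j * bilin_coeffs (jac_pd C k) n) * sym_square g n m)"
      by (intro sum.cong refl arg_cong2[where f="(*)"]) (simp add: bilin_coeffs_sum)
    also have "\<dots> = (\<Sum>k<3. det3 g * g k j * H (3 + k) m)"
      by (simp add: H_def sylv_entry_def sum_distrib_left sum_distrib_right mult_ac) (subst sum.swap, simp)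
    finally show ?thesis .
  qed
  have "sylv_entry (\<lambda>i. subst_quad g (C i)) r m = (\<Sum>s<6. B r s * H s m)" if "r < 6" "m < 6" for r m
  proof (cases "r < 3")
    case True
    then show ?thesis unfolding sum_less_6 using less_3_cases[OF True] that H1[OF True that(2)]
      by (elim disjE) (simp_all add: B_def)
  next
    case False
    then have "\<exists>j<3. r = 3 + j" using that by (intro exI[of _ "r - 3"]) auto
    then obtain j where j: "j < 3" "r = 3 + j" by blast
    show ?thesis unfolding j(2) H2[OF j(1) that(2)] sum_less_6 sum_less_3
      using j by (simp add: B_def t_def)
  qed
  then have "sylv_det (\<lambda>i. subst_quad g (C i)) = Determinant.det (Matrix.mat 6 6 (\<lambda>(i, j). B i j)) *
      Determinant.det (Matrix.mat 6 6 (\<lambda>(i, j). H i j))"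
    unfolding sylv_det_def by (rule det_mat_mult6)
  also have "Determinant.det (Matrix.mat 6 6 (\<lambda>(i, j). H i j)) =
      sylv_det C * Determinant.det (Matrix.mat 6 6 (\<lambda>(i, j). sym_square g i j))"
    unfolding sylv_det_def by (rule det_mat_mult6) (simp add: H_def)
  also have "Determinant.det (Matrix.mat 6 6 (\<lambda>(i, j). B i j)) = t ^ 3 * det3 g"
    unfolding det_list6
    by (simp add: B_def, simp add: list_det_eval) (simp add: det3_def algebra_simps power3_eq_cube)
  finally show ?thesis by (simp add: t_def power4_eq_xxxx power3_eq_cube)
qed

lemma sym_square_mult:
  assumes "i < 6" "j < 6"
  shows "sym_square (\<lambda>a b. \<Sum>k<3. g a k * h k b) i j = (\<Sum>k<6. sym_square g i k * sym_square h k j)"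
  unfolding sum_less_6 using less_6_cases[OF assms(1)] less_6_cases[OF assms(2)]
  by (elim disjE) (simp_all add: bilin_coeffs_def sym_square_def sum_less_3 algebra_simps)

lemma sym_square_cong:
  assumes "\<And>a b. a < 3 \<Longrightarrow> b < 3 \<Longrightarrow> g a b = h a b" "i < 6"
  shows "sym_square g i j = sym_square h i j"
  unfolding sym_square_def using less_6_cases[OF assms(2)]
  by (elim disjE) (simp_all add: assms(1) cong: bilin_coeffs_cong)

abbreviation det_sym_square :: "(nat \<Rightarrow> nat \<Rightarrow> complex) \<Rightarrow> complex" where
  "det_sym_square g \<equiv> Determinant.det (Matrix.mat 6 6 (\<lambda>(i, j). sym_square g i j))"

lemma det_sym_square_upper:
  assumes "g 1 0 = 0" "g 2 0 = 0" "g 2 1 = 0"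
  shows "det_sym_square g = det3 g ^ 4"
  unfolding det_list6 using assms
  by (simp add: sym_square_def bilin_coeffs_def, simp add: list_det_eval) (simp add: det3_def power_mult_distrib eval_nat_numeral)

lemma det_sym_square_lower:
  assumes "g 0 1 = 0" "g 0 2 = 0" "g 1 2 = 0" "g 0 0 = 1" "g 1 1 = 1" "g 2 2 = 1"
  shows "det_sym_square g = 1"
  unfolding det_list6 using assms
  by (simp add: sym_square_def bilin_coeffs_def, simp add: list_det_eval)

text \<open>Where its leading minors do not vanish, a matrix has an LU decomposition; the general case
  follows since both sides are polynomials in \<open>s\<close> along the line \<open>1 + s (g - 1)\<close>.\<close>

lemma det_sym_square_LU:
  assumes "g 0 0 \<noteq> 0" "g 0 0 * g 1 1 - g 0 1 * g 1 0 \<noteq> 0"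
  shows "det_sym_square g = det3 g ^ 4"
proof -
  define m where "m = g 0 0 * g 1 1 - g 0 1 * g 1 0"
  define L where "L a b = (if a = b then 1 else if a = 1 \<and> b = 0 then g 1 0 / g 0 0 else if a = 2 \<and> b = 0 then g 2 0 / g 0 0
     else if a = 2 \<and> b = 1 then (g 0 0 * g 2 1 - g 2 0 * g 0 1) / m else 0)" for a b :: nat
  define U where "U a b = (if a = 0 then g 0 b else if a = 1 \<and> b = 1 then m / g 0 0
     else if a = 1 \<and> b = 2 then g 1 2 - g 1 0 / g 0 0 * g 0 2
     else if a = 2 \<and> b = 2 then g 2 2 - g 2 0 / g 0 0 * g 0 2 - L 2 1 * (g 1 2 - g 1 0 / g 0 0 * g 0 2) else 0)" for a b :: nat
  have nz: "g 0 0 \<noteq> 0" "m \<noteq> 0" using assms by (auto simp: m_def)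
  have LU: "g a b = (\<Sum>k<3. L a k * U k b)" if "a < 3" "b < 3" for a b
    using less_3_cases[OF that(1)] less_3_cases[OF that(2)] nz
    by (elim disjE) (simp_all add: sum_less_3 L_def U_def, simp_all add: m_def field_simps)
  have "det_sym_square g = det_sym_square (\<lambda>a b. \<Sum>k<3. L a k * U k b)"
    using sym_square_cong[of g "\<lambda>a b. \<Sum>k<3. L a k * U k b"] LU
    by (intro arg_cong[where f=Determinant.det] eq_matI) auto
  also have "\<dots> = det_sym_square L * det_sym_square U"
    by (rule det_mat_mult6) (rule sym_square_mult)
  also have "\<dots> = det3 U ^ 4"
    by (subst det_sym_square_lower det_sym_square_upper, simp_all add: L_def U_def)+
  also have "det3 U = det3 L * det3 U" by (simp add: det3_def L_def)
  also have "\<dots> = det3 (\<lambda>a b. \<Sum>k<3. L a k * U k b)" by (rule det3_mult[symmetric])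
  also have "\<dots> = det3 g" by (simp add: det3_def flip: LU)
  finally show ?thesis .
qed

lemma det_sym_square: "det_sym_square g = det3 g ^ 4"
proof -
  define h where "h s a b = (if a = b then 1 else 0) + s * (g a b - (if a = b then 1 else 0))" for s :: complex and a b :: nat
  have hp: "univariate (\<lambda>s. h s a b)" for a b
    unfolding h_def by (intro polynomial_intros)
  \<comment> \<open>The product of the first two leading minors; it is \<open>1\<close> at
    \<open>s = 0\<close>, where \<open>h s\<close> is the identity matrix.\<close>
  define f where "f s = h s 0 0 * (h s 0 0 * h s 1 1 - h s 0 1 * h s 1 0)" for s
  have "det_sym_square (h 1) - det3 (h 1) ^ 4 = 0"
  proof (rule univariate_mult_eq_0[where f=f and g="\<lambda>s. det_sym_square (h s) - det3 (h s) ^ 4" and s=0])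
    show "univariate f" unfolding f_def by (intro polynomial_intros hp)
    have "univariate (\<lambda>s. sym_square (h s) i j)" if "i < 6" "j < 6" for i j
      using less_6_cases[OF that(2)] unfolding sym_square_def bilin_coeffs_def
      by (elim disjE) (simp_all, (intro polynomial_intros hp)+)
    then show "univariate (\<lambda>s. det_sym_square (h s) - det3 (h s) ^ 4)"
      unfolding det3_def by (intro polynomial_intros hp)
    show "f s * (det_sym_square (h s) - det3 (h s) ^ 4) = 0" for s
      using det_sym_square_LU[of "h s"] by (auto simp: f_def)
    show "f 0 \<noteq> 0" by (simp add: f_def h_def)
  qed
  moreover have "h 1 = g" by (intro ext) (simp add: h_def)
  ultimately show ?thesis by simp
qed

lemma sylv_det_subst_quad:
  fixes C :: "nat \<Rightarrow> nat \<Rightarrow> complex"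
  shows "sylv_det (\<lambda>i. subst_quad g (C i)) = det3 g ^ 8 * sylv_det C"
  unfolding sylv_det_subst det_sym_square by (simp flip: power_add)

section \<open>A vanishing determinant forces a common zero\<close>

lemma exists_eigenvector:
  fixes T :: "complex^'n \<Rightarrow> complex^'n" and W :: "(complex^'n) set"
  assumes add: "\<And>x y. T (x + y) = T x + T y" and scale: "\<And>c x. T (c *s x) = c *s T x"
    and W_add: "\<And>x y. x \<in> W \<Longrightarrow> y \<in> W \<Longrightarrow> x + y \<in> W" and W_scale: "\<And>c x. x \<in> W \<Longrightarrow> c *s x \<in> W"
    and W_T: "\<And>x. x \<in> W \<Longrightarrow> T x \<in> W" and w: "w \<in> W" "w \<noteq> 0"
  obtains r u where "u \<in> W" "u \<noteq> 0" "T u = r *s u"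
proof -
  \<comment> \<open>\<open>E p v\<close> is \<open>p(T) v\<close>. A linear dependence among the
    iterates of \<open>w\<close> gives a \<open>p\<close> with \<open>p(T) w = 0\<close>. Splitting
    off a root \<open>r\<close> of \<open>p\<close> either exhibits \<open>v\<close> as an
    eigenvector or replaces it by the nonzero vector \<open>T v - r v\<close> and lowers the
    degree.\<close>
  define E where "E p v = (\<Sum>i\<le>degree p. coeff p i *s (T ^^ i) v)" for p v
  have E_bound: "E p v = (\<Sum>i\<le>n. coeff p i *s (T ^^ i) v)" if "degree p \<le> n" for p v n
    unfolding E_def using that
    by (intro sum.mono_neutral_left) (auto simp: coeff_eq_0)
  have pow_add: "(T ^^ i) (x + y) = (T ^^ i) x + (T ^^ i) y" and pow_scale: "(T ^^ i) (c *s x) = c *s (T ^^ i) x" for i c x y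
    by (induction i) (auto simp: add scale)
  have lin: "c *s x - (r * c) *s y = c *s (x + (- r) *s y)" for c r and x y :: "complex^'n"
    by (simp add: Finite_Cartesian_Product.vec_eq_iff algebra_simps)
  have of_real_smult: "complex_of_real a *s x = a *\<^sub>R x" for a and x :: "complex^'n"
    unfolding Finite_Cartesian_Product.vec_eq_iff vector_smult_component vector_scaleR_component
    by (simp add: scaleR_conv_of_real)
  have E_step: "E ([:- r, 1:] * q) v = E q (T v + (- r) *s v)" for r q v
  proof -
    let ?n = "Suc (degree q)"
    have deg: "degree ([:- r, 1:] * q) \<le> ?n"
      using degree_mult_le[of "[:- r, 1:]" q] by simp
    have co: "coeff ([:- r, 1:] * q) i = (if i = 0 then 0 else coeff q (i - 1)) - r * coeff q i" for i
      by (simp add: coeff_pCons split: nat.split)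
    have "E ([:- r, 1:] * q) v = (\<Sum>i\<le>?n. (if i = 0 then 0 else coeff q (i - 1)) *s (T ^^ i) v) - (\<Sum>i\<le>?n. (r * coeff q i) *s (T ^^ i) v)"
      unfolding E_bound[OF deg] co by (simp add: vector_sub_rdistrib vec.scale_left_diff_distrib sum_subtractf del: sum.atMost_Suc)
    also have "(\<Sum>i\<le>?n. (if i = 0 then 0 else coeff q (i - 1)) *s (T ^^ i) v) = (\<Sum>i\<le>degree q. coeff q i *s (T ^^ i) (T v))"
      by (subst sum.atMost_Suc_shift) (simp add: funpow_swap1)
    also have "(\<Sum>i\<le>?n. (r * coeff q i) *s (T ^^ i) v) = (\<Sum>i\<le>degree q. (r * coeff q i) *s (T ^^ i) v)"
      by (simp add: coeff_eq_0)
    also have "(\<Sum>i\<le>degree q. coeff q i *s (T ^^ i) (T v)) - \<dots> = E q (T v + (- r) *s v)"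
      unfolding E_def sum_subtractf[symmetric]
      by (intro sum.cong refl) (simp only: pow_add pow_scale lin)
    finally show ?thesis .
  qed
  have "\<exists>u r. u \<in> W \<and> u \<noteq> 0 \<and> T u = r *s u"
    if "degree p = n" "p \<noteq> 0" "E p v = 0" "v \<in> W" "v \<noteq> 0" for n p v
    using that
  proof (induction n arbitrary: p v)
    case 0
    then obtain c where "p = [:c:]" "c \<noteq> 0" by (metis degree_0_id pCons_eq_0_iff degree_eq_zeroE)
    with 0 show ?case by (simp add: E_def)
  next
    case (Suc n)
    obtain r where "poly p r = 0"
      using fundamental_theorem_of_algebra[of p] Suc.prems by (auto simp: constant_degree)
    then obtain q where q: "p = [:- r, 1:] * q" by (metis dvdE poly_eq_0_iff_dvd)
    have q0: "q \<noteq> 0" using Suc.prems q by auto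
    have dq: "degree q = n" using Suc.prems(1) q0 unfolding q by (subst (asm) degree_mult_eq) auto
    let ?u = "T v + (- r) *s v"
    show ?case
    proof (cases "?u = 0")
      case True
      then have "T v = r *s v" by (simp add: Finite_Cartesian_Product.vec_eq_iff)
      then show ?thesis using Suc.prems by blast
    next
      case False
      have "E q ?u = 0" using Suc.prems(3) unfolding q E_step .
      moreover have "?u \<in> W" using Suc.prems W_add W_scale W_T by blast
      ultimately show ?thesis using Suc.IH dq q0 False by blast
    qed
  qed
  moreover have "\<exists>p. p \<noteq> 0 \<and> E p w = 0"
  proof -
    let ?N = "DIM(complex^'n)"
    let ?f = "\<lambda>i. (T ^^ i) w"
    show ?thesis
    \<comment> \<open>The dimension argument counts the set of iterates, so a repeated iterate is
      treated separately. In the other case the real dimension is enough, as real coefficients are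
      also complex ones.\<close>
    proof (cases "inj_on ?f {..?N}")
      case False
      then obtain i j where ij: "i \<le> ?N" "j \<le> ?N" "i \<noteq> j" "?f i = ?f j" by (auto simp: inj_on_def)
      define p where "p = monom (1::complex) i - monom 1 j"
      have "p \<noteq> 0" using ij by (auto simp: p_def monom_eq_iff')
      moreover have "degree p \<le> ?N" unfolding p_def
        using ij by (intro degree_diff_le) (auto intro: order.trans[OF degree_monom_le])
      then have "E p w = (\<Sum>k\<le>?N. coeff p k *s ?f k)" by (rule E_bound)
      then have "E p w = (\<Sum>k\<le>?N. (if i = k then ?f k else 0)) - (\<Sum>k\<le>?N. (if j = k then ?f k else 0))"
        unfolding p_def sum_subtractf[symmetric]
        by (auto intro!: sum.cong simp: vector_sub_rdistrib vec.scale_left_diff_distrib)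
      then have "E p w = 0" using ij by simp
      ultimately show ?thesis by blast
    next
      case True
      then have "card (?f ` {..?N}) > ?N" by (simp add: card_image)
      then have "dependent (?f ` {..?N})" by (intro dependent_biggerset) auto
      then obtain c :: "complex^'n \<Rightarrow> real" where c: "\<exists>v\<in>?f ` {..?N}. c v \<noteq> 0" "(\<Sum>v\<in>?f ` {..?N}. c v *\<^sub>R v) = 0"
        by (auto simp: dependent_finite)
      define p where "p = (\<Sum>k\<le>?N. monom (complex_of_real (c (?f k))) k)"
      have cp: "coeff p k = (if k \<le> ?N then complex_of_real (c (?f k)) else 0)" for k
        unfolding p_def by (auto simp: coeff_sum)
      have "p \<noteq> 0" (is ?nz) using c(1) cp by (metis (no_types, lifting) atMost_iff coeff_0 imageE of_real_eq_0_iff)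
      have "degree p \<le> ?N" by (rule degree_le) (simp add: cp)
      then have "E p w = (\<Sum>k\<le>?N. coeff p k *s ?f k)" by (rule E_bound)
      also have "\<dots> = (\<Sum>k\<le>?N. c (?f k) *\<^sub>R ?f k)"
        by (intro sum.cong refl) (simp add: cp of_real_smult)
      also have "\<dots> = 0" using c(2) by (subst (asm) sum.reindex[OF True]) simp
      finally have "E p w = 0" .
      with \<open>p \<noteq> 0\<close> show ?thesis by blast
    qed
  qed
  ultimately show thesis using that w by metis
qed

definition has_common_zero :: "(nat \<Rightarrow> nat \<Rightarrow> complex) \<Rightarrow> bool" where
  "has_common_zero C \<longleftrightarrow> (\<exists>p :: nat \<Rightarrow> complex. (\<exists>k<3. p k \<noteq> 0) \<and> (\<forall>i<3. quad (C i) (p 0) (p 1) (p 2) = 0))"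

lemma dot_rows_eq_0:
  fixes g :: "nat \<Rightarrow> nat \<Rightarrow> complex"
  assumes "det3 g \<noteq> 0" "\<And>i. i < 3 \<Longrightarrow> dot (g i) p = 0" "k < 3"
  shows "p k = 0"
proof -
  have "p k * triple (g 0) (g 1) (g 2) = 0"
    unfolding triple_expand[OF assms(3)] by (simp add: assms(2))
  moreover have "triple (g 0) (g 1) (g 2) = det3 g" by (simp add: triple_def det3_def)
  ultimately show ?thesis using assms by simp
qed

lemma has_common_zero_subst:
  assumes "det3 g \<noteq> 0" "has_common_zero (\<lambda>i. subst_quad g (C i))"
  shows "has_common_zero C"
proof -
  obtain p :: "nat \<Rightarrow> complex" and k :: nat where p: "k < 3" "p k \<noteq> 0" "\<And>i. i < 3 \<Longrightarrow> quad (subst_quad g (C i)) (p 0) (p 1) (p 2) = 0"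
    using assms(2) unfolding has_common_zero_def by blast
  have "\<exists>k<3. mat_app g p k \<noteq> 0"
  proof (rule ccontr)
    assume "\<not> ?thesis"
    then have "dot (g i) p = 0" if "i < 3" for i using that by (auto simp: mat_app_def dot_def)
    with dot_rows_eq_0[OF assms(1) _ p(1)] p(2) show False by blast
  qed
  with p show ?thesis unfolding has_common_zero_def quad_subst_quad by blast
qed

lemma has_common_zero_net:
  assumes "det3 N \<noteq> 0" "has_common_zero (net N C)"
  shows "has_common_zero C"
proof -
  obtain p :: "nat \<Rightarrow> complex" and k :: nat where p: "k < 3" "p k \<noteq> 0" "\<And>i. i < 3 \<Longrightarrow> quad (net N C i) (p 0) (p 1) (p 2) = 0"
    using assms(2) unfolding has_common_zero_def by blast
  let ?q = "\<lambda>i. quad (C i) (p 0) (p 1) (p 2)"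
  have "dot (N i) ?q = 0" if "i < 3" for i
    using p(3)[OF that] by (simp add: dot_def quad_def net_def algebra_simps)
  then have "?q i = 0" if "i < 3" for i
    using dot_rows_eq_0[OF assms(1), of ?q i] that by blast
  with p show ?thesis unfolding has_common_zero_def by blast
qed

text \<open>Invertible substitutions and recombinations preserve this property, so each
  normalization below is a single forward step towards a contradiction.\<close>

definition counterexample :: "(nat \<Rightarrow> nat \<Rightarrow> complex) \<Rightarrow> bool" where
  "counterexample C \<longleftrightarrow> sylv_det C = 0 \<and> \<not> has_common_zero C"

lemma counterexample_subst: "counterexample C \<Longrightarrow> det3 g \<noteq> 0 \<Longrightarrow> counterexample (\<lambda>i. subst_quad g (C i))"
  unfolding counterexample_def using has_common_zero_subst sylv_det_subst_quad by auto

lemma counterexample_net: "counterexample C \<Longrightarrow> det3 N \<noteq> 0 \<Longrightarrow> counterexample (net N C)"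
  unfolding counterexample_def using has_common_zero_net sylv_det_net by auto

lemma vector_4 [simp]:
  fixes a b c d :: "'a::zero"
  shows "(vector [a, b, c, d] :: 'a^4) $ 1 = a" "(vector [a, b, c, d] :: 'a^4) $ 2 = b"
    "(vector [a, b, c, d] :: 'a^4) $ 3 = c" "(vector [a, b, c, d] :: 'a^4) $ 4 = d"
  unfolding vector_def by simp_all

text \<open>A kernel vector \<open>w\<close> is read as a linear functional on the quotient with
  basis \<open>1, x, y, x y\<close>, given by its values on this basis. \<open>X\<close>,
  \<open>Y\<close> and \<open>F\<close> are dual to multiplication by \<open>x\<close>, by
  \<open>y\<close> and by the third form. They commute, so \<open>X\<close> and \<open>Y\<close>
  have a common eigenvector in the kernel of \<open>F\<close>; it is a multiple of the evaluation at
  a point, and that point is the common zero.\<close>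

lemma no_counterexample_normal_form:
  assumes bad: "counterexample C"
    and C0: "C 0 0 = 1" "C 0 1 = 0" "C 0 2 = 0" "C 0 3 = 0"
    and C1: "C 1 0 = 0" "C 1 1 = 0" "C 1 3 = 1" "C 1 4 = 0"
    and C2: "C 2 0 = 0" "C 2 3 = 0"
  shows False
proof -
  define b c a d e l m n where *: "b = C 0 4" "c = C 0 5" "a = C 1 2" "d = C 1 5" "e = C 2 1" "l = C 2 2" "m = C 2 4" "n = C 2 5"
  define M where "M = [[n, l, m, e],
      [e*b*d - l*c, n + e*b*a, - l*b - e*c, m],
      [e*a*c - m*d, - m*a - e*d, n + e*a*b, l],
      [l*b*d + m*a*c + e*c*d, l*a*b - m*d + e*a*c, m*a*b - l*c + e*b*d, n + e*a*b]]"
  have "sylv_det C = sylv_det (\<lambda>i. (!) ([[1, 0, 0, 0, b, c], [0, 0, a, 1, 0, d], [0, e, l, 0, m, n]] ! i))"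
    using C0 C1 C2 by (intro sylv_det_cong) (auto dest!: less_3_cases less_6_cases simp: *)
  then have "list_det M = 0"
    using bad unfolding sylv_det_normal_form M_def[symmetric] counterexample_def by simp
  moreover have "Determinant.det (Matrix.mat 4 4 (\<lambda>(i, j). M ! i ! j)) = list_det M"
    by (rule det_mat_eq_list_det) (auto simp: M_def)
  ultimately obtain v where v: "v \<in> carrier_vec 4" "v \<noteq> 0\<^sub>v 4"
      "Matrix.mat 4 4 (\<lambda>(i, j). M ! i ! j) *\<^sub>v v = 0\<^sub>v 4"
    using det_0_iff_vec_prod_zero_field[of "Matrix.mat 4 4 (\<lambda>(i, j). M ! i ! j)" 4] by auto
  define w :: "complex^4" where "w = vector [vec_index v 0, vec_index v 1, vec_index v 2, vec_index v 3]"
  define X :: "complex^4 \<Rightarrow> complex^4" where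
    "X w = vector [w$2, - (b * w$3) - c * w$1, w$4, a * b * w$2 + b * d * w$1 - c * w$3]" for w
  define Y :: "complex^4 \<Rightarrow> complex^4" where
    "Y w = vector [w$3, w$4, - (a * w$2) - d * w$1, a * b * w$3 + a * c * w$1 - d * w$2]" for w
  define F where "F w = n *s w + l *s X w + m *s Y w + e *s X (Y w)" for w
  have vec4: "x = y \<longleftrightarrow> x$1 = y$1 \<and> x$2 = y$2 \<and> x$3 = y$3 \<and> x$4 = y$4" for x y :: "complex^4"
    by (simp add: Finite_Cartesian_Product.vec_eq_iff forall_4)
  have XY: "X (Y u) = Y (X u)" for u
    by (simp add: vec4 X_def Y_def algebra_simps)
  have Xlin: "X (u + u') = X u + X u'" "X (k *s u) = k *s X u" for u u' k
    by (simp_all add: vec4 X_def algebra_simps)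
  have Ylin: "Y (u + u') = Y u + Y u'" "Y (k *s u) = k *s Y u" for u u' k
    by (simp_all add: vec4 Y_def algebra_simps)
  have Flin: "F (u + u') = F u + F u'" "F (k *s u) = k *s F u" for u u' k
    by (simp_all add: F_def Xlin Ylin vec4 algebra_simps)
  have FX: "F (X u) = X (F u)" for u
    by (simp add: F_def Xlin Ylin XY)
  have FY: "F (Y u) = Y (F u)" for u
    by (simp add: F_def Xlin Ylin XY)
  have "vec_index (Matrix.mat 4 4 (\<lambda>(i, j). M ! i ! j) *\<^sub>v v) i = 0" if "i < 4" for i
    using v(3) that by simp
  then have rows: "(\<Sum>j<4. M ! i ! j * vec_index v j) = 0" if "i < 4" for i
    using that v(1) by (simp add: scalar_prod_def atLeast0LessThan)
  have Fw: "F w = 0"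
    using rows[of 0] rows[of 1] rows[of 2] rows[of 3]
    by (simp add: vec4 F_def X_def Y_def w_def M_def eval_nat_numeral algebra_simps)
  have w0: "w \<noteq> 0"
  proof
    assume w: "w = 0"
    have "vec_index v i = 0" if "i < 4" for i
    proof -
      have "i = 0 \<or> i = 1 \<or> i = 2 \<or> i = 3" using that by auto
      then show ?thesis using w by (auto simp: w_def vec4)
    qed
    then have "v = 0\<^sub>v 4" using v(1) by (intro eq_vecI) auto
    with v(2) show False ..
  qed
  have zero: "X 0 = 0" "Y 0 = 0" by (simp_all add: vec4 X_def Y_def)
  obtain r u where u: "F u = 0" "u \<noteq> 0" "X u = r *s u"
    by (rule exists_eigenvector[of X "{u. F u = 0}" w]) (use Xlin Flin FX zero Fw w0 in auto)
  obtain s t where t: "F t = 0" "X t = r *s t" "t \<noteq> 0" "Y t = s *s t"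
  proof (rule exists_eigenvector[of Y "{u. F u = 0 \<and> X u = r *s u}" u])
    show "Y x \<in> {u. F u = 0 \<and> X u = r *s u}" if "x \<in> {u. F u = 0 \<and> X u = r *s u}" for x
      using that by (simp add: FY XY zero Ylin)
  qed (use u Ylin Flin Xlin in \<open>auto simp: vector_add_ldistrib mult.commute\<close>)
  \<comment> \<open>The eigenvector is proportional to \<open>(1, r, s, r s)\<close>; its other
    components express the first two equations at \<open>(r, s, 1)\<close>.\<close>
  have t2: "t$2 = r * t$1" and t3: "t$3 = s * t$1" and t4: "t$4 = r * t$3"
    and x: "- (b * t$3) - c * t$1 = r * t$2" and y: "- (a * t$2) - d * t$1 = s * t$3"
    using t(2,4) by (simp_all add: vec4 X_def Y_def)
  have t1: "t$1 \<noteq> 0" using t(3) t2 t3 t4 by (auto simp: vec4)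
  have f: "n * t$1 + l * t$2 + m * t$3 + e * t$4 = 0"
    using t(1) by (simp add: F_def vec4 X_def Y_def)
  have "t$1 * (r\<^sup>2 + b * s + c) = r * t$2 - (- (b * t$3) - c * t$1)"
    unfolding t2 t3 by (simp add: algebra_simps power2_eq_square)
  then have "t$1 * (r\<^sup>2 + b * s + c) = 0" using x by simp
  moreover have "t$1 * (s\<^sup>2 + a * r + d) = s * t$3 - (- (a * t$2) - d * t$1)"
    unfolding t2 t3 by (simp add: algebra_simps power2_eq_square)
  then have "t$1 * (s\<^sup>2 + a * r + d) = 0" using y by simp
  moreover have "t$1 * (n + l * r + m * s + e * r * s) = n * t$1 + l * t$2 + m * t$3 + e * t$4"
    unfolding t4 t2 t3 by (simp add: algebra_simps)
  then have "t$1 * (n + l * r + m * s + e * r * s) = 0" using f by simp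
  ultimately have "r\<^sup>2 + b * s + c = 0" "s\<^sup>2 + a * r + d = 0" "n + l * r + m * s + e * r * s = 0"
    using t1 by simp_all
  then have "quad (C i) r s 1 = 0" if "i < 3" for i
    using less_3_cases[OF that] C0 C1 C2 by (elim disjE) (simp_all add: quad_def * algebra_simps)
  then have "has_common_zero C"
    unfolding has_common_zero_def by (intro exI[of _ "\<lambda>i. [r, s, 1] ! i"] conjI exI[of _ 2]) auto
  with bad show False by (simp add: counterexample_def)
qed

lemmas subst_quad_eval = subst_quad_def bilin_coeffs_def sum_less_3 sym_index_def

text \<open>Translating \<open>x\<close> and \<open>y\<close> by multiples of \<open>z\<close>
  completes the squares; the first two forms then clear \<open>x^2\<close> and \<open>y^2\<close>
  from the third.\<close>

lemma no_counterexample_squares: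
  assumes bad: "counterexample C"
    and C0: "C 0 0 = 1" "C 0 1 = 0" "C 0 3 = 0" and C1: "C 1 0 = 0" "C 1 1 = 0" "C 1 3 = 1"
  shows False
proof -
  define g where "g i j = [[1, 0, - C 0 2 / 2], [0, 1, - C 1 4 / 2], [0, 0, 1]] ! i ! j" for i j
  define C' where "C' = (\<lambda>i. subst_quad g (C i))"
  have bad': "counterexample C'" unfolding C'_def
    by (rule counterexample_subst[OF bad]) (simp add: g_def det3_def)
  have C'0: "C' 0 0 = 1" "C' 0 1 = 0" "C' 0 2 = 0" "C' 0 3 = 0"
    and C'1: "C' 1 0 = 0" "C' 1 1 = 0" "C' 1 3 = 1" "C' 1 4 = 0"
    using C0 C1 by (simp_all add: C'_def g_def subst_quad_eval)
  define N where "N i j = [[1, 0, 0], [0, 1, 0], [- C' 2 0, - C' 2 3, 1]] ! i ! j" for i j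
  have "counterexample (net N C')"
    by (rule counterexample_net[OF bad']) (simp add: N_def det3_def)
  then show False
    by (rule no_counterexample_normal_form) (use C'0 C'1 in \<open>simp_all add: net_def N_def\<close>)
qed

lemma no_counterexample_diag:
  assumes bad: "counterexample C"
    and C0: "C 0 0 = 1" "C 0 1 = 0" and C1: "C 1 0 = 0" "C 1 1 = 0" "C 1 3 \<noteq> 0"
  shows False
proof -
  define N where "N i j = [[1, - C 0 3 / C 1 3, 0], [0, 1 / C 1 3, 0], [0, 0, 1]] ! i ! j" for i j
  have "counterexample (net N C)"
    by (rule counterexample_net[OF bad]) (use C1 in \<open>simp add: N_def det3_def\<close>)
  then show False
    by (rule no_counterexample_squares) (use C0 C1 in \<open>simp_all add: net_def N_def\<close>)
qed

definition swap12 :: "nat \<Rightarrow> nat \<Rightarrow> complex" where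
  "swap12 i j = [[1, 0, 0], [0, 0, 1], [0, 1, 0]] ! i ! j"

lemma counterexample_swap12: "counterexample C \<Longrightarrow> counterexample (net swap12 C)"
  by (rule counterexample_net) (simp_all add: swap12_def det3_def)

lemma net_swap12 [simp]: "net swap12 C 0 = C 0" "net swap12 C (Suc 0) = C 2" "net swap12 C 2 = C 1"
  by (simp_all add: net_def swap12_def fun_eq_iff)

text \<open>Without a term \<open>y^2\<close> in the third form, all depends on the binary forms
  \<open>x^2 + k y^2\<close> and \<open>x y + c y^2\<close> on the line \<open>z = 0\<close>. Unless
  they have a common zero, which the third form shares, their pencil contains the squares of two
  independent linear forms, and these become the new coordinates.\<close>

lemma no_counterexample_cross:
  assumes bad: "counterexample C"
    and C0: "C 0 0 = 1" "C 0 1 = 0" and C1: "C 1 0 = 0" "C 1 1 = 1" and C2: "C 2 0 = 0" "C 2 1 = 0"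
  shows False
proof (cases "C 2 3 = 0")
  case False
  show False
    by (rule no_counterexample_diag[OF counterexample_swap12[OF bad]]) (use False C0 C2 in simp_all)
next
  case True
  define k c where "k = C 0 3" and "c = C 1 3"
  have ne: "c\<^sup>2 + k \<noteq> 0"
  proof
    assume *: "c\<^sup>2 + k = 0"
    have "quad (C i) (- c) 1 0 = 0" if "i < 3" for i
      using less_3_cases[OF that] C0 C1 C2 True *
      by (elim disjE) (simp_all add: quad_def k_def c_def)
    then have "has_common_zero C"
      unfolding has_common_zero_def by (intro exI[of _ "\<lambda>i. [- c, 1, 0] ! i"] conjI exI[of _ 1]) auto
    with bad show False by (simp add: counterexample_def)
  qed
  define r where "r = csqrt (c\<^sup>2 + k)"
  have r: "r\<^sup>2 = c\<^sup>2 + k" "r \<noteq> 0" using ne by (simp_all add: r_def)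
  have k: "k = r\<^sup>2 - c\<^sup>2" using r(1) by simp
  \<comment> \<open>\<open>x^2 + s x y + (k + s c) y^2\<close> is a square exactly if
    \<open>s^2 / 4 = k + s c\<close>; \<open>s\<close> and \<open>t\<close> are the two
    solutions.\<close>
  define s t where st: "s = 2 * c + 2 * r" "t = 2 * c - 2 * r"
  have diff: "s - t \<noteq> 0" using r by (simp add: st)
  have sq: "k + s * c = s\<^sup>2 / 4" "k + t * c = t\<^sup>2 / 4"
    unfolding k st by (simp_all add: power2_eq_square algebra_simps)
  define N where "N i j = [[1, s, 0], [1, t, 0], [0, 0, 1]] ! i ! j" for i j
  have bad': "counterexample (net N C)"
    by (rule counterexample_net[OF bad]) (use diff in \<open>simp add: N_def det3_def\<close>)
  define h where "h = 1 / (s - t)"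
  have h: "h * (s - t) = 1" using diff by (simp add: h_def)
  \<comment> \<open>The inverse of the change to the coordinates \<open>x + s y / 2\<close> and
    \<open>x + t y / 2\<close>.\<close>
  define g where "g i j = [[- t * h, s * h, 0], [2 * h, - 2 * h, 0], [0, 0, 1]] ! i ! j" for i j
  have "det3 g = - 2 * h * (h * (s - t))"
    by (simp add: g_def det3_def algebra_simps)
  then have bad'': "counterexample (\<lambda>i. subst_quad g (net N C i))"
    using h by (intro counterexample_subst[OF bad']) auto
  have n: "net N C 0 0 = 1" "net N C 0 1 = s" "net N C 0 3 = s\<^sup>2 / 4"
    "net N C 1 0 = 1" "net N C 1 1 = t" "net N C 1 3 = t\<^sup>2 / 4"
    using C0 C1 sq by (simp_all add: net_def N_def k_def c_def)
  have g: "g 0 0 = - t * h" "g 0 1 = s * h" "g 1 0 = 2 * h" "g 1 1 = - 2 * h" "g 2 0 = 0" "g 2 1 = 0"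
    by (simp_all add: g_def)
  have "subst_quad g (net N C 0) 0 = (h * (s - t))\<^sup>2" "subst_quad g (net N C 1) 3 = (h * (s - t))\<^sup>2"
    unfolding subst_quad_eval by (simp_all add: n[unfolded One_nat_def] g[unfolded One_nat_def] algebra_simps power2_eq_square)
  moreover have "subst_quad g (net N C 0) 1 = 0" "subst_quad g (net N C 0) 3 = 0"
    "subst_quad g (net N C 1) 0 = 0" "subst_quad g (net N C 1) 1 = 0"
    unfolding subst_quad_eval by (simp_all add: n[unfolded One_nat_def] g[unfolded One_nat_def] algebra_simps power2_eq_square)
  ultimately show False
    using no_counterexample_squares[OF bad''] h by simp
qed

text \<open>One of the last two forms has a term \<open>x y\<close> or \<open>y^2\<close>, since
  otherwise both vanish on the line \<open>z = 0\<close>, on which the first form has a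
  zero.\<close>

lemma no_counterexample_monic:
  assumes bad: "counterexample C"
    and C0: "C 0 0 = 1" "C 0 1 = 0" and C1: "C 1 0 = 0" and C2: "C 2 0 = 0"
  shows False
proof -
  have cross: False if bad: "counterexample C"
    and C0: "C 0 0 = 1" "C 0 1 = 0" and C1: "C 1 0 = 0" "C 1 1 \<noteq> 0" and C2: "C 2 0 = 0" for C
  proof -
    define N where "N i j = [[1, 0, 0], [0, 1 / C 1 1, 0], [0, - C 2 1 / C 1 1, 1]] ! i ! j" for i j
    have "counterexample (net N C)"
      by (rule counterexample_net[OF bad]) (use C1 in \<open>simp add: N_def det3_def\<close>)
    then show False
      by (rule no_counterexample_cross) (use C0 C1 C2 in \<open>simp_all add: net_def N_def\<close>)
  qed
  consider "C 1 1 \<noteq> 0" | "C 2 1 \<noteq> 0" | "C 1 1 = 0" "C 1 3 \<noteq> 0" | "C 2 1 = 0" "C 2 3 \<noteq> 0"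
    | "C 1 1 = 0" "C 1 3 = 0" "C 2 1 = 0" "C 2 3 = 0" by blast
  then show False
  proof cases
    case 1
    then show ?thesis using cross bad C0 C1 C2 by blast
  next
    case 2
    then show ?thesis using cross[OF counterexample_swap12[OF bad]] C0 C1 C2 by simp
  next
    case 3
    then show ?thesis using no_counterexample_diag bad C0 C1 by blast
  next
    case 4
    then show ?thesis using no_counterexample_diag[OF counterexample_swap12[OF bad]] C0 C2 by simp
  next
    case 5
    define r where "r = csqrt (- C 0 3)"
    have "quad (C i) r 1 0 = 0" if "i < 3" for i
      using less_3_cases[OF that] C0 C1 C2 5
      by (elim disjE) (simp_all add: quad_def r_def)
    then have "has_common_zero C"
      unfolding has_common_zero_def by (intro exI[of _ "\<lambda>i. [r, 1, 0] ! i"] conjI exI[of _ 1]) auto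
    with bad show False by (simp add: counterexample_def)
  qed
qed

lemma no_counterexample_leading:
  assumes bad: "counterexample C" and C0: "C 0 0 \<noteq> 0"
  shows False
proof -
  define N where "N i j = [[1 / C 0 0, 0, 0], [- C 1 0 / C 0 0, 1, 0], [- C 2 0 / C 0 0, 0, 1]] ! i ! j" for i j
  define C' where "C' = net N C"
  have bad': "counterexample C'" unfolding C'_def
    by (rule counterexample_net[OF bad]) (use C0 in \<open>simp add: N_def det3_def\<close>)
  have C': "C' 0 0 = 1" "C' 1 0 = 0" "C' 2 0 = 0"
    using C0 by (simp_all add: C'_def net_def N_def)
  define g where "g i j = [[1, - C' 0 1 / 2, 0], [0, 1, 0], [0, 0, 1]] ! i ! j" for i j
  have "counterexample (\<lambda>i. subst_quad g (C' i))"
    by (rule counterexample_subst[OF bad']) (simp add: g_def det3_def)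
  then show False
    by (rule no_counterexample_monic) (use C' in \<open>simp_all add: g_def subst_quad_eval\<close>)
qed

theorem sylv_det_eq_0_iff: "sylv_det C = 0 \<longleftrightarrow> has_common_zero C"
proof
  assume "has_common_zero C"
  then show "sylv_det C = 0" unfolding has_common_zero_def using sylv_det_common_zero by blast
next
  assume det: "sylv_det C = 0"
  show "has_common_zero C"
  proof (rule ccontr)
    assume "\<not> has_common_zero C"
    with det have bad: "counterexample C" by (simp add: counterexample_def)
    have "\<exists>i<3. C i 0 \<noteq> 0"
    proof (rule ccontr)
      assume "\<not> ?thesis"
      then have "has_common_zero C"
        unfolding has_common_zero_def by (intro exI[of _ "\<lambda>i. [1, 0, 0] ! i"] conjI exI[of _ 0]) (auto simp: quad_def)
      with bad show False by (simp add: counterexample_def)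
    qed
    then consider "C 0 0 \<noteq> 0" | "C 1 0 \<noteq> 0" | "C 2 0 \<noteq> 0" using less_3_cases by metis
    then show False
    proof cases
      case 1
      then show ?thesis using no_counterexample_leading bad by blast
    next
      case 2
      define N :: "nat \<Rightarrow> nat \<Rightarrow> complex" where "N i j = [[0, 1, 0], [1, 0, 0], [0, 0, 1]] ! i ! j" for i j
      have "counterexample (net N C)" by (rule counterexample_net[OF bad]) (simp add: N_def det3_def)
      then show ?thesis by (rule no_counterexample_leading) (use 2 in \<open>simp add: net_def N_def\<close>)
    next
      case 3
      define N :: "nat \<Rightarrow> nat \<Rightarrow> complex" where "N i j = [[0, 0, 1], [0, 1, 0], [1, 0, 0]] ! i ! j" for i j
      have "counterexample (net N C)" by (rule counterexample_net[OF bad]) (simp add: N_def det3_def)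
      then show ?thesis by (rule no_counterexample_leading) (use 3 in \<open>simp add: net_def N_def\<close>)
    qed
  qed
qed

section \<open>The resultant of three ternary quadratic forms\<close>

definition var_of :: "nat \<Rightarrow> 3" where "var_of i = [1, 2, 3] ! i"

definition expo :: "nat \<Rightarrow> 3 \<Rightarrow>\<^sub>0 nat" where
  "expo m = Poly_Mapping.single (var_of ([0,0,0,1,1,2] ! m)) 1 + Poly_Mapping.single (var_of ([0,1,2,1,2,2] ! m)) 1"

definition coeff_var :: "nat \<Rightarrow> nat \<Rightarrow> 3 \<times> (3 \<Rightarrow>\<^sub>0 nat)" where
  "coeff_var i m = (var_of i, expo m)"

definition form_coeffs :: "(3 \<times> (3 \<Rightarrow>\<^sub>0 nat) \<Rightarrow> complex) \<Rightarrow> nat \<Rightarrow> nat \<Rightarrow> complex" where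
  "form_coeffs x i m = x (coeff_var i m)"

lemma var_of_simps [simp]: "var_of 0 = 1" "var_of (Suc 0) = 2" "var_of 2 = 3"
  by (simp_all add: var_of_def)

lemma all_less_3: "(\<forall>i<3. P i) \<longleftrightarrow> P 0 \<and> P 1 \<and> P (2::nat)"
  using less_3_cases by fastforce

lemma var_of_cases: "\<exists>i<3. v = var_of i"
  using exhaust_3[of v] by (auto intro: exI[of _ "0::nat"] exI[of _ "1::nat"] exI[of _ "2::nat"])

lemma var_of_eq_iff:
  assumes "i < 3" "j < 3"
  shows "var_of i = var_of j \<longleftrightarrow> i = j"
  using less_3_cases[OF assms(1)] less_3_cases[OF assms(2)] by (elim disjE) simp_all

lemma lookup_expo:
  assumes "i < 3" "m < 6"
  shows "Poly_Mapping.lookup (expo m) (var_of i) =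
     [[2,0,0], [1,1,0], [1,0,1], [0,2,0], [0,1,1], [0,0,2]] ! m ! i"
  using less_3_cases[OF assms(1)] less_6_cases[OF assms(2)]
  by (elim disjE) (simp_all add: expo_def lookup_add lookup_single)

lemma expo_inj: "m < 6 \<Longrightarrow> n < 6 \<Longrightarrow> expo m = expo n \<longleftrightarrow> m = n"
proof
  assume mn: "m < 6" "n < 6" "expo m = expo n"
  have *: "\<forall>i<3. [[2,0,0], [1,1,0], [1,0,1], [0,2,0], [0,1,1], [0,0,2::nat]] ! m ! i =
     [[2,0,0], [1,1,0], [1,0,1], [0,2,0], [0,1,1], [0,0,2]] ! n ! i"
    using mn lookup_expo by metis
  show "m = n"
    using *[rule_format, of 0] *[rule_format, of 1] *[rule_format, of 2] less_6_cases[OF mn(1)] less_6_cases[OF mn(2)]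
    by (elim disjE) simp_all
qed simp

lemma mono_deg_3: "mono_deg \<alpha> = Poly_Mapping.lookup \<alpha> 1 + Poly_Mapping.lookup \<alpha> 2 + Poly_Mapping.lookup \<alpha> (3::3)"
proof -
  have "mono_deg \<alpha> = (\<Sum>v\<in>UNIV. Poly_Mapping.lookup \<alpha> v)"
    unfolding mono_deg_def by (intro sum.mono_neutral_left) (auto simp: in_keys_iff)
  then show ?thesis by (simp only: sum_3)
qed

lemma mono_deg_expo: "m < 6 \<Longrightarrow> mono_deg (expo m) = 2"
  using lookup_expo[of 0 m] lookup_expo[of 1 m] lookup_expo[of 2 m]
  by (auto dest!: less_6_cases simp: mono_deg_3)

lemma sum_eq_2_cases:
  fixes a b c :: nat
  assumes "a + b + c = 2"
  shows "a = 2 \<and> b = 0 \<and> c = 0 \<or> a = 1 \<and> b = 1 \<and> c = 0 \<or> a = 1 \<and> b = 0 \<and> c = 1 \<or>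
    a = 0 \<and> b = 2 \<and> c = 0 \<or> a = 0 \<and> b = 1 \<and> c = 1 \<or> a = 0 \<and> b = 0 \<and> c = 2"
  using assms by presburger

lemma mono_deg_2_expo:
  assumes "mono_deg \<alpha> = 2"
  shows "\<exists>m<6. \<alpha> = expo m"
proof -
  have eq: "\<exists>m<6. \<alpha> = expo m"
    if m: "m < 6" "\<forall>i<3. Poly_Mapping.lookup \<alpha> (var_of i) = [[2,0,0], [1,1,0], [1,0,1], [0,2,0], [0,1,1], [0,0,2]] ! m ! i" for m
  proof -
    have "Poly_Mapping.lookup \<alpha> v = Poly_Mapping.lookup (expo m) v" for v
      using var_of_cases[of v] m by (auto simp: lookup_expo)
    then have "\<alpha> = expo m" by (rule poly_mapping_eqI)
    with m show ?thesis by blast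
  qed
  let ?a = "Poly_Mapping.lookup \<alpha> 1" and ?b = "Poly_Mapping.lookup \<alpha> 2" and ?c = "Poly_Mapping.lookup \<alpha> 3"
  have "?a + ?b + ?c = 2" using assms by (simp add: mono_deg_3)
  from sum_eq_2_cases[OF this] consider "?a = 2" "?b = 0" "?c = 0" | "?a = 1" "?b = 1" "?c = 0" | "?a = 1" "?b = 0" "?c = 1"
    | "?a = 0" "?b = 2" "?c = 0" | "?a = 0" "?b = 1" "?c = 1" | "?a = 0" "?b = 0" "?c = 2"
    by (elim disjE conjE) blast+
  then show ?thesis
    by cases (use eq[of 0] eq[of 1] eq[of 2] eq[of 3] eq[of 4] eq[of 5] in \<open>simp_all add: all_less_3\<close>)
qed

lemma mpoly_eval_quadratic:
  fixes f :: "(3, complex) mpoly"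
  assumes "homogeneous 2 f"
  shows "mpoly_eval x f = quad (\<lambda>m. Poly_Mapping.lookup f (expo m)) (x 1) (x 2) (x 3)"
proof -
  have "Poly_Mapping.keys f \<subseteq> expo ` {..<6}"
    using assms mono_deg_2_expo unfolding homogeneous_def by fast
  then have "mpoly_eval x f = (\<Sum>\<alpha>\<in>expo ` {..<6}. Poly_Mapping.lookup f \<alpha> * monomial_eval x \<alpha>)"
    by (intro mpoly_eval_superset) auto
  also have "\<dots> = (\<Sum>m<6. Poly_Mapping.lookup f (expo m) * monomial_eval x (expo m))"
    by (intro sum.reindex_cong[of expo]) (auto simp: inj_on_def expo_inj)
  also have "\<dots> = quad (\<lambda>m. Poly_Mapping.lookup f (expo m)) (x 1) (x 2) (x 3)"
    unfolding sum_less_6 by (simp add: quad_def expo_def monomial_eval_add power2_eq_square mult.assoc)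
  finally show ?thesis .
qed

text \<open>The coefficients of the triple \<open>x^2, y^2, z^2\<close>, at which the resultant is
  normalized.\<close>

definition squares_point :: "3 \<times> (3 \<Rightarrow>\<^sub>0 nat) \<Rightarrow> complex" where
  "squares_point v = (if \<exists>i<3. v = coeff_var i (sym_index i i) then 1 else 0)"

lemma coeff_var_inj: "i < 3 \<Longrightarrow> j < 3 \<Longrightarrow> m < 6 \<Longrightarrow> n < 6 \<Longrightarrow> coeff_var i m = coeff_var j n \<longleftrightarrow> i = j \<and> m = n"
  by (simp add: coeff_var_def var_of_eq_iff expo_inj)

lemma form_coeffs_squares_point:
  assumes "i < 3" "m < 6"
  shows "form_coeffs squares_point i m = [[1, 0, 0, 0, 0, 0], [0, 0, 0, 1, 0, 0], [0, 0, 0, 0, 0, 1]] ! i ! m"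
proof -
  have "sym_index j j < 6" if "j < 3" for j using that by (auto dest!: less_3_cases simp: sym_index_def)
  then have "form_coeffs squares_point i m = (if m = sym_index i i then 1 else 0)"
    using assms coeff_var_inj by (fastforce simp: form_coeffs_def squares_point_def)
  then show ?thesis using less_3_cases[OF assms(1)] less_6_cases[OF assms(2)]
    by (elim disjE) (simp_all add: sym_index_def)
qed

lemma sylv_det_squares_point: "sylv_det (form_coeffs squares_point) = 512"
  unfolding sylv_det_squares[symmetric]
  by (rule sylv_det_cong) (simp add: form_coeffs_squares_point)

lemma sylv_entry_polynomial_on:
  assumes "\<And>i m. i < 3 \<Longrightarrow> m < 6 \<Longrightarrow> polynomial_on X (\<lambda>x. C x i m)" "r < 6" "m < 6"
  shows "polynomial_on X (\<lambda>x. sylv_entry (C x) r m)"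
proof -
  have sym: "sym_index a b < 6" if "a < 3" "b < 3" for a b
    using that by (auto dest!: less_3_cases simp: sym_index_def)
  have h: "polynomial_on X (\<lambda>x. hess (C x i) a b)" if "i < 3" "a < 3" "b < 3" for i a b
    unfolding hess_def using that assms(1) sym by (cases "a = b") (auto intro!: polynomial_intros)
  have "polynomial_on X (\<lambda>x. jac_tri (C x) a b d)" if "a < 3" "b < 3" "d < 3" for a b d
    unfolding jac_tri_def det3_def using that by (auto intro!: polynomial_intros h)
  then have j: "polynomial_on X (\<lambda>x. jac_pd (C x) a b d)" if "a < 3" "b < 3" "d < 3" for a b d
    unfolding jac_pd_def using that by (intro polynomial_intros) auto
  show ?thesis
  proof (cases "r < 3")
    case True
    then show ?thesis using assms by (simp add: sylv_entry_def)
  next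
    case False
    then have "r - 3 < 3" using assms by simp
    then have "polynomial_on X (\<lambda>x. bilin_coeffs (jac_pd (C x) (r - 3)) m)"
      using less_6_cases[OF assms(3)] j unfolding bilin_coeffs_def
      by (elim disjE) (auto intro!: polynomial_intros)
    then show ?thesis using False by (simp add: sylv_entry_def)
  qed
qed

lemma sylv_det_univariate:
  assumes "\<And>i m. univariate (\<lambda>s. C s i m)"
  shows "univariate (\<lambda>s. sylv_det (C s))"
proof -
  have h: "univariate (\<lambda>s. hess (C s i) a b)" for i a b
    unfolding hess_def by (cases "a = b") (auto intro!: polynomial_intros assms)
  have "univariate (\<lambda>s. jac_tri (C s) a b d)" for a b d
    unfolding jac_tri_def det3_def by (auto intro!: polynomial_intros h)
  then have j: "univariate (\<lambda>s. jac_pd (C s) a b d)" for a b d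
    unfolding jac_pd_def by (intro polynomial_intros) auto
  have "univariate (\<lambda>s. sylv_entry (C s) r m)" if "m < 6" for r m
  proof (cases "r < 3")
    case False
    then show ?thesis using less_6_cases[OF that] j unfolding bilin_coeffs_def sylv_entry_def
      by (elim disjE) (auto intro!: polynomial_intros)
  qed (simp add: sylv_entry_def assms)
  then show ?thesis unfolding sylv_det_def by (intro polynomial_intros)
qed

lemma sylv_det_scale: "sylv_det (\<lambda>i m. s * C i m) = s ^ 12 * sylv_det (C :: nat \<Rightarrow> nat \<Rightarrow> complex)"
proof -
  define N where "N i j = (if i = j then s else 0)" for i j :: nat
  have "sylv_det (\<lambda>i m. s * C i m) = sylv_det (net N C)"
    by (rule sylv_det_cong) (auto dest!: less_3_cases simp: net_def N_def)
  also have "\<dots> = s ^ 12 * sylv_det C"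
    by (simp add: sylv_det_net det3_def N_def power_mult_distrib flip: power_add)
  finally show ?thesis .
qed

abbreviation quadratic_vars :: "(3 \<times> (3 \<Rightarrow>\<^sub>0 nat)) set" where
  "quadratic_vars \<equiv> {(i, \<alpha>). mono_deg \<alpha> = 2}"

text \<open>The values determine the polynomial, so the choice only records its existence.\<close>

definition sylv_poly :: "(3 \<times> (3 \<Rightarrow>\<^sub>0 nat), complex) mpoly" where
  "sylv_poly = (SOME p. (\<forall>m\<in>Poly_Mapping.keys p. Poly_Mapping.keys m \<subseteq> quadratic_vars) \<and>
     (\<forall>x. sylv_det (form_coeffs x) / 512 = mpoly_eval x p))"

lemma sylv_poly:
  shows "\<forall>m\<in>Poly_Mapping.keys sylv_poly. Poly_Mapping.keys m \<subseteq> quadratic_vars"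
    and mpoly_eval_sylv_poly: "mpoly_eval x sylv_poly = sylv_det (form_coeffs x) / 512"
proof -
  have "polynomial_on quadratic_vars (\<lambda>x. sylv_det (form_coeffs x) * (1 / 512))"
    unfolding sylv_det_def
    by (intro polynomial_intros sylv_entry_polynomial_on)
      (auto simp: form_coeffs_def coeff_var_def mono_deg_expo intro!: polynomial_intros)
  then have "\<exists>p. (\<forall>m\<in>Poly_Mapping.keys p. Poly_Mapping.keys m \<subseteq> quadratic_vars) \<and>
     (\<forall>x. sylv_det (form_coeffs x) / 512 = mpoly_eval x p)"
    by (simp add: polynomial_on_def)
  from someI_ex[OF this]
  show "\<forall>m\<in>Poly_Mapping.keys sylv_poly. Poly_Mapping.keys m \<subseteq> quadratic_vars"
    and "mpoly_eval x sylv_poly = sylv_det (form_coeffs x) / 512"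
    unfolding sylv_poly_def[symmetric] by auto
qed

lemma mpoly_eval_sylv_poly_eq_0_iff: "mpoly_eval x sylv_poly = 0 \<longleftrightarrow> has_common_zero (form_coeffs x)"
  by (simp add: mpoly_eval_sylv_poly sylv_det_eq_0_iff)

lemma mpoly_eval_squares_point: "mpoly_eval squares_point sylv_poly = 1"
  by (simp add: mpoly_eval_sylv_poly sylv_det_squares_point)

section \<open>Pencils through the triple of squares\<close>

definition liftable :: "(('v \<Rightarrow> complex) \<Rightarrow> complex \<Rightarrow> complex) \<Rightarrow> bool" where
  "liftable f \<longleftrightarrow> (\<exists>P. \<forall>x t. mpoly_eval x (poly P (Poly_Mapping.single 0 t)) = f x t)"

lemma liftable_const: "liftable (\<lambda>x t. c)"
  unfolding liftable_def by (rule exI[of _ "[:Poly_Mapping.single 0 c:]"]) simp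

lemma liftable_var: "liftable (\<lambda>x t. x v)"
  unfolding liftable_def by (rule exI[of _ "[:Poly_Mapping.single (Poly_Mapping.single v 1) 1:]"]) simp

lemma liftable_id: "liftable (\<lambda>x t. t)"
  unfolding liftable_def by (rule exI[of _ "[:0, 1:]"]) simp

lemma liftable_add: "liftable f \<Longrightarrow> liftable g \<Longrightarrow> liftable (\<lambda>x t. f x t + g x t)"
  unfolding liftable_def
proof (elim exE)
  fix P Q assume "\<forall>x t. mpoly_eval x (poly P (Poly_Mapping.single 0 t)) = f x t"
    "\<forall>x t. mpoly_eval x (poly Q (Poly_Mapping.single 0 t)) = g x t"
  then show "\<exists>P. \<forall>x t. mpoly_eval x (poly P (Poly_Mapping.single 0 t)) = f x t + g x t"
    by (intro exI[of _ "P + Q"]) simp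
qed

lemma liftable_mult: "liftable f \<Longrightarrow> liftable g \<Longrightarrow> liftable (\<lambda>x t. f x t * g x t)"
  unfolding liftable_def
proof (elim exE)
  fix P Q assume "\<forall>x t. mpoly_eval x (poly P (Poly_Mapping.single 0 t)) = f x t"
    "\<forall>x t. mpoly_eval x (poly Q (Poly_Mapping.single 0 t)) = g x t"
  then show "\<exists>P. \<forall>x t. mpoly_eval x (poly P (Poly_Mapping.single 0 t)) = f x t * g x t"
    by (intro exI[of _ "P * Q"]) simp
qed

lemma liftable_power: "liftable f \<Longrightarrow> liftable (\<lambda>x t. f x t ^ n)"
  by (induction n) (auto intro: liftable_const liftable_mult)

lemma liftable_sum: "(\<And>i. i \<in> A \<Longrightarrow> liftable (f i)) \<Longrightarrow> liftable (\<lambda>x t. \<Sum>i\<in>A. f i x t)"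
  by (induction A rule: infinite_finite_induct) (auto intro: liftable_const liftable_add)

lemma liftable_prod: "(\<And>i. i \<in> A \<Longrightarrow> liftable (f i)) \<Longrightarrow> liftable (\<lambda>x t. \<Prod>i\<in>A. f i x t)"
  by (induction A rule: infinite_finite_induct) (auto intro: liftable_const liftable_mult)

lemma liftable_translate: "liftable (\<lambda>x t. mpoly_eval (\<lambda>v. x v + t * c v) p)"
  unfolding mpoly_eval_def
  by (intro liftable_sum liftable_mult liftable_const liftable_prod liftable_power liftable_add liftable_var liftable_id)

text \<open>\<open>p (x + t c)\<close> as a polynomial in \<open>t\<close> over the ring of
  polynomials in \<open>x\<close>, a form in which it can be divided with remainder.\<close>

definition translate :: "('v, complex) mpoly \<Rightarrow> ('v \<Rightarrow> complex) \<Rightarrow> ('v, complex) mpoly poly" where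
  "translate p c = (SOME P. \<forall>x t. mpoly_eval x (poly P (Poly_Mapping.single 0 t)) = mpoly_eval (\<lambda>v. x v + t * c v) p)"

lemma translate: "mpoly_eval x (poly (translate p c) (Poly_Mapping.single 0 t)) = mpoly_eval (\<lambda>v. x v + t * c v) p"
  using liftable_translate[of c p] unfolding liftable_def translate_def by (rule someI2_ex) auto

lemma poly_translate_0: "poly (translate p c) 0 = p"
proof (rule mpoly_eval_eqI)
  show "mpoly_eval x (poly (translate p c) 0) = mpoly_eval x p" for x
    using translate[of x p c 0] by simp
qed

definition coeff_eval :: "('v \<Rightarrow> complex) \<Rightarrow> ('v, complex) mpoly poly \<Rightarrow> complex poly" where
  "coeff_eval x P = (\<Sum>j\<le>degree P. monom (mpoly_eval x (coeff P j)) j)"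

lemma coeff_coeff_eval [simp]: "coeff (coeff_eval x P) j = mpoly_eval x (coeff P j)"
  by (auto simp: coeff_eval_def coeff_sum coeff_eq_0)

lemma poly_coeff_eval: "poly (coeff_eval x P) t = mpoly_eval x (poly P (Poly_Mapping.single 0 t))"
  unfolding coeff_eval_def poly_sum poly_monom by (simp add: poly_altdef[of P])

text \<open>The absolute value of a monic polynomial is the product of the distances to its roots,
  so a small value requires a close root.\<close>

lemma near_root:
  fixes p :: "complex poly"
  assumes "degree p = n" "lead_coeff p = 1" "norm (poly p z) < e ^ n" "e > 0"
  shows "\<exists>w. poly p w = 0 \<and> dist w z < e"
proof (rule ccontr)
  assume none: "\<not> ?thesis"
  obtain root where root: "Polynomial.smult (lead_coeff p) (\<Prod>i<degree p. [:-root i, 1:]) = p"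
    by (rule complex_poly_decompose')
  have eq: "poly p w = (\<Prod>i<n. w - root i)" for w
    using arg_cong[OF root, of "\<lambda>p. poly p w"] assms(1,2) by (simp add: poly_prod)
  have "poly p (root i) = 0" if "i < n" for i
    unfolding eq using that by auto
  then have "e \<le> norm (z - root i)" if "i < n" for i
    using none that by (metis dist_commute dist_norm not_le)
  then have "(\<Prod>i<n. e) \<le> (\<Prod>i<n. norm (z - root i))"
    using assms(4) by (intro prod_mono) auto
  then have "e ^ n \<le> norm (poly p z)" by (simp add: eq prod_norm)
  with assms(3) show False by simp
qed

lemma card_roots_rsquarefree:
  fixes p :: "complex poly"
  assumes "rsquarefree p"
  shows "card {z. poly p z = 0} = degree p"
proof -
  have "p \<noteq> 0" using assms by (simp add: rsquarefree_def)
  have "degree p = degree (Polynomial.smult (lead_coeff p) (\<Prod>z|poly p z = 0. [:-z, 1:]))"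
    by (simp only: complex_poly_decompose_rsquarefree[OF assms])
  also have "\<dots> = degree (\<Prod>z|poly p z = 0. [:-z, 1:])" using \<open>p \<noteq> 0\<close> by simp
  also have "\<dots> = card {z. poly p z = 0}" by (subst degree_prod_sum_eq) auto
  finally show ?thesis by simp
qed

text \<open>By homogeneity of degree 12 the value at \<open>x + t c\<close> is \<open>t ^ 12\<close>
  times the value at \<open>c + x / t\<close>. With \<open>c\<close> the triple of squares, the top
  coefficient is the value \<open>1\<close> at \<open>c\<close>.\<close>

lemma coeff_eval_translate_sylv_poly:
  defines "P \<equiv> translate sylv_poly squares_point"
  shows "coeff (coeff_eval x P) 12 = 1" "12 < j \<Longrightarrow> coeff (coeff_eval x P) j = 0"
proof -
  let ?Q = "coeff_eval x P"
  define f where "f s = sylv_det (\<lambda>i m. form_coeffs squares_point i m + s * form_coeffs x i m) / 512" for s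
  have "univariate (\<lambda>s. f s)" unfolding f_def divide_inverse
    by (intro polynomial_intros sylv_det_univariate)
  then obtain r where r: "\<And>s. f s = poly r s" unfolding univariate_def by blast
  have r0: "coeff r 0 = 1"
    using r[of 0] by (simp add: f_def sylv_det_squares_point poly_0_coeff_0)
  have Q: "poly ?Q t = t ^ 12 * poly r (inverse t)" if "t \<noteq> 0" for t
  proof -
    have "poly ?Q t = sylv_det (form_coeffs (\<lambda>v. x v + t * squares_point v)) / 512"
      by (simp add: poly_coeff_eval P_def translate mpoly_eval_sylv_poly)
    also have "form_coeffs (\<lambda>v. x v + t * squares_point v) =
        (\<lambda>i m. t * (form_coeffs squares_point i m + inverse t * form_coeffs x i m))"
      using that by (intro ext) (simp add: form_coeffs_def field_simps)
    finally show ?thesis by (simp add: sylv_det_scale f_def flip: r)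
  qed
  \<comment> \<open>The factor \<open>t ^ degree r\<close> clears the inverse powers of
    \<open>t\<close>, so that coefficients can be compared.\<close>
  have "monom 1 (degree r) * ?Q - monom 1 12 * reflect_poly r = 0"
  proof (rule ccontr)
    assume "monom 1 (degree r) * ?Q - monom 1 12 * reflect_poly r \<noteq> 0" (is "?D \<noteq> 0")
    then have "finite {t. poly ?D t = 0}" by (rule poly_roots_finite)
    moreover have "poly ?D t = 0" if "t \<noteq> 0" for t
      using Q[OF that] poly_reflect_poly_nz[OF that, of r] by (simp add: poly_monom)
    then have "UNIV - {0} \<subseteq> {t. poly ?D t = 0}" by auto
    ultimately have "finite (UNIV - {0 :: complex})" by (rule rev_finite_subset)
    then show False using infinite_UNIV_char_0[where 'a=complex] by simp
  qed
  then have eq: "coeff (monom 1 (degree r) * ?Q) k = coeff (monom 1 12 * reflect_poly r) k" for k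
    by simp
  have "coeff ?Q j = coeff (monom 1 12 * reflect_poly r) (degree r + j)" for j
    using eq[of "degree r + j"] by (simp add: coeff_monom_mult)
  then show "coeff ?Q 12 = 1" "12 < j \<Longrightarrow> coeff ?Q j = 0"
    using r0 by (simp_all add: coeff_monom_mult coeff_reflect_poly)
qed

lemma coeff_eval_translate_monic:
  defines "P \<equiv> translate sylv_poly squares_point"
  shows "degree (coeff_eval x P) = 12" "lead_coeff (coeff_eval x P) = 1"
proof -
  have "degree (coeff_eval x P) \<le> 12"
    using coeff_eval_translate_sylv_poly(2) by (intro degree_le) (simp add: P_def)
  moreover have "12 \<le> degree (coeff_eval x P)"
    using coeff_eval_translate_sylv_poly(1)[of x] by (intro le_degree) (simp add: P_def)
  ultimately show d: "degree (coeff_eval x P) = 12" by simp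
  show "lead_coeff (coeff_eval x P) = 1"
    unfolding d using coeff_eval_translate_sylv_poly(1) by (simp add: P_def)
qed

lemma translate_sylv_poly_monic:
  defines "P \<equiv> translate sylv_poly squares_point"
  shows "degree P = 12" "lead_coeff P = 1"
proof -
  have 1: "coeff P 12 = 1"
    using coeff_eval_translate_sylv_poly(1) by (intro mpoly_eval_eqI) (simp add: P_def)
  have "coeff P j = 0" if "12 < j" for j
    using coeff_eval_translate_sylv_poly(2)[OF that] by (intro mpoly_eval_eqI) (simp add: P_def)
  then have "degree P \<le> 12" by (intro degree_le) auto
  moreover have "12 \<le> degree P" using 1 by (intro le_degree) simp
  ultimately show d: "degree P = 12" by simp
  show "lead_coeff P = 1" unfolding d by (rule 1)
qed

text \<open>On the line \<open>x + t \<cdot> squares_point\<close> through this point, \<open>sylv_poly\<close> is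
  \<open>t\<^sup>1\<^sup>2 + 2 t\<^sup>6 - 3 t\<^sup>3 + 1\<close>, which has no multiple roots.\<close>

definition separable_point :: "3 \<times> (3 \<Rightarrow>\<^sub>0 nat) \<Rightarrow> complex" where
  "separable_point v = (\<Sum>i<3. \<Sum>m<6. if v = coeff_var i m
     then [[0, 0, 1, -1, 0, 0], [0, 0, 0, 0, 0, 1], [1, 0, 0, 0, 1, 0]] ! i ! m else 0)"

lemma sum_coeff_var:
  assumes "i < 3" "m < 6"
  shows "(\<Sum>j<3. \<Sum>n<6. if coeff_var i m = coeff_var j n then g j n else 0) = (g i m :: complex)"
proof -
  have "(\<Sum>j<3. \<Sum>n<6. if coeff_var i m = coeff_var j n then g j n else 0) =
      (\<Sum>j<3. if i = j then (\<Sum>n<6. if m = n then g j n else 0) else 0)"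
    using assms coeff_var_inj by (intro sum.cong refl) (auto intro!: sum.neutral sum.cong)
  also have "\<dots> = g i m" using assms by simp
  finally show ?thesis .
qed

lemma separable_point_roots:
  "card {t. poly (coeff_eval separable_point (translate sylv_poly squares_point)) t = 0} = 12"
proof -
  let ?Q = "coeff_eval separable_point (translate sylv_poly squares_point)"
  let ?q = "monom 1 12 + monom 2 6 - monom 3 3 + (1 :: complex poly)"
  have "poly ?Q t = t ^ 12 + 2 * t ^ 6 - 3 * t ^ 3 + 1" for t
  proof -
    have "sylv_det (form_coeffs (\<lambda>v. separable_point v + t * squares_point v)) =
        sylv_det (\<lambda>i. (!) ([[t, 0, 1, -1, 0, 0], [0, 0, 0, t, 0, 1], [1, 0, 0, 0, 1, t]] ! i))"
    proof (rule sylv_det_cong)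
      fix i m :: nat assume im: "i < 3" "m < 6"
      have "form_coeffs (\<lambda>v. separable_point v + t * squares_point v) i m =
          [[0, 0, 1, -1, 0, 0], [0, 0, 0, 0, 0, 1], [1, 0, 0, 0, 1, 0]] ! i ! m + t * form_coeffs squares_point i m"
        unfolding form_coeffs_def separable_point_def sum_coeff_var[OF im] by simp
      also have "\<dots> = [[t, 0, 1, -1, 0, 0], [0, 0, 0, t, 0, 1], [1, 0, 0, 0, 1, t]] ! i ! m"
        unfolding form_coeffs_squares_point[OF im] using less_3_cases[OF im(1)] less_6_cases[OF im(2)]
        by (elim disjE) simp_all
      finally show "form_coeffs (\<lambda>v. separable_point v + t * squares_point v) i m = \<dots>" .
    qed
    then show ?thesis
      by (simp add: poly_coeff_eval translate mpoly_eval_sylv_poly sylv_det_pencil)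
  qed
  then have Q: "?Q = ?q" by (intro poly_ext) (simp add: poly_monom)
  have "rsquarefree ?q"
    unfolding rsquarefree_roots
  proof (intro allI notI)
    fix t assume "poly ?q t = 0 \<and> poly (pderiv ?q) t = 0"
    then have 1: "t ^ 12 + 2 * t ^ 6 - 3 * t ^ 3 + 1 = 0" and 2: "12 * t ^ 11 + 12 * t ^ 5 - 9 * t ^ 2 = 0"
      by (simp_all add: poly_monom pderiv_add pderiv_diff pderiv_monom)
    \<comment> \<open>In \<open>u = t ^ 3\<close> the Euclidean algorithm for the quartic and its
      derivative ends in the constant -117.\<close>
    define u where "u = t ^ 3"
    have t12: "t ^ 12 = u ^ 4" "t ^ 6 = u ^ 2" by (simp_all add: u_def flip: power_mult)
    have "t \<noteq> 0" using 1 by auto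
    moreover have "3 * t\<^sup>2 * (4 * u ^ 3 + 4 * u - 3) = 0"
      using 2 by (simp add: u_def algebra_simps flip: power_mult power_add)
    ultimately have v: "4 * u ^ 3 + 4 * u - 3 = 0" by simp
    have w: "u ^ 4 + 2 * u ^ 2 - 3 * u + 1 = 0" using 1 unfolding t12 u_def[symmetric] .
    have "4 * u\<^sup>2 - 9 * u + 4 = 4 * (u ^ 4 + 2 * u\<^sup>2 - 3 * u + 1) - u * (4 * u ^ 3 + 4 * u - 3)"
      by (simp add: algebra_simps power2_eq_square power3_eq_cube power4_eq_xxxx)
    then have a: "4 * u\<^sup>2 - 9 * u + 4 = 0" using v w by simp
    have "9 * u\<^sup>2 - 3 = (4 * u ^ 3 + 4 * u - 3) - u * (4 * u\<^sup>2 - 9 * u + 4)"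
      by (simp add: algebra_simps power2_eq_square power3_eq_cube)
    then have b: "9 * u\<^sup>2 - 3 = 0" using v a by simp
    have "81 * u - 48 = 4 * (9 * u\<^sup>2 - 3) - 9 * (4 * u\<^sup>2 - 9 * u + 4)"
      by (simp add: algebra_simps)
    then have c: "81 * u - 48 = 0" using a b by simp
    have "(- 117 :: complex) = (81 * u + 48) * (81 * u - 48) - 729 * (9 * u\<^sup>2 - 3)"
      by (simp add: algebra_simps power2_eq_square)
    also have "\<dots> = 0" unfolding b c by simp
    finally have "(- 117 :: complex) = 0" .
    then show False by simp
  qed
  then have "card {t. poly ?q t = 0} = degree ?q" by (rule card_roots_rsquarefree)
  also have "degree ?q = 12" unfolding Q[symmetric] by (rule coeff_eval_translate_monic)
  finally show ?thesis unfolding Q .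
qed

text \<open>Roots move continuously: for small \<open>s\<close> a root remains within
  \<open>e\<close> of each of the twelve simple roots at \<open>separable_point\<close>, and as
  these are at least \<open>2 * e\<close> apart the new roots are distinct.\<close>

lemma translate_sylv_poly_roots:
  fixes x :: "3 \<times> (3 \<Rightarrow>\<^sub>0 nat) \<Rightarrow> complex"
  defines "y \<equiv> \<lambda>s v. separable_point v + s * (x v - separable_point v)"
  shows "\<exists>d>0. \<forall>s. norm s < d \<longrightarrow>
    card {t. poly (coeff_eval (y s) (translate sylv_poly squares_point)) t = 0} \<ge> 12"
proof -
  let ?Q = "\<lambda>s. coeff_eval (y s) (translate sylv_poly squares_point)"
  define Z where "Z = {t. poly (?Q 0) t = 0}"
  have cardZ: "card Z = 12" unfolding Z_def y_def using separable_point_roots by simp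
  then have finZ: "finite Z" by (metis card.infinite zero_neq_numeral)
  have "\<exists>e>0. \<forall>z\<in>Z. \<forall>w\<in>Z. z \<noteq> w \<longrightarrow> 2 * e \<le> dist z w"
  proof -
    define D where "D = insert 1 ((\<lambda>p. dist (fst p) (snd p)) ` {p \<in> Z \<times> Z. fst p \<noteq> snd p})"
    have fin: "finite D" using finZ by (simp add: D_def)
    have "Min D \<in> D" using fin by (intro Min_in) (auto simp: D_def)
    then have "Min D > 0" by (auto simp: D_def)
    moreover have "Min D \<le> dist z w" if "z \<in> Z" "w \<in> Z" "z \<noteq> w" for z w
      using fin that by (intro Min_le) (force simp: D_def)+
    ultimately show ?thesis by (intro exI[of _ "Min D / 2"]) auto
  qed
  then obtain e where e: "e > 0" "\<And>z w. z \<in> Z \<Longrightarrow> w \<in> Z \<Longrightarrow> z \<noteq> w \<Longrightarrow> 2 * e \<le> dist z w"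
    by blast
  have cont: "\<forall>\<^sub>F s in at 0. norm (poly (?Q s) z) < e ^ 12" if "z \<in> Z" for z
  proof -
    have "univariate (\<lambda>s. poly (?Q s) z)"
      unfolding poly_coeff_eval translate y_def by (intro polynomial_intros)
    then obtain r where r: "\<And>s. poly (?Q s) z = poly r s" unfolding univariate_def by blast
    have "((\<lambda>s. norm (poly r s)) \<longlongrightarrow> norm (poly r 0)) (at 0)"
      using poly_isCont[where p=r and x=0] by (intro tendsto_norm) (simp add: isCont_def)
    moreover have "norm (poly r 0) < e ^ 12" using r[of 0] that e(1) by (simp add: Z_def)
    ultimately show ?thesis unfolding r by (rule order_tendstoD)
  qed
  then have "\<forall>\<^sub>F s in at 0. \<forall>z\<in>Z. norm (poly (?Q s) z) < e ^ 12"
    using finZ by (simp add: eventually_ball_finite_distrib)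
  then obtain d where d: "d > 0" "\<And>s. s \<noteq> 0 \<Longrightarrow> dist s 0 < d \<Longrightarrow> \<forall>z\<in>Z. norm (poly (?Q s) z) < e ^ 12"
    unfolding eventually_at by blast
  have "card {t. poly (?Q s) t = 0} \<ge> 12" if "norm s < d" for s
  proof (cases "s = 0")
    case True
    then show ?thesis using cardZ by (simp add: Z_def)
  next
    case False
    then have "\<exists>w. poly (?Q s) w = 0 \<and> dist w z < e" if "z \<in> Z" for z
      using d(2)[of s] \<open>norm s < d\<close> that e(1) by (intro near_root[of _ 12] coeff_eval_translate_monic) auto
    then obtain w where w: "\<And>z. z \<in> Z \<Longrightarrow> poly (?Q s) (w z) = 0 \<and> dist (w z) z < e"
      by metis
    have "inj_on w Z"
    proof (rule inj_onI, rule ccontr)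
      fix z z' assume z: "z \<in> Z" "z' \<in> Z" "w z = w z'" "z \<noteq> z'"
      have "dist z z' \<le> dist (w z) z + dist (w z') z'" using z(3) by (metis dist_commute dist_triangle)
      with w[OF z(1)] w[OF z(2)] e(2)[OF z(1,2,4)] show False by simp
    qed
    then have "card Z = card (w ` Z)" by (simp add: card_image)
    also have "\<dots> \<le> card {t. poly (?Q s) t = 0}"
    proof (intro card_mono poly_roots_finite)
      show "?Q s \<noteq> 0" using coeff_eval_translate_monic(1)[of "y s"] by (metis degree_0 zero_neq_numeral)
    qed (use w in auto)
    finally show ?thesis using cardZ by simp
  qed
  with d(1) show ?thesis by blast
qed

text \<open>Takes the place of the Nullstellensatz. \<open>p (x + t c)\<close> is divided by the
  monic \<open>P\<close> in the variable \<open>t\<close>. Near \<open>separable_point\<close>,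
  \<open>P\<close> has twelve distinct roots; each gives a triple with a common zero, so
  \<open>p\<close> vanishes there and with it the remainder, whose degree is below 12. A coefficient
  of the remainder that vanishes near one point of a line vanishes on the whole line; finally
  \<open>t = 0\<close> gives the factorization of \<open>p\<close>.\<close>

lemma sylv_poly_dvd:
  assumes "\<And>x. has_common_zero (form_coeffs x) \<Longrightarrow> mpoly_eval x p = 0"
  shows "sylv_poly dvd p"
proof -
  define P where "P = translate sylv_poly squares_point"
  \<comment> \<open>The divisor is monic, so pseudo-division is honest division with
    remainder.\<close>
  obtain Q r where qr: "pseudo_divmod (translate p squares_point) P = (Q, r)" by (metis surj_pair)
  have P0: "P \<noteq> 0" using translate_sylv_poly_monic(2) by (auto simp: P_def)
  from pseudo_divmod[OF P0 qr] have eq: "translate p squares_point = P * Q + r" and deg: "r = 0 \<or> degree r < 12"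
    using translate_sylv_poly_monic by (simp_all add: P_def)
  have "mpoly_eval x (coeff r j) = 0" for x j
  proof -
    define y where "y s v = separable_point v + s * (x v - separable_point v)" for s v
    obtain d where d: "d > 0" "\<And>s. norm s < d \<Longrightarrow> card {t. poly (coeff_eval (y s) P) t = 0} \<ge> 12"
      using translate_sylv_poly_roots[of x] unfolding y_def P_def by blast
    have zero: "mpoly_eval (y s) (coeff r j) = 0" if s: "norm s < d" for s
    proof -
      have "poly (coeff_eval (y s) r) t = 0" if t: "poly (coeff_eval (y s) P) t = 0" for t
      proof -
        have "mpoly_eval (\<lambda>v. y s v + t * squares_point v) sylv_poly = 0"
          using t by (simp add: poly_coeff_eval P_def translate)
        then have "mpoly_eval (\<lambda>v. y s v + t * squares_point v) p = 0"
          using assms by (simp add: mpoly_eval_sylv_poly_eq_0_iff)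
        then have "mpoly_eval (y s) (poly (P * Q + r) (Poly_Mapping.single 0 t)) = 0"
          unfolding eq[symmetric] by (simp add: translate)
        then show ?thesis using t by (simp add: poly_coeff_eval)
      qed
      then have sub: "{t. poly (coeff_eval (y s) P) t = 0} \<subseteq> {t. poly (coeff_eval (y s) r) t = 0}"
        by auto
      have "coeff_eval (y s) r = 0"
      proof (rule ccontr)
        assume nz: "coeff_eval (y s) r \<noteq> 0"
        then have "r \<noteq> 0" by (auto simp: coeff_eval_def)
        then have "degree r < 12" using deg by simp
        then have "degree (coeff_eval (y s) r) < 12"
          by (intro degree_lessI) (auto simp: coeff_eq_0)
        moreover have "12 \<le> card {t. poly (coeff_eval (y s) r) t = 0}"
          using d(2)[OF s] card_mono[OF poly_roots_finite[OF nz] sub] by linarith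
        ultimately show False using card_poly_roots_bound[OF nz] by linarith
      qed
      then show ?thesis by (metis coeff_0 coeff_coeff_eval)
    qed
    have "univariate (\<lambda>s. mpoly_eval (y s) (coeff r j))" unfolding y_def by (intro polynomial_intros)
    moreover have "infinite {s. mpoly_eval (y s) (coeff r j) = 0}"
    proof
      assume "finite {s. mpoly_eval (y s) (coeff r j) = 0}"
      moreover have "ball 0 d \<subseteq> {s. mpoly_eval (y s) (coeff r j) = 0}" using zero by auto
      ultimately have "finite (ball (0::complex) d)" by (rule rev_finite_subset)
      then show False using uncountable_ball[OF d(1), of 0] countable_finite by blast
    qed
    ultimately have "mpoly_eval (y 1) (coeff r j) = 0" by (rule univariate_zero)
    moreover have "y 1 = x" by (simp add: y_def fun_eq_iff)
    ultimately show ?thesis by simp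
  qed
  then have "r = 0" by (intro poly_eqI mpoly_eval_eqI) simp
  then have "poly (translate p squares_point) 0 = poly P 0 * poly Q 0" using eq by simp
  then show ?thesis by (simp add: poly_translate_0 P_def)
qed

text \<open>The set of triples with a common zero is irreducible: if \<open>p\<close> and \<open>q\<close> are zeros of two such
  triples and \<open>l\<close> is a linear form with \<open>l p = l q = 1\<close>, then along the segment \<open>p\<^sub>s\<close> from \<open>p\<close> to
  \<open>q\<close> the forms \<open>G\<^sub>s - G\<^sub>s(p\<^sub>s) l\<^sup>2\<close>, with \<open>G\<^sub>s\<close> on the segment between the triples, vanish at
  \<open>p\<^sub>s\<close>.\<close>

lemma common_functional:
  fixes p q :: "nat \<Rightarrow> complex"
  assumes "k < 3" "p k \<noteq> 0" "j < 3" "q j \<noteq> 0"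
  shows "\<exists>l. dot l p \<noteq> 0 \<and> dot l q \<noteq> 0"
proof -
  define e where "e k i = (if i = k then 1 else 0 :: complex)" for k i :: nat
  have e: "dot (e k) v = v k" if "k < 3" for k v
    using less_3_cases[OF that] by (elim disjE) (simp_all add: dot_def e_def)
  have ee: "dot (\<lambda>i. e k i + e j i) v = dot (e k) v + dot (e j) v" for v
    by (simp add: dot_def algebra_simps)
  consider "q k \<noteq> 0" | "p j \<noteq> 0" | "q k = 0" "p j = 0" by blast
  then show ?thesis
  proof cases
    case 1
    then show ?thesis using assms e by (intro exI[of _ "e k"]) simp
  next
    case 2
    then show ?thesis using assms e by (intro exI[of _ "e j"]) simp
  next
    case 3
    then show ?thesis using assms e by (intro exI[of _ "\<lambda>i. e k i + e j i"]) (simp add: ee)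
  qed
qed

lemma has_common_zero_normalize:
  assumes "dot l p = 1" "\<And>i. i < 3 \<Longrightarrow> quad (C i) (p 0) (p 1) (p 2) = 0"
  shows "has_common_zero C"
proof -
  have "\<exists>k<3. p k \<noteq> 0"
  proof (rule ccontr)
    assume "\<not> ?thesis"
    then have "p 0 = 0" "p 1 = 0" "p 2 = 0" by auto
    with assms(1) show False by (simp add: dot_def)
  qed
  with assms(2) show ?thesis unfolding has_common_zero_def by blast
qed

lemma has_common_zero_curve:
  assumes "has_common_zero (form_coeffs x)" "has_common_zero (form_coeffs y)"
  obtains z where "z 0 = x" "z 1 = y" "\<And>v. univariate (\<lambda>s. z s v)" "\<And>s. has_common_zero (form_coeffs (z s))"
proof -
  obtain p' :: "nat \<Rightarrow> complex" and k :: nat where p': "k < 3" "p' k \<noteq> 0" "\<And>i. i < 3 \<Longrightarrow> quad (form_coeffs x i) (p' 0) (p' 1) (p' 2) = 0"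
    using assms(1) unfolding has_common_zero_def by blast
  obtain q' :: "nat \<Rightarrow> complex" and j :: nat where q': "j < 3" "q' j \<noteq> 0" "\<And>i. i < 3 \<Longrightarrow> quad (form_coeffs y i) (q' 0) (q' 1) (q' 2) = 0"
    using assms(2) unfolding has_common_zero_def by blast
  obtain l where l: "dot l p' \<noteq> 0" "dot l q' \<noteq> 0" using common_functional p'(1,2) q'(1,2) by blast
  have scale: "quad c (u / h) (v / h) (w / h) = quad c u v w / h\<^sup>2" for c :: "nat \<Rightarrow> complex" and u v w h
    by (simp add: quad_def power2_eq_square add_divide_distrib)
  define p where "p i = p' i / dot l p'" for i
  define q where "q i = q' i / dot l q'" for i
  have dp: "dot l p = 1" and dq: "dot l q = 1"
    using l by (simp_all add: p_def q_def dot_def divide_simps)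
  have zp: "quad (form_coeffs x i) (p 0) (p 1) (p 2) = 0" and zq: "quad (form_coeffs y i) (q 0) (q 1) (q 2) = 0"
    if "i < 3" for i
    using p'(3)[OF that] q'(3)[OF that] by (simp_all add: p_def q_def scale)
  define r where "r s i = (1 - s) * p i + s * q i" for s i
  define G where "G s v = (1 - s) * x v + s * y v" for s v
  define l2 where "l2 = bilin_coeffs (\<lambda>a b. l a * l b)"
  define e where "e s i = quad (form_coeffs (G s) i) (r s 0) (r s 1) (r s 2)" for s i
  \<comment> \<open>Only coefficients of quadratic monomials are corrected; all other indeterminates
    are just interpolated.\<close>
  define z where "z s v = G s v - (\<Sum>i<3. \<Sum>m<6. if v = coeff_var i m then e s i * l2 m else 0)" for s v
  have "univariate (\<lambda>s. z s v)" for v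
  proof -
    have "univariate (\<lambda>s. if b then e s i * l2 m else 0)" for b i m
      unfolding e_def quad_def form_coeffs_def G_def r_def by (cases b) (auto intro!: polynomial_intros)
    then show ?thesis unfolding z_def G_def by (intro polynomial_intros) auto
  qed
  moreover have "z 0 = x"
  proof
    fix v
    have "G 0 = x" "r 0 = p" by (auto simp: G_def r_def)
    then have "e 0 i = 0" if "i < 3" for i using zp[OF that] by (simp add: e_def)
    then have "(\<Sum>i<3. \<Sum>m<6. if v = coeff_var i m then e 0 i * l2 m else 0) = 0"
      by (intro sum.neutral ballI) simp
    then show "z 0 v = x v" using \<open>G 0 = x\<close> by (simp add: z_def)
  qed
  moreover have "z 1 = y"
  proof
    fix v
    have "G 1 = y" "r 1 = q" by (auto simp: G_def r_def)
    then have "e 1 i = 0" if "i < 3" for i using zq[OF that] by (simp add: e_def)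
    then have "(\<Sum>i<3. \<Sum>m<6. if v = coeff_var i m then e 1 i * l2 m else 0) = 0"
      by (intro sum.neutral ballI) simp
    then show "z 1 v = y v" using \<open>G 1 = y\<close> by (simp add: z_def)
  qed
  moreover have "has_common_zero (form_coeffs (z s))" for s
  proof (rule has_common_zero_normalize[of l "r s"])
    have "dot l (r s) = (1 - s) * dot l p + s * dot l q" by (simp add: dot_def r_def algebra_simps)
    then show dr: "dot l (r s) = 1" by (simp add: dp dq)
    fix i :: nat assume i: "i < 3"
    have c: "form_coeffs (z s) i m = form_coeffs (G s) i m - e s i * l2 m" if "m < 6" for m
      using sum_coeff_var[OF i that, of "\<lambda>i m. e s i * l2 m"] by (simp add: form_coeffs_def z_def)
    have "quad (form_coeffs (z s) i) (r s 0) (r s 1) (r s 2) =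
        quad (form_coeffs (G s) i) (r s 0) (r s 1) (r s 2) - e s i * quad l2 (r s 0) (r s 1) (r s 2)"
      unfolding quad_def by (simp add: c) (simp add: algebra_simps)
    also have "quad l2 (r s 0) (r s 1) (r s 2) = (dot l (r s))\<^sup>2"
      by (simp add: l2_def quad_def bilin_coeffs_def dot_def power2_eq_square algebra_simps)
    finally show "quad (form_coeffs (z s) i) (r s 0) (r s 1) (r s 2) = 0" by (simp add: dr e_def)
  qed
  ultimately show thesis using that by blast
qed

text \<open>Otherwise \<open>a\<close> is nonzero at one triple with a common zero and
  \<open>b\<close> at another. On a curve of such triples joining them the product vanishes
  identically, although neither univariate factor does.\<close>

lemma sylv_poly_prime:
  assumes "sylv_poly dvd a * b"
  shows "sylv_poly dvd a \<or> sylv_poly dvd b"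
proof (rule ccontr)
  assume "\<not> ?thesis"
  then obtain x y where x: "has_common_zero (form_coeffs x)" "mpoly_eval x a \<noteq> 0"
    and y: "has_common_zero (form_coeffs y)" "mpoly_eval y b \<noteq> 0"
    using sylv_poly_dvd by metis
  obtain z where z: "z 0 = x" "z 1 = y" "\<And>v. univariate (\<lambda>s. z s v)" "\<And>s. has_common_zero (form_coeffs (z s))"
    using has_common_zero_curve[OF x(1) y(1)] by metis
  obtain c where c: "a * b = sylv_poly * c" using assms by (elim dvdE)
  have "mpoly_eval (z s) a * mpoly_eval (z s) b = 0" for s
    using arg_cong[OF c, of "mpoly_eval (z s)"] z(4)[of s] by (simp flip: mpoly_eval_sylv_poly_eq_0_iff)
  moreover have "univariate (\<lambda>s. mpoly_eval (z s) r)" for r using z(3) by (rule univariate_mpoly_eval)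
  ultimately show False
    using univariate_mult_eq_0[of "\<lambda>s. mpoly_eval (z s) a" "\<lambda>s. mpoly_eval (z s) b" 0 1] x(2) y(2) z(1,2) by simp
qed

text \<open>Reduced to one variable on the line from a point where \<open>p\<close> is nonzero to an
  arbitrary point.\<close>

lemma mpoly_no_zero_divisors:
  fixes p q :: "('v, complex) mpoly"
  assumes "p * q = 0" "p \<noteq> 0"
  shows "q = 0"
proof (rule mpoly_eval_eqI)
  fix y
  obtain x where x: "mpoly_eval x p \<noteq> 0" using mpoly_eval_nonzero assms(2) by blast
  define z where "z s v = x v + s * (y v - x v)" for s v
  have z: "z 0 = x" "z 1 = y" by (auto simp: z_def)
  have u: "univariate (\<lambda>s. mpoly_eval (z s) r)" for r unfolding z_def by (intro polynomial_intros)
  have "mpoly_eval (z s) p * mpoly_eval (z s) q = 0" for s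
    using arg_cong[OF assms(1), of "mpoly_eval (z s)"] by simp
  then show "mpoly_eval y q = mpoly_eval y 0"
    using univariate_mult_eq_0[of "\<lambda>s. mpoly_eval (z s) p" "\<lambda>s. mpoly_eval (z s) q" 0 1] x z u by simp
qed

text \<open>A unit restricts to a univariate unit on every line through \<open>0\<close>, so it has
  its value at \<open>0\<close> everywhere.\<close>

lemma mpoly_unit_constant:
  fixes p :: "('v, complex) mpoly"
  assumes "p dvd 1"
  shows "\<exists>c. p = Poly_Mapping.single 0 c"
proof -
  obtain q where q: "1 = p * q" using assms by (elim dvdE)
  have "mpoly_eval y p = mpoly_eval (\<lambda>_. 0) p" for y
  proof -
    define z where "z s v = s * y v" for s v
    have z: "z 0 = (\<lambda>_. 0)" "z 1 = y" by (auto simp: z_def)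
    have u: "univariate (\<lambda>s. mpoly_eval (z s) r)" for r unfolding z_def by (intro polynomial_intros)
    obtain P Q where P: "\<And>s. mpoly_eval (z s) p = poly P s" and Q: "\<And>s. mpoly_eval (z s) q = poly Q s"
      using u[of p] u[of q] unfolding univariate_def by metis
    have "mpoly_eval (z s) p * mpoly_eval (z s) q = 1" for s
      using q by (metis mpoly_eval_1 mpoly_eval_mult)
    then have "P * Q = 1" by (intro poly_ext) (simp add: P Q)
    then have "degree P = 0" by (metis dvd_triv_left is_unit_iff_degree mult_zero_left zero_neq_one)
    then obtain c where "P = [:c:]" by (elim degree_eq_zeroE)
    then show ?thesis using P[of 0] P[of 1] z by simp
  qed
  then show ?thesis by (intro exI[of _ "mpoly_eval (\<lambda>_. 0) p"] mpoly_eval_eqI) (simp add: fun_eq_iff)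
qed

section \<open>Irreducibility and identification of the resultant\<close>

lemma sylv_poly_nonzero: "sylv_poly \<noteq> 0"
  using mpoly_eval_squares_point by auto

lemma sylv_poly_not_unit: "\<not> sylv_poly dvd 1"
proof
  assume "sylv_poly dvd 1"
  then obtain c where c: "1 = sylv_poly * c" by (elim dvdE)
  have "has_common_zero (form_coeffs (\<lambda>v. 0))"
    unfolding has_common_zero_def by (intro exI[of _ "\<lambda>i. 1"]) (auto simp: quad_def form_coeffs_def intro: exI[of _ 0])
  then have "mpoly_eval (\<lambda>v. 0) sylv_poly = 0" by (simp add: mpoly_eval_sylv_poly_eq_0_iff)
  with arg_cong[OF c, of "mpoly_eval (\<lambda>v. 0)"] show False by simp
qed

lemma sylv_poly_irreducible: "irreducible sylv_poly"
proof (rule irreducibleI)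
  fix a b assume ab: "sylv_poly = a * b"
  have unit: "d dvd 1" if "sylv_poly = c * d" "sylv_poly dvd c" for c d
  proof -
    obtain e where e: "c = sylv_poly * e" using \<open>sylv_poly dvd c\<close> by (elim dvdE)
    have "sylv_poly * (1 - e * d) = sylv_poly - c * d" unfolding e by (simp add: algebra_simps)
    also have "\<dots> = 0" using that(1) by simp
    finally have "1 - e * d = 0" using mpoly_no_zero_divisors sylv_poly_nonzero by blast
    then have "1 = d * e" by (simp add: mult.commute)
    then show ?thesis by (rule dvdI)
  qed
  have "sylv_poly dvd a \<or> sylv_poly dvd b" using ab by (intro sylv_poly_prime) simp
  then show "a dvd 1 \<or> b dvd 1" using unit[of a b] unit[of b a] ab by (auto simp: mult.commute)
qed (use sylv_poly_nonzero sylv_poly_not_unit in auto)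

lemma has_common_zero_iff_vec:
  assumes "\<And>i. i < 3 \<Longrightarrow> homogeneous 2 (F (var_of i))"
  shows "has_common_zero (\<lambda>i m. Poly_Mapping.lookup (F (var_of i)) (expo m)) \<longleftrightarrow>
    (\<exists>p :: complex^3. p \<noteq> 0 \<and> (\<forall>v. mpoly_eval (($) p) (F v) = 0))"
proof -
  have ev: "mpoly_eval (($) p) (F (var_of i)) = quad (\<lambda>m. Poly_Mapping.lookup (F (var_of i)) (expo m)) (p $ 1) (p $ 2) (p $ 3)"
    if "i < 3" for p :: "complex^3" and i
    using assms[OF that] by (rule mpoly_eval_quadratic)
  show ?thesis
  proof
    assume "has_common_zero (\<lambda>i m. Poly_Mapping.lookup (F (var_of i)) (expo m))"
    then obtain p :: "nat \<Rightarrow> complex" and k :: nat where p: "k < 3" "p k \<noteq> 0"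
      "\<And>i. i < 3 \<Longrightarrow> quad (\<lambda>m. Poly_Mapping.lookup (F (var_of i)) (expo m)) (p 0) (p 1) (p 2) = 0"
      unfolding has_common_zero_def by blast
    define v :: "complex^3" where "v = vector [p 0, p 1, p 2]"
    have "v \<noteq> 0" using less_3_cases[OF p(1)] p(2)
      by (auto simp: v_def Finite_Cartesian_Product.vec_eq_iff forall_3)
    moreover have "mpoly_eval (($) v) (F u) = 0" for u
    proof -
      obtain i where "i < 3" "u = var_of i" using var_of_cases by blast
      then show ?thesis using ev p(3) by (simp add: v_def)
    qed
    ultimately show "\<exists>p :: complex^3. p \<noteq> 0 \<and> (\<forall>v. mpoly_eval (($) p) (F v) = 0)"
      by blast
  next
    assume "\<exists>p :: complex^3. p \<noteq> 0 \<and> (\<forall>v. mpoly_eval (($) p) (F v) = 0)"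
    then obtain p :: "complex^3" where p: "p \<noteq> 0" "\<And>v. mpoly_eval (($) p) (F v) = 0" by blast
    have "\<exists>k<3. [p $ 1, p $ 2, p $ 3] ! k \<noteq> 0"
    proof (rule ccontr)
      assume "\<not> ?thesis"
      then have "p = 0" by (simp add: all_less_3 Finite_Cartesian_Product.vec_eq_iff forall_3)
      with p(1) show False ..
    qed
    moreover have "quad (\<lambda>m. Poly_Mapping.lookup (F (var_of i)) (expo m)) (p $ 1) (p $ 2) (p $ 3) = 0"
      if "i < 3" for i
      using p(2) ev[OF that] by metis
    ultimately show "has_common_zero (\<lambda>i m. Poly_Mapping.lookup (F (var_of i)) (expo m))"
      unfolding has_common_zero_def by (intro exI[of _ "\<lambda>k. [p $ 1, p $ 2, p $ 3] ! k"]) simp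
  qed
qed

lemma squares_point_lookup:
  assumes "mono_deg \<alpha> = 2"
  shows "Poly_Mapping.lookup (Poly_Mapping.single (Poly_Mapping.single i 2) (1::complex)) \<alpha> = squares_point (i, \<alpha>)"
proof -
  obtain m where m: "m < 6" "\<alpha> = expo m" using mono_deg_2_expo[OF assms] by blast
  obtain k where k: "k < 3" "i = var_of k" using var_of_cases by blast
  have lt: "sym_index k k < 6" and "expo (sym_index k k) = Poly_Mapping.single i 1 + Poly_Mapping.single i 1"
    using less_3_cases[OF k(1)] unfolding k(2)
    by (elim disjE; simp add: expo_def sym_index_def)+
  then have sq: "Poly_Mapping.single i (2::nat) = expo (sym_index k k)"
    using single_add[of i "1::nat" 1] by (simp only: one_add_one)
  have "squares_point (i, \<alpha>) = form_coeffs squares_point k m"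
    by (simp add: form_coeffs_def coeff_var_def m k)
  also have "\<dots> = (if m = sym_index k k then 1 else 0)"
    unfolding form_coeffs_squares_point[OF k(1) m(1)] using less_3_cases[OF k(1)] less_6_cases[OF m(1)]
    by (elim disjE) (simp_all add: sym_index_def)
  finally show ?thesis using expo_inj[OF lt m(1)] by (auto simp: sq m(2) lookup_single when_def)
qed

lemma mpoly_eval_quadratic_vars_cong:
  assumes "\<forall>m\<in>Poly_Mapping.keys p. \<forall>(i, \<alpha>)\<in>Poly_Mapping.keys m. mono_deg \<alpha> = 2"
    and "\<And>i \<alpha>. mono_deg \<alpha> = 2 \<Longrightarrow> x (i, \<alpha>) = y (i, \<alpha>)"
  shows "mpoly_eval x p = mpoly_eval y p"
  using assms by (intro mpoly_eval_cong) fastforce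

lemma sylv_poly_vars: "\<forall>m\<in>Poly_Mapping.keys sylv_poly. \<forall>(i, \<alpha>)\<in>Poly_Mapping.keys m. mono_deg \<alpha> = 2"
  using sylv_poly by fastforce

lemma is_resultant_sylv_poly: "is_resultant (\<lambda>_ :: 3. 2) sylv_poly"
  unfolding is_resultant_def
proof (intro conjI allI impI)
  show "irreducible sylv_poly" by (rule sylv_poly_irreducible)
  show "\<forall>m\<in>Poly_Mapping.keys sylv_poly. \<forall>(i, \<alpha>)\<in>Poly_Mapping.keys m. mono_deg \<alpha> = 2"
    by (rule sylv_poly_vars)
  fix F :: "3 \<Rightarrow> (3, complex) mpoly" assume F: "\<forall>i. homogeneous 2 (F i)"
  have "mpoly_eval (\<lambda>(i, \<alpha>). Poly_Mapping.lookup (F i) \<alpha>) sylv_poly = 0 \<longleftrightarrow>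
     has_common_zero (\<lambda>i m. Poly_Mapping.lookup (F (var_of i)) (expo m))"
    unfolding mpoly_eval_sylv_poly_eq_0_iff form_coeffs_def coeff_var_def by simp
  then show "(mpoly_eval (\<lambda>(i, \<alpha>). Poly_Mapping.lookup (F i) \<alpha>) sylv_poly = 0) =
      (\<exists>p :: complex^3. p \<noteq> 0 \<and> (\<forall>i. mpoly_eval (($) p) (F i) = 0))"
    using has_common_zero_iff_vec F by simp
next
  have "mpoly_eval (\<lambda>(i, \<alpha>). Poly_Mapping.lookup (Poly_Mapping.single (Poly_Mapping.single i 2) (1::complex)) \<alpha>) sylv_poly
      = mpoly_eval squares_point sylv_poly"
    using squares_point_lookup by (intro mpoly_eval_quadratic_vars_cong sylv_poly_vars) auto
  then show "mpoly_eval (\<lambda>(i, \<alpha>). Poly_Mapping.lookup (Poly_Mapping.single (Poly_Mapping.single i 2) (1::complex)) \<alpha>) sylv_poly = 1"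
    using mpoly_eval_squares_point by simp
qed

text \<open>The zero condition gives divisibility by \<open>sylv_poly\<close>, irreducibility makes
  the cofactor a constant, and the normalization makes this constant \<open>1\<close>.\<close>

lemma is_resultant_unique:
  assumes "is_resultant (\<lambda>_ :: 3. 2) R"
  shows "R = sylv_poly"
proof -
  have irr: "irreducible R" and vars: "\<forall>m\<in>Poly_Mapping.keys R. \<forall>(i, \<alpha>)\<in>Poly_Mapping.keys m. mono_deg \<alpha> = 2"
    and zero: "\<And>F :: 3 \<Rightarrow> (3, complex) mpoly. (\<forall>i. homogeneous 2 (F i)) \<Longrightarrow>
        mpoly_eval (\<lambda>(i, \<alpha>). Poly_Mapping.lookup (F i) \<alpha>) R = 0 \<longleftrightarrow>
         (\<exists>p :: complex^3. p \<noteq> 0 \<and> (\<forall>i. mpoly_eval (($) p) (F i) = 0))"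
    and one: "mpoly_eval (\<lambda>(i, \<alpha>). Poly_Mapping.lookup (Poly_Mapping.single (Poly_Mapping.single i 2) (1::complex)) \<alpha>) R = 1"
    using assms unfolding is_resultant_def by blast+
  have one': "mpoly_eval squares_point R = 1"
  proof -
    have "mpoly_eval squares_point R = mpoly_eval (\<lambda>(i, \<alpha>). Poly_Mapping.lookup (Poly_Mapping.single (Poly_Mapping.single i 2) (1::complex)) \<alpha>) R"
      using squares_point_lookup by (intro mpoly_eval_quadratic_vars_cong vars) auto
    then show ?thesis using one by simp
  qed
  have "sylv_poly dvd R"
  proof (rule sylv_poly_dvd)
    fix x assume x: "has_common_zero (form_coeffs x)"
    \<comment> \<open>\<open>x\<close> may be nonzero at indeterminates of other degrees;
      \<open>F\<close> keeps its quadratic coefficients, the only ones on which \<open>R\<close>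
      depends.\<close>
    define F :: "3 \<Rightarrow> (3, complex) mpoly" where "F i = (\<Sum>m<6. Poly_Mapping.single (expo m) (x (i, expo m)))" for i
    have lookup: "Poly_Mapping.lookup (F i) (expo n) = x (i, expo n)" if "n < 6" for i n
    proof -
      have "Poly_Mapping.lookup (F i) (expo n) = (\<Sum>m<6. if m = n then x (i, expo n) else 0)"
        unfolding F_def lookup_sum using that expo_inj by (intro sum.cong) (auto simp: lookup_single when_def)
      then show ?thesis using that by simp
    qed
    have hom: "homogeneous 2 (F i)" for i
      unfolding homogeneous_def
    proof
      fix \<alpha> assume "\<alpha> \<in> Poly_Mapping.keys (F i)"
      then have "(\<Sum>m<6. Poly_Mapping.lookup (Poly_Mapping.single (expo m) (x (i, expo m))) \<alpha>) \<noteq> 0"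
        by (simp add: in_keys_iff F_def lookup_sum)
      then obtain m where "m \<in> {..<6}" "Poly_Mapping.lookup (Poly_Mapping.single (expo m) (x (i, expo m))) \<alpha> \<noteq> 0"
        by (rule sum.not_neutral_contains_not_neutral)
      then have "m < 6" "\<alpha> = expo m" by (auto simp: lookup_single when_def split: if_splits)
      then show "mono_deg \<alpha> = 2" using mono_deg_expo by simp
    qed
    have "has_common_zero (\<lambda>i m. Poly_Mapping.lookup (F (var_of i)) (expo m))"
    proof -
      have "quad (\<lambda>m. Poly_Mapping.lookup (F (var_of i)) (expo m)) a b c = quad (form_coeffs x i) a b c" for i a b c
        by (simp add: quad_def lookup form_coeffs_def coeff_var_def)
      then show ?thesis using x unfolding has_common_zero_def by simp
    qed
    then have "mpoly_eval (\<lambda>(i, \<alpha>). Poly_Mapping.lookup (F i) \<alpha>) R = 0"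
      using zero[of F] hom has_common_zero_iff_vec[of F] by blast
    also have "mpoly_eval (\<lambda>(i, \<alpha>). Poly_Mapping.lookup (F i) \<alpha>) R = mpoly_eval x R"
      using mono_deg_2_expo lookup by (intro mpoly_eval_quadratic_vars_cong vars) auto
    finally show "mpoly_eval x R = 0" .
  qed
  then obtain c where c: "R = sylv_poly * c" by (elim dvdE)
  then have "c dvd 1" using irr sylv_poly_not_unit irreducibleD by blast
  then obtain k where k: "c = Poly_Mapping.single 0 k" using mpoly_unit_constant by blast
  have "k = 1" using one' mpoly_eval_squares_point by (simp add: c k)
  then show ?thesis by (simp add: c k)
qed

theorem resultant_quadratic_forms:
  "resultant (\<lambda>_ :: 3. 2) F = sylv_det (\<lambda>i m. Poly_Mapping.lookup (F (var_of i)) (expo m)) / 512"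
proof -
  have "(THE R. is_resultant (\<lambda>_ :: 3. 2) R) = sylv_poly"
    using is_resultant_sylv_poly is_resultant_unique by blast
  moreover have "form_coeffs (\<lambda>(i, \<alpha>). Poly_Mapping.lookup (F i) \<alpha>) = (\<lambda>i m. Poly_Mapping.lookup (F (var_of i)) (expo m))"
    by (intro ext) (simp add: form_coeffs_def coeff_var_def)
  ultimately show ?thesis
    by (simp add: resultant_def mpoly_eval_sylv_poly)
qed

section \<open>The discriminant of a cubic form in Weierstrass coordinates\<close>

lemma monomial_eval_3:
  "monomial_eval x \<alpha> = x 1 ^ Poly_Mapping.lookup \<alpha> 1 * x 2 ^ Poly_Mapping.lookup \<alpha> 2 * x 3 ^ Poly_Mapping.lookup \<alpha> (3::3)"
  by (subst monomial_eval_superset[of UNIV]) (simp, simp, unfold UNIV_3, simp add: mult_ac)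

lemma mpoly_eval_pderiv:
  "mpoly_eval x (mpoly_pderiv v p) = (\<Sum>\<alpha>\<in>Poly_Mapping.keys p.
     of_nat (Poly_Mapping.lookup \<alpha> v) * Poly_Mapping.lookup p \<alpha> * monomial_eval x (\<alpha> - Poly_Mapping.single v 1))"
  by (simp add: mpoly_pderiv_def)

lemma homogeneous_pderiv:
  fixes p :: "(3, complex) mpoly"
  assumes "homogeneous (Suc d) p"
  shows "homogeneous d (mpoly_pderiv v p)"
  unfolding homogeneous_def
proof
  fix \<beta> assume "\<beta> \<in> Poly_Mapping.keys (mpoly_pderiv v p)"
  then have "(\<Sum>\<alpha>\<in>Poly_Mapping.keys p. Poly_Mapping.lookup (Poly_Mapping.single (\<alpha> - Poly_Mapping.single v 1)
          (of_nat (Poly_Mapping.lookup \<alpha> v) * Poly_Mapping.lookup p \<alpha>)) \<beta>) \<noteq> 0"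
    by (simp add: in_keys_iff mpoly_pderiv_def lookup_sum)
  then obtain \<alpha> where \<alpha>: "\<alpha> \<in> Poly_Mapping.keys p" "Poly_Mapping.lookup (Poly_Mapping.single (\<alpha> - Poly_Mapping.single v 1)
          (of_nat (Poly_Mapping.lookup \<alpha> v) * Poly_Mapping.lookup p \<alpha>)) \<beta> \<noteq> 0"
    by (rule sum.not_neutral_contains_not_neutral)
  then have \<beta>: "\<beta> = \<alpha> - Poly_Mapping.single v 1" "Poly_Mapping.lookup \<alpha> v \<noteq> 0"
    by (auto simp: lookup_single when_def split: if_splits)
  have "mono_deg \<alpha> = Suc d" using assms \<alpha>(1) by (simp add: homogeneous_def)
  then show "mono_deg \<beta> = d"
    using \<beta>(2) exhaust_3[of v] by (auto simp: \<beta>(1) mono_deg_3 lookup_minus lookup_single when_def)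
qed

text \<open>Links formal partial derivatives with complex differentiation, so that the chain rule
  for a linear substitution follows from uniqueness of derivatives.\<close>

lemma mpoly_eval_has_derivative:
  fixes p :: "(3, complex) mpoly"
  shows "((\<lambda>s. mpoly_eval (\<lambda>v. x v + s * u v) p) has_field_derivative
    u 1 * mpoly_eval x (mpoly_pderiv 1 p) + u 2 * mpoly_eval x (mpoly_pderiv 2 p) + u 3 * mpoly_eval x (mpoly_pderiv 3 p)) (at 0)"
proof -
  have mono: "((\<lambda>s. monomial_eval (\<lambda>v. x v + s * u v) \<alpha>) has_field_derivative
    u 1 * (of_nat (Poly_Mapping.lookup \<alpha> 1) * monomial_eval x (\<alpha> - Poly_Mapping.single 1 1)) +
    u 2 * (of_nat (Poly_Mapping.lookup \<alpha> 2) * monomial_eval x (\<alpha> - Poly_Mapping.single 2 1)) +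
    u 3 * (of_nat (Poly_Mapping.lookup \<alpha> 3) * monomial_eval x (\<alpha> - Poly_Mapping.single 3 1))) (at 0)" for \<alpha> :: "3 \<Rightarrow>\<^sub>0 nat"
    unfolding monomial_eval_3 lookup_minus
    by (rule derivative_eq_intros refl | simp)+ (simp add: lookup_single when_def algebra_simps)
  have "((\<lambda>s. \<Sum>\<alpha>\<in>Poly_Mapping.keys p. Poly_Mapping.lookup p \<alpha> * monomial_eval (\<lambda>v. x v + s * u v) \<alpha>) has_field_derivative
    (\<Sum>\<alpha>\<in>Poly_Mapping.keys p. Poly_Mapping.lookup p \<alpha> * (
    u 1 * (of_nat (Poly_Mapping.lookup \<alpha> 1) * monomial_eval x (\<alpha> - Poly_Mapping.single 1 1)) +
    u 2 * (of_nat (Poly_Mapping.lookup \<alpha> 2) * monomial_eval x (\<alpha> - Poly_Mapping.single 2 1)) +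
    u 3 * (of_nat (Poly_Mapping.lookup \<alpha> 3) * monomial_eval x (\<alpha> - Poly_Mapping.single 3 1))))) (at 0)"
    by (intro DERIV_sum DERIV_cmult mono)
  also have "(\<Sum>\<alpha>\<in>Poly_Mapping.keys p. Poly_Mapping.lookup p \<alpha> * (
    u 1 * (of_nat (Poly_Mapping.lookup \<alpha> 1) * monomial_eval x (\<alpha> - Poly_Mapping.single 1 1)) +
    u 2 * (of_nat (Poly_Mapping.lookup \<alpha> 2) * monomial_eval x (\<alpha> - Poly_Mapping.single 2 1)) +
    u 3 * (of_nat (Poly_Mapping.lookup \<alpha> 3) * monomial_eval x (\<alpha> - Poly_Mapping.single 3 1)))) =
    u 1 * mpoly_eval x (mpoly_pderiv 1 p) + u 2 * mpoly_eval x (mpoly_pderiv 2 p) + u 3 * mpoly_eval x (mpoly_pderiv 3 p)"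
    unfolding mpoly_eval_pderiv sum_distrib_left sum.distrib[symmetric]
    by (intro sum.cong refl) (simp add: algebra_simps)
  finally show ?thesis unfolding mpoly_eval_monomial_eval[of _ p] .
qed

lemma quad_coeffs_unique:
  fixes c d :: "nat \<Rightarrow> complex"
  assumes eq: "\<And>x y z. quad c x y z = quad d x y z" and "m < 6"
  shows "c m = d m"
  using less_6_cases[OF \<open>m < 6\<close>] eq[of 1 0 0] eq[of 0 1 0] eq[of 0 0 1] eq[of 1 1 0] eq[of 1 0 1] eq[of 0 1 1]
  by (elim disjE) (simp_all add: quad_def)

theorem cubic_discriminant_weierstrass:
  fixes \<phi> :: ternary_form and M :: "complex^3^3"
  assumes hom: "homogeneous 3 \<phi>" and inv: "invertible M"
    and W: "\<And>X Y Z :: complex. mpoly_eval (($) (M *v vector [X, Y, Z])) \<phi> =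
             Y ^ 2 * Z - 4 * X ^ 3 + g\<^sub>2 * X * Z ^ 2 + g\<^sub>3 * Z ^ 3"
  shows "cubic_discriminant \<phi> = 2 ^ 12 * (g\<^sub>2 ^ 3 - 27 * g\<^sub>3\<^sup>2) / Determinants.det M ^ 12"
proof -
  define C where "C i m = Poly_Mapping.lookup (mpoly_pderiv (var_of i) \<phi>) (expo m)" for i m
  define g where "g i j = M $ var_of i $ var_of j" for i j
  define W' where "W' = (\<lambda>i. (!) ([[-12, 0, 0, 0, 0, g\<^sub>2], [0, 0, 0, 0, 2, 0], [0, 0, 2 * g\<^sub>2, 1, 0, 3 * g\<^sub>3]] ! i))"
  have quadC: "mpoly_eval x (mpoly_pderiv (var_of i) \<phi>) = quad (C i) (x 1) (x 2) (x 3)" for i x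
    unfolding C_def using hom by (intro mpoly_eval_quadratic homogeneous_pderiv) (simp add: numeral_3_eq_3)
  have quadC': "mpoly_eval x (mpoly_pderiv 1 \<phi>) = quad (C 0) (x 1) (x 2) (x 3)"
    "mpoly_eval x (mpoly_pderiv 2 \<phi>) = quad (C 1) (x 1) (x 2) (x 3)"
    "mpoly_eval x (mpoly_pderiv 3 \<phi>) = quad (C 2) (x 1) (x 2) (x 3)" for x
    using quadC[of x 0] quadC[of x 1] quadC[of x 2] by simp_all
  \<comment> \<open>Differentiation in the direction of the \<open>k\<close>-th new coordinate: the
    transpose of \<open>M\<close> carries the gradient of \<open>\<phi>\<close> to the gradient
    \<open>W'\<close> of the Weierstrass form.\<close>
  have chain: "g 0 k * quad (C 0) q1 q2 q3 + g 1 k * quad (C 1) q1 q2 q3 + g 2 k * quad (C 2) q1 q2 q3 = quad (W' k) X Y Z"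
    if k: "k < 3" and q: "q1 = g 0 0 * X + g 0 1 * Y + g 0 2 * Z" "q2 = g 1 0 * X + g 1 1 * Y + g 1 2 * Z"
      "q3 = g 2 0 * X + g 2 1 * Y + g 2 2 * Z" for k X Y Z q1 q2 q3
  proof -
    define e where "e j = (if j = k then 1 else 0 :: complex)" for j :: nat
    let ?q = "($) (vector [q1, q2, q3] :: complex^3)"
    have "((\<lambda>s. mpoly_eval (\<lambda>v. ?q v + s * M $ v $ var_of k) \<phi>) has_field_derivative
        M $ 1 $ var_of k * quad (C 0) q1 q2 q3 + M $ 2 $ var_of k * quad (C 1) q1 q2 q3 + M $ 3 $ var_of k * quad (C 2) q1 q2 q3) (at 0)"
      using mpoly_eval_has_derivative[of ?q "\<lambda>v. M $ v $ var_of k" \<phi>] by (simp add: quadC')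
    moreover have "(\<lambda>v. ?q v + s * M $ v $ var_of k) = ($) (M *v vector [X + s * e 0, Y + s * e 1, Z + s * e 2])" for s
    proof
      fix v :: 3
      have "v = 1 \<or> v = 2 \<or> v = 3" by (rule exhaust_3)
      then show "?q v + s * M $ v $ var_of k = (M *v vector [X + s * e 0, Y + s * e 1, Z + s * e 2]) $ v"
        using less_3_cases[OF k]
        by (elim disjE) (simp_all add: q g_def matrix_vector_mult_def sum_3 e_def algebra_simps)
    qed
    ultimately have 1: "((\<lambda>s. (Y + s * e 1) ^ 2 * (Z + s * e 2) - 4 * (X + s * e 0) ^ 3
          + g\<^sub>2 * (X + s * e 0) * (Z + s * e 2) ^ 2 + g\<^sub>3 * (Z + s * e 2) ^ 3) has_field_derivative
        g 0 k * quad (C 0) q1 q2 q3 + g 1 k * quad (C 1) q1 q2 q3 + g 2 k * quad (C 2) q1 q2 q3) (at 0)"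
      by (simp add: W g_def)
    have "((\<lambda>s. (Y + s * e 1) ^ 2 * (Z + s * e 2) - 4 * (X + s * e 0) ^ 3
          + g\<^sub>2 * (X + s * e 0) * (Z + s * e 2) ^ 2 + g\<^sub>3 * (Z + s * e 2) ^ 3) has_field_derivative
        2 * Y * e 1 * Z + Y\<^sup>2 * e 2 - 12 * X\<^sup>2 * e 0 + g\<^sub>2 * (e 0 * Z\<^sup>2 + 2 * X * Z * e 2) + 3 * g\<^sub>3 * Z\<^sup>2 * e 2) (at 0)"
      by (rule derivative_eq_intros refl | simp)+ (simp add: algebra_simps)
    from DERIV_unique[OF 1 this] show ?thesis
      using less_3_cases[OF k] by (elim disjE) (simp_all add: e_def W'_def quad_def algebra_simps)
  qed
  \<comment> \<open>The transpose of \<open>g\<close> recombines the derivatives, whence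
    \<open>det M ^ 4\<close> besides the \<open>det M ^ 8\<close> of the substitution.\<close>
  define N where "N i j = g j i" for i j
  define x where "x = 2 ^ 12 * (g\<^sub>2 ^ 3 - 27 * g\<^sub>3\<^sup>2) / Determinants.det M ^ 12"
  have "sylv_det (net N (\<lambda>i. subst_quad g (C i))) = sylv_det W'"
  proof (rule sylv_det_cong, rule quad_coeffs_unique)
    fix i m :: nat and X Y Z :: complex assume i: "i < 3"
    let ?p = "\<lambda>j. [X, Y, Z] ! j"
    have s: "quad (subst_quad g (C j)) X Y Z = quad (C j) (mat_app g ?p 0) (mat_app g ?p 1) (mat_app g ?p 2)" for j
      using quad_subst_quad[of g "C j" ?p] by simp
    have "quad (net N (\<lambda>i. subst_quad g (C i)) i) X Y Z =
        g 0 i * quad (subst_quad g (C 0)) X Y Z + g 1 i * quad (subst_quad g (C 1)) X Y Z + g 2 i * quad (subst_quad g (C 2)) X Y Z"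
      by (simp add: quad_def net_def N_def algebra_simps)
    also have "\<dots> = quad (W' i) X Y Z"
      unfolding s by (rule chain[OF i]) (simp_all add: mat_app_def)
    finally show "quad (net N (\<lambda>i. subst_quad g (C i)) i) X Y Z = quad (W' i) X Y Z" .
  qed
  also have "sylv_det W' = - (512 * 27 * 4096) * (g\<^sub>2 ^ 3 - 27 * g\<^sub>3\<^sup>2)"
    unfolding W'_def by (rule sylv_det_weierstrass)
  also have "sylv_det (net N (\<lambda>i. subst_quad g (C i))) = det3 N ^ 4 * (det3 g ^ 8 * sylv_det C)"
    by (simp add: sylv_det_net sylv_det_subst_quad)
  also have "det3 N = Determinants.det M"
    by (simp add: det3_def N_def g_def det_3 algebra_simps)
  also have "det3 g = Determinants.det M"
    by (simp add: det3_def g_def det_3 algebra_simps)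
  finally have "Determinants.det M ^ 12 * sylv_det C = - (512 * 27 * 4096) * (g\<^sub>2 ^ 3 - 27 * g\<^sub>3\<^sup>2)"
    by (simp flip: power_add mult.assoc)
  moreover have "Determinants.det M \<noteq> 0" using inv by (simp add: invertible_det_nz)
  \<comment> \<open>\<open>13824 = 512 * 27\<close>; the factor \<open>4096 = 2 ^ 12\<close> stays
    in \<open>x\<close>.\<close>
  ultimately have x: "sylv_det C = - 13824 * x"
    by (simp add: x_def field_simps)
  have "cubic_discriminant \<phi> = - (sylv_det C / 512) / 27"
    unfolding cubic_discriminant_def resultant_quadratic_forms C_def ..
  also have "\<dots> = x" unfolding x by simp
  finally show ?thesis by (simp add: x_def)
qed

section \<open>Lattice sums and elliptic functions\<close>

lemma summable_on_int_abs:
  fixes f :: "int \<Rightarrow> real"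
  assumes "\<And>n. f n = g (nat \<bar>n\<bar>)" "\<And>n. g n \<ge> 0" "summable g"
  shows "f summable_on UNIV"
proof -
  have g: "g summable_on UNIV" using assms(2,3) by (simp add: summable_on_UNIV_nonneg_real_iff)
  have "f summable_on range int"
    using g by (subst summable_on_reindex) (auto simp: o_def assms(1) inj_on_def)
  moreover have "f summable_on range (\<lambda>n. - int n)"
    using g by (subst summable_on_reindex) (auto simp: o_def assms(1) inj_on_def)
  ultimately have "f summable_on (range int \<union> range (\<lambda>n. - int n))"
    using assms(1,2) by (intro summable_on_union) auto
  moreover have "range int \<union> range (\<lambda>n. - int n) = UNIV"
    by (auto simp: image_iff) (metis int_cases2)
  ultimately show ?thesis by simp
qed

locale upper_half_plane =
  fixes \<tau> :: complex
  assumes Im_tau: "Im \<tau> > 0"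
begin

definition lattice :: "complex set" where "lattice = period_lattice 1 \<tau>"

lemma lattice_iff: "z \<in> lattice \<longleftrightarrow> (\<exists>m n. z = of_int m + of_int n * \<tau>)"
  by (auto simp: lattice_def period_lattice_def)

lemma latticeI: "of_int m + of_int n * \<tau> \<in> lattice"
  by (auto simp: lattice_iff)

lemma lattice_0 [simp]: "0 \<in> lattice" and lattice_1 [simp]: "1 \<in> lattice" and lattice_tau [simp]: "\<tau> \<in> lattice"
  using latticeI[of 0 0] latticeI[of 1 0] latticeI[of 0 1] by simp_all

lemma lattice_add: "z \<in> lattice \<Longrightarrow> w \<in> lattice \<Longrightarrow> z + w \<in> lattice"
proof -
  assume "z \<in> lattice" "w \<in> lattice"
  then obtain m n m' n' where "z = of_int m + of_int n * \<tau>" "w = of_int m' + of_int n' * \<tau>"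
    by (auto simp: lattice_iff)
  then have "z + w = of_int (m + m') + of_int (n + n') * \<tau>" by (simp add: algebra_simps)
  then show ?thesis using latticeI by metis
qed

lemma lattice_uminus: "z \<in> lattice \<Longrightarrow> - z \<in> lattice"
proof -
  assume "z \<in> lattice"
  then obtain m n where "z = of_int m + of_int n * \<tau>" by (auto simp: lattice_iff)
  then have "- z = of_int (- m) + of_int (- n) * \<tau>" by simp
  then show ?thesis using latticeI by metis
qed

lemma lattice_uminus_iff [simp]: "- z \<in> lattice \<longleftrightarrow> z \<in> lattice"
  using lattice_uminus[of z] lattice_uminus[of "- z"] by auto

lemma lattice_diff: "z \<in> lattice \<Longrightarrow> w \<in> lattice \<Longrightarrow> z - w \<in> lattice"
  using lattice_add[of z "- w"] by simp

lemma lattice_add_iff: "w \<in> lattice \<Longrightarrow> z + w \<in> lattice \<longleftrightarrow> z \<in> lattice"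
  using lattice_add[of z w] lattice_diff[of "z + w" w] by auto

definition lat_const :: real where "lat_const = 1 + (1 + norm \<tau>) / Im \<tau>"

lemma lat_const_pos: "lat_const > 0"
  using Im_tau by (auto simp: lat_const_def intro!: add_pos_nonneg)

text \<open>The imaginary part controls \<open>n\<close>, and then the triangle inequality controls
  \<open>m\<close>.\<close>

lemma norm_lattice_ge: "\<bar>real_of_int m\<bar> + \<bar>real_of_int n\<bar> \<le> lat_const * norm (of_int m + of_int n * \<tau>)"
proof -
  let ?w = "of_int m + of_int n * \<tau>"
  have "\<bar>Im ?w\<bar> \<le> norm ?w" by (rule abs_Im_le_cmod)
  then have n: "\<bar>real_of_int n\<bar> \<le> norm ?w / Im \<tau>"
    using Im_tau by (simp add: abs_mult field_simps)
  have "\<bar>real_of_int m\<bar> = norm (?w - of_int n * \<tau>)" by simp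
  also have "\<dots> \<le> norm ?w + \<bar>real_of_int n\<bar> * norm \<tau>"
    using norm_triangle_ineq4[of ?w "of_int n * \<tau>"] by (simp add: norm_mult)
  also have "\<dots> \<le> norm ?w + norm ?w / Im \<tau> * norm \<tau>"
    using n by (intro add_left_mono mult_right_mono) auto
  finally show ?thesis using n by (simp add: lat_const_def algebra_simps add_divide_distrib)
qed

lemma norm_lattice_nonzero_ge:
  assumes "w \<in> lattice" "w \<noteq> 0"
  shows "1 / lat_const \<le> norm w"
proof -
  obtain m n where w: "w = of_int m + of_int n * \<tau>" using assms by (auto simp: lattice_iff)
  then have "m \<noteq> 0 \<or> n \<noteq> 0" using assms by auto
  then have "1 \<le> \<bar>real_of_int m\<bar> + \<bar>real_of_int n\<bar>" by linarith
  also have "\<dots> \<le> lat_const * norm w" unfolding w by (rule norm_lattice_ge)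
  finally show ?thesis using lat_const_pos by (simp add: field_simps)
qed

lemma lattice_eq_iff: "of_int m + of_int n * \<tau> = of_int m' + of_int n' * \<tau> \<longleftrightarrow> m = m' \<and> n = n'"
proof
  assume "of_int m + of_int n * \<tau> = of_int m' + of_int n' * \<tau>"
  then have "of_int (m - m') + of_int (n - n') * \<tau> = 0" by (simp add: algebra_simps)
  then have "\<bar>real_of_int (m - m')\<bar> + \<bar>real_of_int (n - n')\<bar> \<le> 0"
    using norm_lattice_ge[of "m - m'" "n - n'"] by simp
  then show "m = m' \<and> n = n'" by linarith
qed auto

lemma summable_lattice_cube: "(\<lambda>w. 1 / norm w ^ 3) summable_on (lattice - {0})"
proof -
  \<comment> \<open>The exponent 3 is shared evenly: \<open>(1 + |m|) (1 + |n|)\<close> is at most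
    the square of \<open>1 + |m| + |n|\<close>, so a product of two series with exponent
    \<open>3/2 > 1\<close> dominates. The factor \<open>8 = 2 ^ 3\<close> arises from
    \<open>1 + |m| + |n| \<le> 2 (|m| + |n|)\<close> away from the origin.\<close>
  define a :: "int \<Rightarrow> real" where "a m = (1 + \<bar>real_of_int m\<bar>) powr (-3/2)" for m
  have "summable (\<lambda>n. (1 + real n) powr (-3/2))"
    using summable_real_powr_iff[of "-3/2"] by (subst (asm) summable_Suc_iff[symmetric]) (simp add: add.commute)
  then have a: "a summable_on UNIV"
    by (rule summable_on_int_abs[rotated 2]) (auto simp: a_def)
  have "(\<lambda>(m, n). a m * a n) summable_on UNIV \<times> UNIV"
  proof (rule summable_on_SigmaI)
    show "((\<lambda>n. case (m, n) of (m, n) \<Rightarrow> a m * a n) has_sum a m * infsum a UNIV) UNIV" for m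
      using a by (simp add: has_sum_cmult_right)
    show "(\<lambda>m. a m * infsum a UNIV) summable_on UNIV" using a by (intro summable_on_cmult_left)
  qed (auto simp: a_def)
  then have prod: "(\<lambda>(m, n). 8 * lat_const ^ 3 * (a m * a n)) summable_on (UNIV - {(0, 0)})"
    using summable_on_cmult_right[of "\<lambda>(m, n). a m * a n" UNIV "8 * lat_const ^ 3"]
    by (auto simp: case_prod_unfold intro: summable_on_subset)
  define f :: "int \<times> int \<Rightarrow> complex" where "f = (\<lambda>(m, n). of_int m + of_int n * \<tau>)"
  have bound: "1 / norm (f (m, n)) ^ 3 \<le> 8 * lat_const ^ 3 * (a m * a n)" if "(m, n) \<noteq> (0, 0)" for m n
  proof -
    define x where "x = 1 + \<bar>real_of_int m\<bar> + \<bar>real_of_int n\<bar>"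
    have x: "x > 0" by (simp add: x_def)
    have "1 \<le> \<bar>real_of_int m\<bar> + \<bar>real_of_int n\<bar>" using that by (cases "m = 0") auto
    then have "x \<le> 2 * (\<bar>real_of_int m\<bar> + \<bar>real_of_int n\<bar>)" by (simp add: x_def)
    also have "\<dots> \<le> 2 * (lat_const * norm (f (m, n)))"
      using norm_lattice_ge[of m n] unfolding f_def by simp
    finally have "x ^ 3 \<le> (2 * (lat_const * norm (f (m, n)))) ^ 3" using x by (intro power_mono) auto
    then have 1: "x ^ 3 \<le> 8 * lat_const ^ 3 * norm (f (m, n)) ^ 3" by (simp add: power_mult_distrib)
    have "(1 + \<bar>real_of_int m\<bar>) * (1 + \<bar>real_of_int n\<bar>) \<le> x\<^sup>2"
      by (simp add: x_def power2_eq_square algebra_simps)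
    then have "((1 + \<bar>real_of_int m\<bar>) * (1 + \<bar>real_of_int n\<bar>)) powr (3/2) \<le> (x\<^sup>2) powr (3/2)"
      by (intro powr_mono2) auto
    also have "(x\<^sup>2) powr (3/2) = x ^ 3" using x by (simp add: powr_powr flip: powr_numeral)
    finally have 2: "1 / x ^ 3 \<le> a m * a n"
      unfolding a_def by (simp add: powr_minus powr_mult divide_simps) (use x in \<open>simp add: field_simps\<close>)
    have fpos: "norm (f (m, n)) > 0"
      using 1 x lat_const_pos zero_less_power[OF x, of 3] by (cases "f (m, n) = 0") auto
    have "1 / norm (f (m, n)) ^ 3 \<le> 8 * lat_const ^ 3 * (1 / x ^ 3)"
      using 1 fpos x by (simp add: field_simps)
    also have "\<dots> \<le> 8 * lat_const ^ 3 * (a m * a n)" using 2 lat_const_pos by (intro mult_left_mono) auto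
    finally show ?thesis .
  qed
  have "(\<lambda>p. 1 / norm (f p) ^ 3) summable_on (UNIV - {(0, 0)})"
    by (rule summable_on_comparison_test[OF prod]) (use bound in auto)
  moreover have "bij_betw f (UNIV - {(0, 0)}) (lattice - {0})"
    unfolding bij_betw_def
  proof
    show "inj_on f (UNIV - {(0, 0)})" by (auto simp: inj_on_def f_def lattice_eq_iff)
    show "f ` (UNIV - {(0, 0)}) = lattice - {0}"
    proof
      show "f ` (UNIV - {(0, 0)}) \<subseteq> lattice - {0}"
        using lattice_eq_iff[of _ _ 0 0] latticeI by (auto simp: f_def)
      show "lattice - {0} \<subseteq> f ` (UNIV - {(0, 0)})"
      proof
        fix w assume w: "w \<in> lattice - {0}"
        then obtain m n where "w = f (m, n)" by (auto simp: lattice_iff f_def)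
        with w show "w \<in> f ` (UNIV - {(0, 0)})" by (intro image_eqI[of _ _ "(m, n)"]) (auto simp: f_def)
      qed
    qed
  qed
  ultimately show ?thesis using summable_on_reindex_bij_betw by fastforce
qed

lemma summable_lattice_power:
  assumes "k \<ge> 3"
  shows "(\<lambda>w. 1 / norm w ^ k) summable_on (lattice - {0})"
proof (rule summable_on_comparison_test)
  show "(\<lambda>w. lat_const ^ (k - 3) * (1 / norm w ^ 3)) summable_on (lattice - {0})"
    by (intro summable_on_cmult_right summable_lattice_cube)
  fix w assume w: "w \<in> lattice - {0}"
  then have "norm w > 0" by auto
  have "1 / norm w \<le> lat_const" using norm_lattice_nonzero_ge[of w] w lat_const_pos by (auto simp: field_simps)
  then have "(1 / norm w) ^ (k - 3) \<le> lat_const ^ (k - 3)" by (intro power_mono) auto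
  then have "(1 / norm w) ^ (k - 3) * (1 / norm w ^ 3) \<le> lat_const ^ (k - 3) * (1 / norm w ^ 3)"
    by (intro mult_right_mono) auto
  also have "(1 / norm w) ^ (k - 3) * (1 / norm w ^ 3) = 1 / norm w ^ k"
    using assms by (simp add: power_divide flip: power_add)
  finally show "1 / norm w ^ k \<le> lat_const ^ (k - 3) * (1 / norm w ^ 3)" .
qed auto

lemma summable_lattice_inverse_power:
  assumes "k \<ge> 3"
  shows "(\<lambda>w. 1 / w ^ k) summable_on (lattice - {0})"
  by (rule abs_summable_summable) (use summable_lattice_power[OF assms] in \<open>simp add: norm_divide norm_power\<close>)

lemma lattice_near:
  obtains d where "d > 0" "\<And>w. w \<in> lattice \<Longrightarrow> w \<noteq> z \<Longrightarrow> dist w z \<ge> d"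
proof (cases "\<exists>w\<in>lattice. w \<noteq> z \<and> dist w z < 1 / (2 * lat_const)")
  case False
  then show ?thesis using that[of "1 / (2 * lat_const)"] lat_const_pos by (auto simp: not_less)
next
  case True
  then obtain w where w: "w \<in> lattice" "w \<noteq> z" "dist w z < 1 / (2 * lat_const)" by blast
  have "dist v z \<ge> dist w z" if "v \<in> lattice" "v \<noteq> z" for v
  proof (cases "v = w")
    case False
    then have "1 / lat_const \<le> dist v w"
      using norm_lattice_nonzero_ge[of "v - w"] lattice_diff[of v w] that w by (simp add: dist_norm)
    also have "\<dots> \<le> dist v z + dist w z" by (rule dist_triangle2)
    finally show ?thesis using w(3) by (simp add: field_simps)
  qed auto
  then show ?thesis using w that[of "dist w z"] by simp
qed

lemma closed_lattice_subset: "X \<subseteq> lattice \<Longrightarrow> closed X"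
proof (subst closed_limpt, intro allI impI)
  fix z assume X: "X \<subseteq> lattice" and lim: "z islimpt X"
  obtain d where "d > 0" "\<And>w. w \<in> lattice \<Longrightarrow> w \<noteq> z \<Longrightarrow> dist w z \<ge> d"
    using lattice_near[of z] by metis
  moreover obtain w where "w \<in> X" "w \<noteq> z" "dist w z < d"
    using lim \<open>d > 0\<close> unfolding islimpt_approachable by blast
  ultimately show "z \<in> X" using X by force
qed

lemma reduce_to_parallelogram:
  obtains w where "w \<in> lattice" "\<exists>s\<in>{0..1}. \<exists>t\<in>{0..1}. z + w = of_real s + of_real t * \<tau>"
proof -
  define t where "t = Im z / Im \<tau>"
  define s where "s = Re z - t * Re \<tau>"
  have z: "z = of_real s + of_real t * \<tau>"
    using Im_tau by (simp add: complex_eq_iff s_def t_def)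
  have "z + (of_int (- \<lfloor>s\<rfloor>) + of_int (- \<lfloor>t\<rfloor>) * \<tau>) = of_real (frac s) + of_real (frac t) * \<tau>"
    unfolding z by (simp add: frac_def algebra_simps)
  moreover have "frac s \<in> {0..1}" "frac t \<in> {0..1}" by (auto simp: frac_ge_0 frac_lt_1 less_imp_le)
  ultimately show thesis using that latticeI by metis
qed

lemma periodic_lattice:
  assumes "\<And>z. f (z + 1) = f z" "\<And>z. f (z + \<tau>) = f z" "w \<in> lattice"
  shows "f (z + w) = f z"
proof -
  have int: "f (z + of_int n * p) = f z" if "\<And>z. f (z + p) = f z" for p n z
  proof (induction n arbitrary: z rule: int_induct[of _ 0])
    case (step1 i)
    have "f (z + of_int (i + 1) * p) = f ((z + of_int i * p) + p)" by (simp add: algebra_simps)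
    then show ?case using that step1 by metis
  next
    case (step2 i)
    have "f (z + of_int (i - 1) * p) = f ((z + of_int (i - 1) * p) + p)" using that by metis
    also have "(z + of_int (i - 1) * p) + p = z + of_int i * p" by (simp add: algebra_simps)
    finally show ?case using step2 by metis
  qed simp
  obtain m n where "w = of_int m + of_int n * \<tau>" using assms(3) by (auto simp: lattice_iff)
  then have "f (z + w) = f ((z + of_int m * 1) + of_int n * \<tau>)" by (simp add: add.assoc)
  also have "\<dots> = f z" using int[of \<tau>] int[of 1] assms by metis
  finally show ?thesis .
qed

text \<open>The limit removes the singularity at \<open>0\<close> and, by periodicity, those at all
  lattice points. The extension is bounded because every value is taken on a compact
  parallelogram.\<close>

lemma elliptic_constant:
  assumes holo: "f holomorphic_on - lattice"
    and per: "\<And>z. f (z + 1) = f z" "\<And>z. f (z + \<tau>) = f z"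
    and lim: "f \<midarrow>0\<rightarrow> c" and z: "z \<notin> lattice"
  shows "f z = c"
proof -
  \<comment> \<open>Nothing is known about the values of \<open>f\<close> on the lattice, so they
    are replaced by the limit.\<close>
  define g where "g z = (if z \<in> lattice then c else f z)" for z
  obtain d where d: "d > 0" "\<And>w. w \<in> lattice \<Longrightarrow> w \<noteq> 0 \<Longrightarrow> dist w 0 \<ge> d"
    using lattice_near[of 0] by metis
  have ball: "ball 0 d - {0} \<subseteq> - lattice" using d(2) by (force simp: dist_commute)
  have "(\<lambda>y. if y = 0 then c else f y) holomorphic_on ball 0 d"
    by (rule removable_singularity) (use holomorphic_on_subset[OF holo ball] lim in auto)
  also have "?this \<longleftrightarrow> g holomorphic_on ball 0 d"
    using ball by (intro holomorphic_cong) (auto simp: g_def)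
  finally have g0: "g holomorphic_on ball 0 d" .
  have gper: "g (z + w) = g z" if "w \<in> lattice" for z w
    using periodic_lattice[of f, OF per that] that by (simp add: g_def lattice_add_iff)
  have "g field_differentiable at w" for w
  proof (cases "w \<in> lattice")
    case False
    have op: "open (- lattice)" using closed_lattice_subset[of lattice] by (simp add: open_Compl)
    have "g holomorphic_on - lattice" using holo by (rule holomorphic_transform) (simp add: g_def)
    then show ?thesis using op False by (simp add: holomorphic_on_open field_differentiable_def)
  next
    case True
    have "g \<circ> (\<lambda>z. z - w) = g" using gper[of "- w"] True by (auto simp: fun_eq_iff)
    moreover have "(g \<circ> (\<lambda>z. z - w)) field_differentiable at w"
    proof (rule field_differentiable_compose)
      show "(\<lambda>z. z - w) field_differentiable at w" by (intro derivative_intros)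
      show "g field_differentiable at (w - w)"
        using g0 d(1) by (simp add: holomorphic_on_open field_differentiable_def)
    qed
    ultimately show ?thesis by simp
  qed
  then have gholo: "g holomorphic_on UNIV" by (simp add: holomorphic_on_def field_differentiable_at_within)
  define K where "K = (\<lambda>(s, t). of_real s + of_real t * \<tau>) ` ({0..1} \<times> {0..1::real})"
  have "compact K" unfolding K_def
    by (intro compact_continuous_image compact_Times) (auto simp: case_prod_unfold intro!: continuous_intros)
  then have "compact (g ` K)"
    using holomorphic_on_imp_continuous_on[OF gholo] by (intro compact_continuous_image) (auto intro: continuous_on_subset)
  moreover have "range g \<subseteq> g ` K"
  proof safe
    fix z
    obtain w where w: "w \<in> lattice" "\<exists>s\<in>{0..1}. \<exists>t\<in>{0..1}. z + w = of_real s + of_real t * \<tau>"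
      by (rule reduce_to_parallelogram)
    then obtain s t :: real where st: "(s, t) \<in> {0..1} \<times> {0..1}" "z + w = of_real s + of_real t * \<tau>"
      by auto
    then have "z + w \<in> K" unfolding K_def by (intro image_eqI[of _ _ "(s, t)"]) simp_all
    then show "g z \<in> g ` K" using gper[OF w(1), of z] by (metis imageI)
  qed
  ultimately have "bounded (range g)" using compact_imp_bounded bounded_subset by blast
  with gholo have "g constant_on UNIV" by (rule Liouville_theorem)
  then have "g z = g 0" unfolding constant_on_def by auto
  then show ?thesis using z by (simp add: g_def)
qed

end

context upper_half_plane
begin

section \<open>Eisenstein sums and the derivative of the Weierstrass function\<close>

definition eisenstein :: "nat \<Rightarrow> complex" where
  "eisenstein k = (\<Sum>\<^sub>\<infinity>w\<in>lattice - {0}. 1 / w ^ k)"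

text \<open>This is \<open>-1/2\<close> times the derivative of the Weierstrass function; it
  converges absolutely without the correction terms of the Weierstrass series.\<close>

definition inverse_cube_sum :: "complex \<Rightarrow> complex" where
  "inverse_cube_sum z = (\<Sum>\<^sub>\<infinity>w\<in>lattice. 1 / (z - w) ^ 3)"

definition regular_cube_sum :: "complex \<Rightarrow> complex" where
  "regular_cube_sum z = (\<Sum>\<^sub>\<infinity>w\<in>lattice - {0}. 1 / (z - w) ^ 3)"

text \<open>As \<open>x\<close> keeps a fixed distance from all \<open>w\<close>, the bound
  \<open>norm w \<le> norm x + norm (x - w)\<close> is at most a constant times
  \<open>norm (x - w)\<close>. This is the majorant for the Weierstrass test.\<close>

lemma lattice_uniform_bound:
  assumes "z \<notin> lattice - {0}"
  obtains r c where "r > 0" "\<And>x w. x \<in> cball z r \<Longrightarrow> w \<in> lattice - {0} \<Longrightarrow> x \<noteq> w \<and> norm (1 / (x - w) ^ 3) \<le> c * (1 / norm w ^ 3)"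
proof -
  obtain d where d: "d > 0" "\<And>w. w \<in> lattice \<Longrightarrow> w \<noteq> z \<Longrightarrow> dist w z \<ge> d"
    using lattice_near[of z] by metis
  define R where "R = norm z + d / 2"
  define c where "c = 1 + 2 * R / d"
  have "x \<noteq> w \<and> norm (1 / (x - w) ^ 3) \<le> c ^ 3 * (1 / norm w ^ 3)"
    if x: "x \<in> cball z (d / 2)" and w: "w \<in> lattice - {0}" for x w
  proof -
    have "d \<le> dist w z" using d(2) w assms by auto
    also have "\<dots> \<le> dist x w + dist z x"
      using dist_triangle[of w z x] by (simp add: dist_commute add.commute)
    finally have xw: "d / 2 \<le> norm (x - w)" using x by (simp add: dist_norm)
    have "norm x \<le> R" using x norm_triangle_ineq2[of x z] by (simp add: R_def dist_norm norm_minus_commute)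
    also have "R \<le> R * (2 / d * norm (x - w))"
    proof -
      have "1 \<le> 2 / d * norm (x - w)" using xw d(1) by (simp add: field_simps)
      moreover have "0 \<le> R" using d(1) by (simp add: R_def)
      ultimately show ?thesis using mult_left_mono by fastforce
    qed
    also have "\<dots> = 2 * R / d * norm (x - w)" by simp
    finally have "norm w \<le> c * norm (x - w)"
      using norm_triangle_ineq4[of x "x - w"] by (simp add: c_def algebra_simps)
    then have "norm w ^ 3 \<le> c ^ 3 * norm (x - w) ^ 3"
      by (metis norm_ge_zero power_mono power_mult_distrib)
    moreover have "norm (x - w) > 0" using xw d(1) by linarith
    ultimately show ?thesis using w by (auto simp: norm_divide norm_power field_simps)
  qed
  then show thesis using that[of "d / 2" "c ^ 3"] d(1) by simp
qed

lemma summable_regular_cube_sum: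
  assumes "z \<notin> lattice - {0}"
  shows "(\<lambda>w. 1 / (z - w) ^ 3) summable_on (lattice - {0})"
proof -
  obtain r c where rc: "r > 0" "\<And>x w. x \<in> cball z r \<Longrightarrow> w \<in> lattice - {0} \<Longrightarrow> x \<noteq> w \<and> norm (1 / (x - w) ^ 3) \<le> c * (1 / norm w ^ 3)"
    using lattice_uniform_bound[OF assms] by metis
  have "(\<lambda>w. c * (1 / norm w ^ 3)) summable_on (lattice - {0})"
    by (intro summable_on_cmult_right summable_lattice_cube)
  then have "(\<lambda>w. norm (1 / (z - w) ^ 3)) summable_on (lattice - {0})"
    by (rule summable_on_comparison_test) (use rc in auto)
  then show ?thesis by (rule abs_summable_summable)
qed

lemma regular_cube_sum_holomorphic: "regular_cube_sum holomorphic_on - (lattice - {0})"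
  unfolding holomorphic_on_def
proof
  fix z assume "z \<in> - (lattice - {0})"
  then obtain r c where rc: "r > 0" "\<And>x w. x \<in> cball z r \<Longrightarrow> w \<in> lattice - {0} \<Longrightarrow> x \<noteq> w \<and> norm (1 / (x - w) ^ 3) \<le> c * (1 / norm w ^ 3)"
    using lattice_uniform_bound[of z] by (metis ComplD)
  let ?f = "\<lambda>X x. \<Sum>w\<in>X. 1 / (x - w) ^ 3"
  have "uniform_limit (cball z r) ?f regular_cube_sum (finite_subsets_at_top (lattice - {0}))"
    unfolding regular_cube_sum_def using rc(2)
    by (intro Weierstrass_m_test_general[where M="\<lambda>w. c * (1 / norm w ^ 3)"] summable_on_cmult_right summable_lattice_cube) auto
  moreover have "\<forall>\<^sub>F X in finite_subsets_at_top (lattice - {0}). continuous_on (cball z r) (?f X) \<and> ?f X holomorphic_on ball z r"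
  proof (rule eventually_finite_subsets_at_top_weakI)
    fix X assume X: "X \<subseteq> lattice - {0}"
    have "?f X holomorphic_on cball z r"
      using rc(2) X by (intro holomorphic_intros) auto
    then show "continuous_on (cball z r) (?f X) \<and> ?f X holomorphic_on ball z r"
      using holomorphic_on_subset[OF _ ball_subset_cball] holomorphic_on_imp_continuous_on by blast
  qed
  ultimately have "regular_cube_sum holomorphic_on ball z r"
    using holomorphic_uniform_limit[of z r ?f "finite_subsets_at_top (lattice - {0})" regular_cube_sum] by simp
  then have "regular_cube_sum field_differentiable at z" using rc(1)
    by (simp add: holomorphic_on_open field_differentiable_def)
  then show "regular_cube_sum field_differentiable at z within - (lattice - {0})"
    by (rule field_differentiable_at_within)
qed

lemma inverse_cube_sum_eq: "z \<notin> lattice \<Longrightarrow> inverse_cube_sum z = 1 / z ^ 3 + regular_cube_sum z"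
proof -
  assume "z \<notin> lattice"
  then have "((\<lambda>w. 1 / (z - w) ^ 3) has_sum regular_cube_sum z) (lattice - {0})"
    unfolding regular_cube_sum_def by (intro has_sum_infsum summable_regular_cube_sum) auto
  then have "((\<lambda>w. 1 / (z - w) ^ 3) has_sum (1 / (z - 0) ^ 3 + regular_cube_sum z)) (insert 0 (lattice - {0}))"
    by (intro has_sum_insert) auto
  then show ?thesis unfolding inverse_cube_sum_def by (simp add: insert_absorb infsumI)
qed

lemma inverse_cube_sum_periodic:
  assumes "v \<in> lattice"
  shows "inverse_cube_sum (z + v) = inverse_cube_sum z"
  unfolding inverse_cube_sum_def
  by (rule infsum_reindex_bij_witness[where i="\<lambda>w. w + v" and j="\<lambda>w. w - v"])
    (use assms in \<open>auto simp: lattice_diff lattice_add algebra_simps\<close>)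

lemma inverse_cube_sum_minus: "inverse_cube_sum (- z) = - inverse_cube_sum z"
proof -
  have *: "- (1 / (z - - w) ^ 3) = 1 / (- z - w) ^ 3" for w
  proof -
    have "- z - w = - (z - - w)" by simp
    then have "(- z - w) ^ 3 = (- (z - - w)) ^ 3" by (rule arg_cong)
    also have "\<dots> = - ((z - - w) ^ 3)" by (rule power_minus_odd) simp
    finally show ?thesis by (metis minus_divide_right)
  qed
  have "inverse_cube_sum (- z) = (\<Sum>\<^sub>\<infinity>w\<in>lattice. - (1 / (z - w) ^ 3))"
    unfolding inverse_cube_sum_def
    by (rule infsum_reindex_bij_witness[where i=uminus and j=uminus]) (use * in simp_all)
  then show ?thesis by (simp add: infsum_uminus inverse_cube_sum_def)
qed

lemma regular_cube_sum_0: "regular_cube_sum 0 = - eisenstein 3"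
  by (simp add: regular_cube_sum_def eisenstein_def infsum_uminus power3_eq_cube)

lemma eisenstein_odd:
  assumes "odd k"
  shows "eisenstein k = 0"
proof -
  have "eisenstein k = (\<Sum>\<^sub>\<infinity>w\<in>lattice - {0}. - (1 / w ^ k))"
    unfolding eisenstein_def
    by (rule infsum_reindex_bij_witness[where i=uminus and j=uminus])
      (use assms in \<open>auto simp: power_minus_odd\<close>)
  then show ?thesis by (simp add: infsum_uminus eisenstein_def)
qed

text \<open>With \<open>u = z / w\<close>, the coefficients 1, 3, 6, 10 are those of
  \<open>(1 - u)^(-3)\<close>; up to sign and the factor \<open>1 / w^3\<close> the remainder is
  \<open>u^4 (15 - 24 u + 10 u^2) / (1 - u)^3\<close>. For \<open>norm u \<le> 1/2\<close> the
  quadratic is at most 30 and the inverse cube at most 8, whence 240.\<close>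

lemma cube_expansion:
  fixes z w :: complex
  assumes "w \<noteq> 0" "norm z \<le> norm w / 2"
  shows "norm (1 / (z - w) ^ 3 + (1 / w ^ 3 + 3 * z * (1 / w ^ 4) + 6 * z\<^sup>2 * (1 / w ^ 5) + 10 * z ^ 3 * (1 / w ^ 6))) \<le>
    240 * norm z ^ 4 * (1 / norm w ^ 7)"
proof -
  define u where "u = z / w"
  have u: "norm u \<le> 1 / 2" using assms by (simp add: u_def norm_divide field_simps)
  have z: "z = u * w" using assms by (simp add: u_def)
  have "1 / 2 \<le> norm (1 - u)" using u norm_triangle_ineq2[of 1 u] by simp
  then have "(1 / 2) ^ 3 \<le> norm (1 - u) ^ 3" by (intro power_mono) auto
  then have u3: "1 / 8 \<le> norm ((1 - u) ^ 3)" by (simp add: norm_power power_divide)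
  then have nz: "1 - u \<noteq> 0" by auto
  have "1 / (z - w) ^ 3 = - (1 / (w ^ 3 * (1 - u) ^ 3))"
  proof -
    have "(z - w) ^ 3 = - (w ^ 3 * (1 - u) ^ 3)" unfolding z by (simp add: power3_eq_cube algebra_simps)
    then show ?thesis by simp
  qed
  moreover have "1 / w ^ 3 + 3 * z * (1 / w ^ 4) + 6 * z\<^sup>2 * (1 / w ^ 5) + 10 * z ^ 3 * (1 / w ^ 6) =
      (1 + 3 * u + 6 * u\<^sup>2 + 10 * u ^ 3) / w ^ 3"
    unfolding z using assms(1) by (simp add: field_simps power_numeral_reduce)
  moreover have "- (1 / (w ^ 3 * (1 - u) ^ 3)) + (1 + 3 * u + 6 * u\<^sup>2 + 10 * u ^ 3) / w ^ 3 =
      - (u ^ 4 * (15 - 24 * u + 10 * u\<^sup>2) / (1 - u) ^ 3 / w ^ 3)"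
    using assms(1) nz by (simp add: divide_simps) (simp add: algebra_simps power_numeral_reduce)
  ultimately have eq: "1 / (z - w) ^ 3 + (1 / w ^ 3 + 3 * z * (1 / w ^ 4) + 6 * z\<^sup>2 * (1 / w ^ 5) + 10 * z ^ 3 * (1 / w ^ 6)) =
      - (u ^ 4 * (15 - 24 * u + 10 * u\<^sup>2) / (1 - u) ^ 3 / w ^ 3)"
    by simp
  have "norm (15 - 24 * u + 10 * u\<^sup>2) \<le> norm (15 - 24 * u) + norm (10 * u\<^sup>2)"
    by (rule norm_triangle_ineq)
  also have "\<dots> \<le> (15 + 24 * norm u) + 10 * norm u ^ 2"
    using norm_triangle_ineq4[of 15 "24 * u"] by (intro add_mono) (simp_all add: norm_mult norm_power)
  also have "\<dots> \<le> (15 + 24 * (1 / 2)) + 10 * (1 / 2) ^ 2"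
    using u by (intro add_mono mult_left_mono power_mono) auto
  finally have q: "norm (15 - 24 * u + 10 * u\<^sup>2) \<le> 30" by (simp add: power2_eq_square)
  have "norm (u ^ 4 * (15 - 24 * u + 10 * u\<^sup>2) / (1 - u) ^ 3 / w ^ 3) =
      norm u ^ 4 * (norm (15 - 24 * u + 10 * u\<^sup>2) / norm ((1 - u) ^ 3)) / norm w ^ 3"
    by (simp add: norm_mult norm_divide norm_power)
  also have "\<dots> \<le> norm u ^ 4 * (30 / (1 / 8)) / norm w ^ 3"
    using q u3 by (intro divide_right_mono mult_left_mono frac_le) auto
  also have "\<dots> = 240 * norm z ^ 4 * (1 / norm w ^ 7)"
    using assms(1) by (simp add: u_def norm_divide field_simps power_numeral_reduce)
  finally show ?thesis unfolding eq by simp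
qed

lemma regular_cube_sum_expansion:
  assumes "norm z \<le> 1 / (2 * lat_const)"
  shows "norm (regular_cube_sum z + 3 * eisenstein 4 * z + 10 * eisenstein 6 * z ^ 3) \<le>
     240 * (\<Sum>\<^sub>\<infinity>w\<in>lattice - {0}. 1 / norm w ^ 7) * norm z ^ 4"
proof -
  have small: "norm z \<le> norm w / 2" if "w \<in> lattice - {0}" for w
  proof -
    have "norm z \<le> 1 / lat_const / 2" using assms by simp
    also have "1 / lat_const \<le> norm w" using norm_lattice_nonzero_ge[of w] that by auto
    finally show ?thesis by simp
  qed
  have z: "z \<notin> lattice - {0}" using small[of z] by auto
  have e: "((\<lambda>w. 1 / w ^ k) has_sum eisenstein k) (lattice - {0})" if "k \<ge> 3" for k
    unfolding eisenstein_def using summable_lattice_inverse_power[OF that] by (rule has_sum_infsum)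
  have "((\<lambda>w. 1 / (z - w) ^ 3) has_sum regular_cube_sum z) (lattice - {0})"
    unfolding regular_cube_sum_def by (intro has_sum_infsum summable_regular_cube_sum z)
  then have "((\<lambda>w. 1 / (z - w) ^ 3 + (1 / w ^ 3 + 3 * z * (1 / w ^ 4) + 6 * z\<^sup>2 * (1 / w ^ 5) + 10 * z ^ 3 * (1 / w ^ 6))) has_sum
     (regular_cube_sum z + (eisenstein 3 + 3 * z * eisenstein 4 + 6 * z\<^sup>2 * eisenstein 5 + 10 * z ^ 3 * eisenstein 6))) (lattice - {0})"
    by (intro has_sum_add has_sum_cmult_right e) auto
  moreover have "((\<lambda>w. 240 * norm z ^ 4 * (1 / norm w ^ 7)) has_sum
      (240 * norm z ^ 4 * (\<Sum>\<^sub>\<infinity>w\<in>lattice - {0}. 1 / norm w ^ 7))) (lattice - {0})"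
    by (intro has_sum_cmult_right has_sum_infsum summable_lattice_power) simp
  ultimately have "norm (regular_cube_sum z + (eisenstein 3 + 3 * z * eisenstein 4 + 6 * z\<^sup>2 * eisenstein 5 + 10 * z ^ 3 * eisenstein 6)) \<le>
      240 * norm z ^ 4 * (\<Sum>\<^sub>\<infinity>w\<in>lattice - {0}. 1 / norm w ^ 7)"
    by (rule norm_infsum_le) (intro cube_expansion small, auto)
  \<comment> \<open>The Eisenstein sums of weight 3 and 5 vanish.\<close>
  then show ?thesis by (simp add: eisenstein_odd algebra_simps)
qed

end

lemma deriv_even_0:
  fixes f :: "complex \<Rightarrow> complex"
  assumes "f holomorphic_on ball 0 d" "d > 0" "\<And>z. z \<in> ball 0 d \<Longrightarrow> f (- z) = f z"
  shows "deriv f 0 = 0"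
proof -
  have f: "(f has_field_derivative deriv f 0) (at 0)"
    using assms by (intro holomorphic_derivI[of f "ball 0 d"]) auto
  have m: "(uminus has_field_derivative (- 1 :: complex)) (at (0::complex))"
    using DERIV_minus[OF DERIV_ident[of "at (0::complex)"]] by simp
  have "(f has_field_derivative deriv f 0) (at (- 0))" using f by simp
  then have "((\<lambda>z. f (- z)) has_field_derivative - deriv f 0) (at 0)"
    using DERIV_chain2[of f "deriv f 0" uminus 0 "- 1" UNIV] m by simp
  then have "(f has_field_derivative - deriv f 0) (at 0)"
    by (rule has_field_derivative_transform_within_open[of _ _ _ "ball 0 d"]) (use assms in auto)
  with f have "deriv f 0 = - deriv f 0" by (intro DERIV_unique) auto
  then show ?thesis by simp
qed

text \<open>An even elliptic function with principal part \<open>1 / z\<^sup>2\<close> at the lattice points differs from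
  the Weierstrass function by the constant \<open>h 0\<close>.\<close>

locale weierstrass_function = upper_half_plane +
  fixes X h :: "complex \<Rightarrow> complex" and d :: real
  assumes X_holo: "X holomorphic_on - lattice"
    and X_per: "\<And>z. X (z + 1) = X z" "\<And>z. X (z + \<tau>) = X z"
    and X_even: "\<And>z. X (- z) = X z"
    and d_pos: "d > 0"
    and h_holo: "h holomorphic_on ball 0 d"
    and X_h: "\<And>z. z \<in> ball 0 d - {0} \<Longrightarrow> z \<notin> lattice \<and> X z = 1 / z\<^sup>2 + h z"
begin

lemma h_even: "z \<in> ball 0 d \<Longrightarrow> h (- z) = h z"
  using X_h[of z] X_h[of "- z"] X_even[of z] by (cases "z = 0") auto

lemma h_deriv: "z \<in> ball 0 d \<Longrightarrow> (h has_field_derivative deriv h z) (at z)"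
  using h_holo by (intro holomorphic_derivI[of h "ball 0 d"]) auto

lemma deriv_h_0: "deriv h 0 = 0"
  using h_holo d_pos h_even by (rule deriv_even_0)

lemma deriv_X_near: 
  assumes "z \<in> ball 0 d - {0}"
  shows "deriv X z = - 2 / z ^ 3 + deriv h z"
proof -
  have "((\<lambda>z. 1 / z\<^sup>2 + h z) has_field_derivative - 2 / z ^ 3 + deriv h z) (at z)"
    by (rule derivative_eq_intros h_deriv refl | use assms in force)+
      (use assms in \<open>simp add: field_simps power2_eq_square power3_eq_cube\<close>)
  then have "(X has_field_derivative - 2 / z ^ 3 + deriv h z) (at z)"
    by (rule has_field_derivative_transform_within_open[of _ _ _ "ball 0 d - {0}"])
      (use assms X_h in auto)
  then show ?thesis by (rule DERIV_imp_deriv)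
qed

lemma deriv_X_periodic: "(\<And>z. X (z + p) = X z) \<Longrightarrow> deriv X (z + p) = deriv X z"
  unfolding deriv_def DERIV_shift by simp

lemma holomorphic_isCont:
  assumes "f holomorphic_on S" "open S" "z \<in> S"
  shows "f \<midarrow>z\<rightarrow> f z"
  using holomorphic_on_imp_continuous_on[OF assms(1)] assms(2,3)
  by (simp add: continuous_on_eq_continuous_at isCont_def)

lemma open_off_lattice: "open (- lattice)" "open (- (lattice - {0}))"
  by (rule open_Compl, rule closed_lattice_subset, blast)+

text \<open>Both sides are elliptic with the same pole at \<open>0\<close>, and their difference
  tends there to \<open>deriv h 0 - 2 * eisenstein 3 = 0\<close>.\<close>

lemma deriv_X: "z \<notin> lattice \<Longrightarrow> deriv X z = - 2 * inverse_cube_sum z"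
proof -
  have "deriv X z + 2 * inverse_cube_sum z = 0" if "z \<notin> lattice" for z
  proof (rule elliptic_constant[of "\<lambda>z. deriv X z + 2 * inverse_cube_sum z"])
    have "(\<lambda>z. deriv X z + 2 * (1 / z ^ 3 + regular_cube_sum z)) holomorphic_on - lattice"
      by (intro holomorphic_intros holomorphic_deriv X_holo open_off_lattice
          holomorphic_on_subset[OF regular_cube_sum_holomorphic]) auto
    then show "(\<lambda>z. deriv X z + 2 * inverse_cube_sum z) holomorphic_on - lattice"
      by (rule holomorphic_transform) (simp add: inverse_cube_sum_eq)
    have "(\<lambda>z. deriv h z + 2 * regular_cube_sum z) \<midarrow>0\<rightarrow> deriv h 0 + 2 * regular_cube_sum 0"
      using d_pos h_holo regular_cube_sum_holomorphic open_off_lattice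
      by (intro tendsto_intros holomorphic_isCont[of _ "ball 0 d"] holomorphic_isCont[of _ "- (lattice - {0})"] holomorphic_deriv) auto
    moreover have "\<forall>\<^sub>F z in at 0. deriv h z + 2 * regular_cube_sum z = deriv X z + 2 * inverse_cube_sum z"
    proof (rule eventually_mono[OF eventually_at_in_open[of "ball 0 d" 0]])
      fix z :: complex assume "z \<in> ball 0 d - {0}"
      then show "deriv h z + 2 * regular_cube_sum z = deriv X z + 2 * inverse_cube_sum z"
        using deriv_X_near[of z] inverse_cube_sum_eq[of z] X_h[of z] by (simp add: algebra_simps)
    qed (use d_pos in auto)
    ultimately show "(\<lambda>z. deriv X z + 2 * inverse_cube_sum z) \<midarrow>0\<rightarrow> 0"
      by (rule Lim_transform_eventually[THEN tendsto_eq_rhs])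
        (simp add: deriv_h_0 regular_cube_sum_0 eisenstein_odd)
  qed (use that X_per deriv_X_periodic inverse_cube_sum_periodic in auto)
  then show "z \<notin> lattice \<Longrightarrow> deriv X z = - 2 * inverse_cube_sum z"
    by (simp add: eq_neg_iff_add_eq_0)
qed

text \<open>The derivative is odd, and a half period agrees with its negative modulo the
  lattice.\<close>

lemma deriv_X_half_period:
  assumes "z \<notin> lattice" "2 * z \<in> lattice"
  shows "deriv X z = 0"
proof -
  have "inverse_cube_sum z = inverse_cube_sum (- z + 2 * z)" by simp
  also have "\<dots> = - inverse_cube_sum z"
    by (simp only: inverse_cube_sum_periodic[OF assms(2)] inverse_cube_sum_minus)
  finally show ?thesis using deriv_X[OF assms(1)] by simp
qed

text \<open>The difference \<open>D\<close> of the two sides is elliptic, so it is enough that it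
  tends to \<open>0\<close> at \<open>0\<close>. For this the expansions of \<open>X\<close> and its
  derivative are needed only up to errors \<open>A\<close> and \<open>B\<close> of order 5 and
  4.\<close>

lemma weierstrass_equation:
  assumes "z \<notin> lattice"
  shows "(deriv X z)\<^sup>2 = 4 * (X z - h 0) ^ 3 - 60 * eisenstein 4 * (X z - h 0) - 140 * eisenstein 6"
proof -
  define G4 where "G4 = eisenstein 4"
  define G6 where "G6 = eisenstein 6"
  define C where "C = 480 * (\<Sum>\<^sub>\<infinity>w\<in>lattice - {0}. 1 / norm w ^ 7)"
  have C: "C \<ge> 0" unfolding C_def by (intro mult_nonneg_nonneg infsum_nonneg) auto
  define r where "r = min d (1 / (2 * lat_const))"
  have r: "r > 0" "r \<le> d" "r \<le> 1 / (2 * lat_const)" using d_pos lat_const_pos by (auto simp: r_def)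
  define B where "B z = deriv h z - 6 * G4 * z - 20 * G6 * z ^ 3" for z
  define A where "A z = h z - h 0 - 3 * G4 * z\<^sup>2 - 5 * G6 * z ^ 4" for z
  have B: "norm (B z) \<le> C * norm z ^ 4" if "norm z < r" for z
  proof (cases "z = 0")
    case False
    have z: "z \<in> ball 0 d - {0}" using False that r by auto
    have "deriv h z = - 2 * regular_cube_sum z"
      using deriv_X_near[OF z] deriv_X[of z] inverse_cube_sum_eq[of z] X_h[OF z] by (simp add: algebra_simps)
    then have "B z = - 2 * (regular_cube_sum z + 3 * eisenstein 4 * z + 10 * eisenstein 6 * z ^ 3)"
      by (simp add: B_def G4_def G6_def algebra_simps)
    then have "norm (B z) = 2 * norm (regular_cube_sum z + 3 * eisenstein 4 * z + 10 * eisenstein 6 * z ^ 3)"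
      by (simp only: norm_mult) simp
    also have "\<dots> \<le> 2 * (240 * (\<Sum>\<^sub>\<infinity>w\<in>lattice - {0}. 1 / norm w ^ 7) * norm z ^ 4)"
      using that r by (intro mult_left_mono regular_cube_sum_expansion) auto
    finally show ?thesis by (simp add: C_def)
  qed (simp add: B_def deriv_h_0)
  have A_deriv: "(A has_field_derivative B z) (at z)" if "norm z < r" for z
    unfolding A_def B_def using h_deriv[of z] that r
    by (auto intro!: derivative_eq_intros simp: power_numeral_reduce)
  have A: "norm (A z) \<le> C * norm z ^ 5" if z: "norm z < r" for z
  proof -
    \<comment> \<open>\<open>B\<close> is the derivative of \<open>A\<close>, so the mean value
      bound gains one order.\<close>
    have "norm (A z - A 0) \<le> (C * norm z ^ 4) * norm (z - 0)"
    proof (rule field_differentiable_bound)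
      show "convex (cball (0::complex) (norm z))" by simp
      show "(A has_field_derivative B x) (at x within cball 0 (norm z))" if "x \<in> cball 0 (norm z)" for x
        using that z by (auto intro: has_field_derivative_at_within[OF A_deriv])
      show "norm (B x) \<le> C * norm z ^ 4" if x: "x \<in> cball 0 (norm z)" for x
      proof -
        have "norm (B x) \<le> C * norm x ^ 4" using x z by (intro B) auto
        also have "\<dots> \<le> C * norm z ^ 4" using x C by (intro mult_left_mono power_mono) auto
        finally show ?thesis .
      qed
    qed auto
    then show ?thesis by (simp add: A_def power_numeral_reduce mult_ac)
  qed
  have small: "(\<lambda>z. f z / z ^ k) \<midarrow>0\<rightarrow> 0"
    if f: "\<And>z. norm z < r \<Longrightarrow> norm (f z) \<le> C * norm z ^ Suc k" for f :: "complex \<Rightarrow> complex" and k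
  proof (rule Lim_null_comparison)
    show "\<forall>\<^sub>F z in at 0. norm (f z / z ^ k) \<le> C * norm z"
    proof (rule eventually_mono[OF eventually_at_in_open[of "ball 0 r" 0]])
      fix z :: complex assume "z \<in> ball 0 r - {0}"
      then have "norm (f z) \<le> C * norm z ^ Suc k" "z \<noteq> 0" using f by auto
      then show "norm (f z / z ^ k) \<le> C * norm z" by (simp add: norm_divide norm_power field_simps)
    qed (use r in auto)
    show "((\<lambda>z. C * norm z) \<longlongrightarrow> 0) (at (0::complex))"
      by (rule tendsto_eq_intros refl | simp)+
  qed
  define a where "a z = A z / z ^ 4" for z
  define b where "b z = B z / z ^ 3" for z
  have a: "a \<midarrow>0\<rightarrow> 0" unfolding a_def using A by (intro small) (simp add: eval_nat_numeral)
  have b: "b \<midarrow>0\<rightarrow> 0" unfolding b_def using B by (intro small) (simp add: eval_nat_numeral)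
  define u where "u z = 3 * G4 * z + 5 * G6 * z ^ 3 + z ^ 3 * a z" for z
  define v where "v z = 6 * G4 + 20 * G6 * z\<^sup>2 + z\<^sup>2 * b z" for z
  define D where "D z = (deriv X z)\<^sup>2 - 4 * (X z - h 0) ^ 3 + 60 * G4 * (X z - h 0) + 140 * G6" for z
  have D: "- 4 * b z - 12 * a z + z\<^sup>2 * (v z)\<^sup>2 - 12 * (u z)\<^sup>2 - 4 * z ^ 3 * u z ^ 3 + 60 * G4 * z * u z = D z"
    if z: "z \<in> ball 0 r - {0}" for z
  proof -
    have z': "z \<in> ball 0 d - {0}" "z \<noteq> 0" using z r by auto
    define y where "y = 1 / z"
    have yz: "y * z = 1" using z' by (simp add: y_def)
    have "X z - h 0 = 1 / z\<^sup>2 + 3 * G4 * z\<^sup>2 + 5 * G6 * z ^ 4 + A z"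
      using X_h[OF z'(1)] by (simp add: A_def)
    also have "\<dots> = y\<^sup>2 + z * u z"
      using z' by (simp add: u_def a_def y_def field_simps power_numeral_reduce)
    finally have P: "X z - h 0 = y\<^sup>2 + z * u z" .
    have "deriv X z = - 2 / z ^ 3 + 6 * G4 * z + 20 * G6 * z ^ 3 + B z"
      using deriv_X_near[OF z'(1)] by (simp add: B_def)
    also have "\<dots> = - 2 * y ^ 3 + z * v z"
      using z' by (simp add: v_def b_def y_def field_simps power_numeral_reduce)
    finally have Q: "deriv X z = - 2 * y ^ 3 + z * v z" .
    have yv: "y\<^sup>2 * v z = 6 * G4 * y\<^sup>2 + 20 * G6 + b z"
      using z' by (simp add: v_def y_def field_simps)
    have yu: "y ^ 3 * u z = 3 * G4 * y\<^sup>2 + 5 * G6 + a z"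
      using z' by (simp add: u_def y_def field_simps power_numeral_reduce)
    have s1: "(- 2 * y ^ 3 + z * v z)\<^sup>2 = 4 * y ^ 6 - 4 * (y * z) * (y\<^sup>2 * v z) + z\<^sup>2 * (v z)\<^sup>2"
      by (simp add: power_numeral_reduce algebra_simps)
    have s2: "(y\<^sup>2 + z * u z) ^ 3 = y ^ 6 + 3 * (y * z) * (y ^ 3 * u z) + 3 * (y * z)\<^sup>2 * (u z)\<^sup>2 + z ^ 3 * u z ^ 3"
      by (simp add: power_numeral_reduce algebra_simps)
    \<comment> \<open>With \<open>y = 1 / z\<close> the terms \<open>4 * y ^ 6\<close> cancel, those
      in \<open>y ^ 2\<close> cancel because \<open>60 = 24 + 36\<close>, and the constants because
      \<open>140 = 80 + 60\<close>.\<close>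
    show ?thesis unfolding D_def P Q s1 s2 yv yu yz by (simp add: algebra_simps)
  qed
  have "(\<lambda>z. - 4 * b z - 12 * a z + z\<^sup>2 * (v z)\<^sup>2 - 12 * (u z)\<^sup>2 - 4 * z ^ 3 * u z ^ 3 + 60 * G4 * z * u z) \<midarrow>0\<rightarrow> 0"
    unfolding u_def v_def by (rule tendsto_eq_intros a b refl | simp)+
  moreover have "\<forall>\<^sub>F z in at 0. - 4 * b z - 12 * a z + z\<^sup>2 * (v z)\<^sup>2 - 12 * (u z)\<^sup>2 - 4 * z ^ 3 * u z ^ 3 + 60 * G4 * z * u z = D z"
    by (rule eventually_mono[OF eventually_at_in_open[of "ball 0 r" 0]]) (use r D in auto)
  ultimately have "D \<midarrow>0\<rightarrow> 0" by (rule Lim_transform_eventually)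
  moreover have "D holomorphic_on - lattice"
    unfolding D_def by (intro holomorphic_intros holomorphic_deriv X_holo open_off_lattice)
  moreover have "D (z + 1) = D z" "D (z + \<tau>) = D z" for z
    unfolding D_def by (simp_all only: X_per deriv_X_periodic[of 1, OF X_per(1)] deriv_X_periodic[of \<tau>, OF X_per(2)])
  ultimately have "D z = 0" using elliptic_constant[of D 0 z] assms by blast
  then show ?thesis by (simp add: D_def G4_def G6_def algebra_simps)
qed

end

section \<open>Theta functions and the triple product\<close>

definition linear_prod :: "(nat \<Rightarrow> complex) \<Rightarrow> complex \<Rightarrow> complex" where
  "linear_prod c x = lim (\<lambda>N. \<Prod>k<N. 1 + c k * x)"

lemma uniform_limit_linear_prod:
  assumes "summable (\<lambda>k. norm (c k))"
  shows "uniform_limit (cball 0 r) (\<lambda>N x. \<Prod>k<N. 1 + c k * x) (linear_prod c) sequentially"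
proof -
  have "uniformly_convergent_on (cball 0 r) (\<lambda>N x. \<Prod>k<N. 1 + c k * x)"
  proof (rule uniformly_convergent_on_prod)
    show "uniformly_convergent_on (cball 0 r) (\<lambda>N x. \<Sum>k<N. norm (c k * x))"
    proof (rule Weierstrass_m_test')
      show "norm (norm (c k * x)) \<le> norm (c k) * r" if "x \<in> cball 0 r" for k x
        using that by (auto simp: norm_mult intro!: mult_left_mono)
      show "summable (\<lambda>k. norm (c k) * r)" using assms by (rule summable_mult2)
    qed
  qed (auto intro!: continuous_intros)
  then show ?thesis unfolding linear_prod_def uniformly_convergent_uniform_limit_iff .
qed

lemma linear_prod_tendsto:
  assumes "summable (\<lambda>k. norm (c k))"
  shows "(\<lambda>N. \<Prod>k<N. 1 + c k * x) \<longlonglongrightarrow> linear_prod c x"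
  using uniform_limit_linear_prod[OF assms, of "norm x"] by (rule tendsto_uniform_limitI) simp

lemma linear_prod_isCont:
  assumes "summable (\<lambda>k. norm (c k))"
  shows "isCont (linear_prod c) x"
proof -
  have "continuous_on (cball 0 (norm x + 1)) (linear_prod c)"
    using uniform_limit_linear_prod[OF assms]
    by (rule uniform_limit_theorem[rotated]) (auto intro!: always_eventually continuous_intros)
  then show ?thesis
    by (rule continuous_on_interior) (simp add: interior_cball)
qed

lemma linear_prod_nonzero:
  assumes "summable (\<lambda>k. norm (c k))" "\<And>k. 1 + c k * x \<noteq> 0"
  shows "linear_prod c x \<noteq> 0"
proof -
  have "summable (\<lambda>k. norm (c k) * norm x)" using assms(1) by (rule summable_mult2)
  then have "abs_convergent_prod (\<lambda>k. 1 + c k * x)"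
    by (intro summable_imp_abs_convergent_prod) (simp add: norm_mult)
  then have conv: "convergent_prod (\<lambda>k. 1 + c k * x)" by (rule abs_convergent_prod_imp_convergent_prod)
  then have "prodinf (\<lambda>k. 1 + c k * x) \<noteq> 0" using assms(2) by (rule prodinf_nonzero)
  moreover have "(\<lambda>N. \<Prod>k<N. 1 + c k * x) \<longlonglongrightarrow> prodinf (\<lambda>k. 1 + c k * x)"
    using conv by (intro has_prod_imp_tendsto' convergent_prod_has_prod)
  then have "prodinf (\<lambda>k. 1 + c k * x) = linear_prod c x"
    using linear_prod_tendsto[OF assms(1)] by (rule LIMSEQ_unique)
  ultimately show ?thesis by simp
qed

section \<open>The q-binomial theorem\<close>

definition q_factorial :: "complex \<Rightarrow> nat \<Rightarrow> complex" where
  "q_factorial Q n = (\<Prod>k<n. 1 - Q ^ Suc k)"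

definition q_binomial :: "complex \<Rightarrow> nat \<Rightarrow> nat \<Rightarrow> complex" where
  "q_binomial Q M m = (if m \<le> M then q_factorial Q M / (q_factorial Q m * q_factorial Q (M - m)) else 0)"

lemma power_neq_1:
  fixes Q :: complex
  assumes "norm Q < 1"
  shows "Q ^ Suc k \<noteq> 1"
proof
  assume "Q ^ Suc k = 1"
  then have "norm Q ^ Suc k = 1" by (metis norm_one norm_power)
  then show False using power_Suc_less_one[of "norm Q" k] assms by (cases "norm Q = 0") auto
qed

lemma q_factorial_nonzero: "norm Q < 1 \<Longrightarrow> q_factorial Q n \<noteq> 0"
  unfolding q_factorial_def using power_neq_1[of Q] by (auto simp del: power_Suc dest!: sym[of 1])

lemma q_factorial_Suc: "q_factorial Q (Suc n) = q_factorial Q n * (1 - Q ^ Suc n)"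
  by (simp add: q_factorial_def)

lemma q_binomial_0: "norm Q < 1 \<Longrightarrow> q_binomial Q M 0 = 1"
  using q_factorial_nonzero[of Q M] by (simp add: q_binomial_def q_factorial_def)

text \<open>Of the two q-Pascal rules, the one that fits splitting off the last factor
  \<open>1 + Q ^ M * x\<close>.\<close>

lemma q_pascal:
  assumes "norm Q < 1" "m \<le> M"
  shows "q_binomial Q (Suc M) (Suc m) = q_binomial Q M (Suc m) + Q ^ (M - m) * q_binomial Q M m"
proof (cases "m = M")
  case True
  then show ?thesis using q_factorial_nonzero[OF assms(1)] by (simp add: q_binomial_def)
next
  case False
  then obtain j where j: "M = Suc (m + j)" using assms(2) by (metis le_neq_implies_less less_iff_Suc_add)
  let ?f = "q_factorial Q"
  have nz: "?f n \<noteq> 0" for n using q_factorial_nonzero[OF assms(1)] .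
  have nz': "1 - Q ^ Suc n \<noteq> 0" for n using power_neq_1[OF assms(1), of n] by simp
  have a: "q_binomial Q (Suc M) (Suc m) = ?f M * (1 - Q ^ Suc M) / (?f m * (1 - Q ^ Suc m) * (?f j * (1 - Q ^ Suc j)))"
    using j by (simp add: q_binomial_def q_factorial_Suc del: power_Suc)
  have b: "q_binomial Q M (Suc m) = ?f M / (?f m * (1 - Q ^ Suc m) * ?f j)"
    using j by (simp add: q_binomial_def q_factorial_Suc[of Q m] del: power_Suc)
  have c: "q_binomial Q M m = ?f M / (?f m * (?f j * (1 - Q ^ Suc j)))"
    using j by (simp add: q_binomial_def q_factorial_Suc[of Q j] Suc_diff_le del: power_Suc)
  have M: "M - m = Suc j" "Q ^ Suc M = Q ^ Suc m * Q ^ Suc j" using j by (simp_all flip: power_add)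
  show ?thesis unfolding a b c M
    using nz[of m] nz[of j] nz'[of m] nz'[of j] by (simp add: divide_simps del: power_Suc) (simp add: algebra_simps)
qed

lemma q_binomial_theorem:
  assumes "norm Q < 1"
  shows "(\<Prod>k<M. 1 + Q ^ k * x) = (\<Sum>m\<le>M. q_binomial Q M m * Q ^ (m * (m - 1) div 2) * x ^ m)"
proof (induction M)
  case 0
  then show ?case by (simp add: q_binomial_0[OF assms])
next
  case (Suc M)
  let ?c = "\<lambda>M m. q_binomial Q M m * Q ^ (m * (m - 1) div 2)"
  have step: "?c (Suc M) (Suc m) = ?c M (Suc m) + Q ^ M * ?c M m" if "m \<le> M" for m
  proof -
    have t: "Suc m * (Suc m - 1) div 2 = m * (m - 1) div 2 + m"
    proof -
      have "Suc m * (Suc m - 1) = m * (m - 1) + m * 2" by (cases m) auto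
      then show ?thesis by simp
    qed
    have "Q ^ (M - m) * Q ^ m = Q ^ M" using that by (simp flip: power_add)
    then show ?thesis unfolding t q_pascal[OF assms that] by (simp add: power_add algebra_simps)
  qed
  have "(\<Prod>k<Suc M. 1 + Q ^ k * x) = (\<Sum>m\<le>M. ?c M m * x ^ m) + (\<Sum>m\<le>M. Q ^ M * ?c M m * x ^ Suc m)"
    unfolding prod.lessThan_Suc Suc.IH
    by (simp add: ring_distribs sum_distrib_left sum_distrib_right sum.distrib mult_ac)
  also have "(\<Sum>m\<le>M. ?c M m * x ^ m) = (\<Sum>m\<le>Suc M. ?c M m * x ^ m)"
    by (simp add: q_binomial_def)
  also have "\<dots> = ?c M 0 + (\<Sum>m\<le>M. ?c M (Suc m) * x ^ Suc m)"
    by (subst sum.atMost_Suc_shift) simp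
  also have "\<dots> + (\<Sum>m\<le>M. Q ^ M * ?c M m * x ^ Suc m) = ?c M 0 + (\<Sum>m\<le>M. ?c (Suc M) (Suc m) * x ^ Suc m)"
    unfolding add.assoc sum.distrib[symmetric] by (intro arg_cong2[where f="(+)"] sum.cong refl) (simp only: step atMost_iff ring_distribs)
  also have "\<dots> = (\<Sum>m\<le>Suc M. ?c (Suc M) m * x ^ m)"
    by (subst sum.atMost_Suc_shift) (simp add: q_binomial_0[OF assms])
  finally show ?case .
qed

context upper_half_plane
begin

section \<open>The theta series and the triple product\<close>

definition theta_term :: "int \<Rightarrow> complex \<Rightarrow> complex" where
  "theta_term n z = exp (pi * \<i> * of_int n ^ 2 * \<tau> + 2 * pi * \<i> * of_int n * z)"

lemma theta3_eq: "theta3 z \<tau> = (\<Sum>\<^sub>\<infinity>n. theta_term n z)"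
  by (simp add: theta3_def theta_term_def)

lemma norm_theta_term_le:
  assumes "\<bar>Im z\<bar> \<le> R"
  shows "norm (theta_term n z) \<le> exp (pi * ((2 * R + 1)\<^sup>2 / (4 * Im \<tau>))) * exp (- pi * \<bar>real_of_int n\<bar>)"
proof -
  let ?y = "Im \<tau>" and ?n = "real_of_int n"
  \<comment> \<open>Completes the square in \<open>|n|\<close>; the extra \<open>1\<close> in
    \<open>2 * R + 1\<close> reserves the decaying factor \<open>exp (- pi * |n|)\<close>.\<close>
  have "(2 * ?y * \<bar>?n\<bar> - (2 * R + 1))\<^sup>2 \<ge> 0" by simp
  then have "4 * ?y * ((2 * R + 1) * \<bar>?n\<bar> - ?n\<^sup>2 * ?y) \<le> (2 * R + 1)\<^sup>2"
    by (simp add: power2_eq_square algebra_simps)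
  then have 1: "(2 * R + 1) * \<bar>?n\<bar> - ?n\<^sup>2 * ?y \<le> (2 * R + 1)\<^sup>2 / (4 * ?y)"
    using Im_tau by (simp add: field_simps)
  have "- (?n * Im z) \<le> \<bar>?n\<bar> * \<bar>Im z\<bar>" by (metis abs_ge_minus_self abs_mult)
  also have "\<dots> \<le> \<bar>?n\<bar> * R" using assms by (intro mult_left_mono) auto
  finally have "- ?n\<^sup>2 * ?y - 2 * ?n * Im z \<le> (2 * R + 1)\<^sup>2 / (4 * ?y) - \<bar>?n\<bar>"
    using 1 by (simp add: algebra_simps)
  then have "pi * (- ?n\<^sup>2 * ?y - 2 * ?n * Im z) \<le> pi * ((2 * R + 1)\<^sup>2 / (4 * ?y) - \<bar>?n\<bar>)"
    by (intro mult_left_mono) auto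
  moreover have "norm (theta_term n z) = exp (pi * (- ?n\<^sup>2 * ?y - 2 * ?n * Im z))"
  proof -
    have "Re (pi * \<i> * of_int n ^ 2 * \<tau> + 2 * pi * \<i> * of_int n * z) = pi * (- ?n\<^sup>2 * ?y - 2 * ?n * Im z)"
      by (simp add: power2_eq_square algebra_simps)
    then show ?thesis by (simp only: theta_term_def norm_exp_eq_Re)
  qed
  ultimately show ?thesis by (simp add: exp_add[symmetric] algebra_simps)
qed

lemma summable_theta_bound: "(\<lambda>n. c * exp (- pi * \<bar>real_of_int n\<bar>)) summable_on UNIV"
proof (intro summable_on_cmult_right summable_on_int_abs)
  show "summable (\<lambda>n. exp (- pi) ^ n)" by (rule summable_geometric) simp
  show "exp (- pi * \<bar>real_of_int n\<bar>) = exp (- pi) ^ nat \<bar>n\<bar>" for n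
    by (simp flip: exp_of_nat_mult)
qed auto

lemma theta3_has_sum: "((\<lambda>n. theta_term n z) has_sum theta3 z \<tau>) UNIV"
  unfolding theta3_eq
proof (rule has_sum_infsum, rule abs_summable_summable)
  show "(\<lambda>n. norm (theta_term n z)) summable_on UNIV"
    by (rule summable_on_comparison_test[OF summable_theta_bound]) (use norm_theta_term_le[OF order_refl] in auto)
qed

lemma theta3_holomorphic: "(\<lambda>z. theta3 z \<tau>) holomorphic_on UNIV"
  unfolding holomorphic_on_def
proof
  fix z :: complex
  let ?f = "\<lambda>X x. \<Sum>n\<in>X. theta_term n x"
  have im: "\<bar>Im x\<bar> \<le> \<bar>Im z\<bar> + 1" if "x \<in> cball z 1" for x
  proof -
    have "\<bar>Im (x - z)\<bar> \<le> 1" using abs_Im_le_cmod[of "x - z"] that by (simp add: dist_norm norm_minus_commute)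
    then show ?thesis by simp
  qed
  have "uniform_limit (cball z 1) ?f (\<lambda>z. theta3 z \<tau>) (finite_subsets_at_top UNIV)"
    unfolding theta3_eq
    by (rule Weierstrass_m_test_general[OF norm_theta_term_le[OF im] summable_theta_bound])
  moreover have "\<forall>\<^sub>F X in finite_subsets_at_top UNIV. continuous_on (cball z 1) (?f X) \<and> ?f X holomorphic_on ball z 1"
    unfolding theta_term_def by (intro always_eventually allI conjI continuous_intros holomorphic_intros)
  ultimately have "(\<lambda>z. theta3 z \<tau>) holomorphic_on ball z 1"
    using holomorphic_uniform_limit[of z 1 ?f "finite_subsets_at_top UNIV" "\<lambda>z. theta3 z \<tau>"] by simp
  then show "(\<lambda>z. theta3 z \<tau>) field_differentiable at z within UNIV"
    by (simp add: holomorphic_on_open field_differentiable_def)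
qed

lemma theta3_add_1: "theta3 (z + 1) \<tau> = theta3 z \<tau>"
proof -
  have "theta_term n (z + 1) = theta_term n z" for n
  proof -
    have "theta_term n (z + 1) = theta_term n z * exp (2 * pi * \<i> * of_int n)"
      unfolding theta_term_def exp_add[symmetric] by (rule arg_cong[where f=exp]) (simp add: algebra_simps)
    also have "exp (2 * pi * \<i> * of_int n) = 1" using exp_integer_2pi[of "of_int n"] by (simp add: mult_ac)
    finally show ?thesis by simp
  qed
  then show ?thesis by (simp add: theta3_eq)
qed

lemma theta3_minus: "theta3 (- z) \<tau> = theta3 z \<tau>"
  unfolding theta3_eq
  by (rule infsum_reindex_bij_witness[where i=uminus and j=uminus]) (auto simp: theta_term_def)

lemma theta3_add_tau: "theta3 (z + \<tau>) \<tau> = exp (- pi * \<i> * \<tau> - 2 * pi * \<i> * z) * theta3 z \<tau>"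
proof -
  have "theta3 (z + \<tau>) \<tau> = (\<Sum>\<^sub>\<infinity>n. exp (- pi * \<i> * \<tau> - 2 * pi * \<i> * z) * theta_term n z)"
    unfolding theta3_eq
  proof (rule infsum_reindex_bij_witness[where i="\<lambda>n. n - 1" and j="\<lambda>n. n + 1"])
    show "exp (- pi * \<i> * \<tau> - 2 * pi * \<i> * z) * theta_term (n + 1) z = theta_term n (z + \<tau>)" for n
      by (simp add: theta_term_def power2_eq_square algebra_simps flip: exp_add)
  qed auto
  then show ?thesis by (simp add: infsum_cmult_right' theta3_eq)
qed

definition nome :: complex where "nome = exp (pi * \<i> * \<tau>)"

lemma norm_nome: "norm nome < 1"
  using Im_tau by (simp add: nome_def norm_exp_eq_Re mult_pos_pos)

lemma nome_nonzero [simp]: "nome \<noteq> 0" by (simp add: nome_def)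

lemma norm_nome2: "norm (nome\<^sup>2) < 1"
  using norm_nome by (simp add: norm_power power_less_one_iff)

definition odd_nome :: "nat \<Rightarrow> complex" where "odd_nome k = nome ^ (2 * k + 1)"
definition even_nome :: "nat \<Rightarrow> complex" where "even_nome k = (nome\<^sup>2) ^ Suc k"

lemma summable_even_nome: "summable (\<lambda>k. norm (even_nome k))"
proof -
  have "summable (\<lambda>k. norm (nome\<^sup>2) * norm (nome\<^sup>2) ^ k)"
    using norm_nome2 by (intro summable_mult summable_geometric) simp
  then show ?thesis by (simp add: even_nome_def norm_mult norm_power)
qed

lemma summable_odd_nome: "summable (\<lambda>k. norm (odd_nome k))"
proof -
  have "summable (\<lambda>k. norm nome * norm (nome\<^sup>2) ^ k)"
    using norm_nome2 by (intro summable_mult summable_geometric) simp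
  then show ?thesis by (simp add: odd_nome_def norm_mult norm_power power_mult)
qed

text \<open>The product of \<open>1 - q ^ (2 k)\<close> over all \<open>k \<ge> 1\<close>, where
  \<open>q\<close> is the nome.\<close>

definition euler :: complex where "euler = linear_prod even_nome (-1)"

lemma q_factorial_tendsto: "q_factorial (nome\<^sup>2) \<longlonglongrightarrow> euler"
proof -
  have "q_factorial (nome\<^sup>2) = (\<lambda>N. \<Prod>k<N. 1 + even_nome k * - 1)"
    by (simp add: fun_eq_iff q_factorial_def even_nome_def)
  then show ?thesis using linear_prod_tendsto[OF summable_even_nome, of "- 1"] by (simp only: euler_def)
qed

lemma euler_nonzero: "euler \<noteq> 0"
  unfolding euler_def using power_neq_1[OF norm_nome2]
  by (intro linear_prod_nonzero summable_even_nome) (auto simp: even_nome_def simp del: power_Suc)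

definition w_exp :: "complex \<Rightarrow> complex" where "w_exp z = exp (2 * pi * \<i> * z)"

text \<open>The triple product arises from the q-binomial theorem for the finite products by a termwise
  limit.\<close>

definition partial_triple :: "nat \<Rightarrow> complex \<Rightarrow> complex" where
  "partial_triple N z = (\<Prod>k<N. 1 + odd_nome k * w_exp z) * (\<Prod>k<N. 1 + odd_nome k * w_exp (- z))"

lemma nome_power: "nome ^ n = exp (of_nat n * (pi * \<i> * \<tau>))"
  by (simp add: nome_def exp_of_nat_mult)

text \<open>The q-binomial theorem with base \<open>q ^ 2\<close>, \<open>2 N\<close> factors and
  \<open>x = q ^ (1 - 2 N) w\<close>: the factors carry the odd exponents from
  \<open>1 - 2 N\<close> to \<open>2 N - 1\<close>. From those with negative exponent the monomial
  is pulled out, which inverts \<open>w\<close> and produces \<open>e\<close>; dividing by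
  \<open>e\<close> centres the index at \<open>N\<close>.\<close>

lemma partial_triple_eq:
  "partial_triple N z = (\<Sum>m\<le>2 * N. q_binomial (nome\<^sup>2) (2 * N) m * theta_term (int m - int N) z)"
proof -
  define e where "e = exp (- pi * \<i> * \<tau> * of_nat N ^ 2 + 2 * pi * \<i> * z * of_nat N)"
  have e0: "e \<noteq> 0" by (simp add: e_def)
  define x where "x = exp (pi * \<i> * \<tau> * (1 - 2 * of_nat N) + 2 * pi * \<i> * z)"
  define y where "y k = (nome\<^sup>2) ^ k * x" for k
  have y: "y k = exp (pi * \<i> * \<tau> * (2 * of_nat k + 1 - 2 * of_nat N) + 2 * pi * \<i> * z)" for k
  proof -
    have "(nome\<^sup>2) ^ k = nome ^ (2 * k)" by (simp add: power_mult)
    then show ?thesis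
      unfolding y_def x_def exp_add[symmetric] nome_power[of "2 * k"]
      by (simp add: exp_add[symmetric] algebra_simps)
  qed
  have upper: "y (N + j) = odd_nome j * w_exp z" for j
    unfolding y odd_nome_def w_exp_def nome_power exp_add[symmetric]
    by (rule arg_cong[where f=exp]) (simp add: algebra_simps)
  have lower: "1 + y (N - Suc j) = exp (- pi * \<i> * \<tau> * (2 * of_nat j + 1) + 2 * pi * \<i> * z) * (1 + odd_nome j * w_exp (- z))"
    if "j < N" for j
  proof -
    have "y (N - Suc j) = exp (- pi * \<i> * \<tau> * (2 * of_nat j + 1) + 2 * pi * \<i> * z)"
      using that by (simp add: y of_nat_diff algebra_simps)
    moreover have "exp (- pi * \<i> * \<tau> * (2 * of_nat j + 1) + 2 * pi * \<i> * z) * (odd_nome j * w_exp (- z)) = exp 0"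
      unfolding odd_nome_def w_exp_def nome_power exp_add[symmetric]
      by (rule arg_cong[where f=exp]) (simp add: algebra_simps)
    ultimately show ?thesis by (simp add: ring_distribs)
  qed
  have prod_e: "(\<Prod>j<n. exp (- pi * \<i> * \<tau> * (2 * of_nat j + 1) + 2 * pi * \<i> * z)) =
      exp (- pi * \<i> * \<tau> * of_nat n ^ 2 + 2 * pi * \<i> * z * of_nat n)" for n
    by (induction n) (simp_all add: power2_eq_square algebra_simps flip: exp_add)
  have "{..<2 * N} = {..<N} \<union> {N..<2 * N}" by auto
  then have "(\<Prod>k<2 * N. 1 + y k) = (\<Prod>k<N. 1 + y k) * (\<Prod>k\<in>{N..<2 * N}. 1 + y k)"
    by (simp add: prod.union_disjoint ivl_disj_int)
  also have "(\<Prod>k\<in>{N..<2 * N}. 1 + y k) = (\<Prod>j<N. 1 + y (N + j))"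
    by (rule prod.reindex_bij_witness[of _ "\<lambda>j. N + j" "\<lambda>k. k - N"]) auto
  also have "(\<Prod>k<N. 1 + y k) = (\<Prod>j<N. 1 + y (N - Suc j))"
    by (rule prod.nat_diff_reindex[symmetric])
  also have "\<dots> = (\<Prod>j<N. exp (- pi * \<i> * \<tau> * (2 * of_nat j + 1) + 2 * pi * \<i> * z) * (1 + odd_nome j * w_exp (- z)))"
    by (intro prod.cong refl lower) simp
  also have "\<dots> = e * (\<Prod>j<N. 1 + odd_nome j * w_exp (- z))"
    unfolding prod.distrib prod_e e_def ..
  finally have prod_y: "(\<Prod>k<2 * N. 1 + y k) = e * partial_triple N z"
    by (simp add: partial_triple_def upper mult_ac)
  have sum_y: "(\<Prod>k<2 * N. 1 + y k) = (\<Sum>m\<le>2 * N. q_binomial (nome\<^sup>2) (2 * N) m * (nome\<^sup>2) ^ (m * (m - 1) div 2) * x ^ m)"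
    unfolding y_def by (rule q_binomial_theorem[OF norm_nome2])
  have "q_binomial (nome\<^sup>2) (2 * N) m * (nome\<^sup>2) ^ (m * (m - 1) div 2) * x ^ m =
      e * (q_binomial (nome\<^sup>2) (2 * N) m * theta_term (int m - int N) z)" for m
  proof -
    have "(nome\<^sup>2) ^ (m * (m - 1) div 2) * x ^ m = e * theta_term (int m - int N) z" for m
  proof -
    have "(nome\<^sup>2) ^ (m * (m - 1) div 2) = nome ^ (m * (m - 1))"
      unfolding power_mult[symmetric] by (cases "even m") (auto elim!: evenE oddE)
    also have "\<dots> = exp (of_nat (m * (m - 1)) * (pi * \<i> * \<tau>))" by (rule nome_power)
    also have "of_nat (m * (m - 1)) = (of_nat m ^ 2 - of_nat m :: complex)"
      by (cases m) (simp_all add: power2_eq_square algebra_simps)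
    finally have 1: "(nome\<^sup>2) ^ (m * (m - 1) div 2) = exp ((of_nat m ^ 2 - of_nat m) * (pi * \<i> * \<tau>))" .
    have 2: "x ^ m = exp (of_nat m * (pi * \<i> * \<tau> * (1 - 2 * of_nat N) + 2 * pi * \<i> * z))"
      by (simp add: x_def exp_of_nat_mult)
    show ?thesis unfolding 1 2 e_def theta_term_def exp_add[symmetric]
      by (simp add: power2_eq_square algebra_simps)
  qed
  then show ?thesis by (simp only: mult.assoc mult.left_commute)
  qed
  then have "e * partial_triple N z = e * (\<Sum>m\<le>2 * N. q_binomial (nome\<^sup>2) (2 * N) m * theta_term (int m - int N) z)"
    unfolding prod_y[symmetric] sum_y sum_distrib_left by (simp only:)
  then show ?thesis using e0 by simp
qed

definition triple_coeff :: "nat \<Rightarrow> int \<Rightarrow> complex" where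
  "triple_coeff N j = (if \<bar>j\<bar> \<le> int N then q_binomial (nome\<^sup>2) (2 * N) (nat (j + int N)) else 0)"

lemma partial_triple_infsum: "partial_triple N z = (\<Sum>\<^sub>\<infinity>j. triple_coeff N j * theta_term j z)"
proof -
  have "(\<Sum>\<^sub>\<infinity>j. triple_coeff N j * theta_term j z) = (\<Sum>\<^sub>\<infinity>j\<in>{- int N..int N}. triple_coeff N j * theta_term j z)"
    by (rule infsum_cong_neutral) (auto simp: triple_coeff_def)
  also have "\<dots> = (\<Sum>j\<in>{- int N..int N}. triple_coeff N j * theta_term j z)" by simp
  also have "\<dots> = (\<Sum>m\<le>2 * N. q_binomial (nome\<^sup>2) (2 * N) m * theta_term (int m - int N) z)"
    by (rule sum.reindex_bij_witness[of _ "\<lambda>m. int m - int N" "\<lambda>j. nat (j + int N)"])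
      (auto simp: triple_coeff_def)
  finally show ?thesis by (simp add: partial_triple_eq)
qed

text \<open>For fixed \<open>j\<close>, all three q-factorials in the coefficient have indices
  tending to infinity, so each tends to \<open>euler\<close>.\<close>

lemma triple_coeff_tendsto: "(\<lambda>N. triple_coeff N j) \<longlonglongrightarrow> 1 / euler"
proof -
  let ?f = "q_factorial (nome\<^sup>2)"
  have f: "(\<lambda>N. ?f (g N)) \<longlonglongrightarrow> euler" if "filterlim g at_top sequentially" for g
    using q_factorial_tendsto that by (rule filterlim_compose)
  have "(\<lambda>N. ?f (2 * N) / (?f (nat (j + int N)) * ?f (nat (int N - j)))) \<longlonglongrightarrow> euler / (euler * euler)"
  proof (intro tendsto_intros f)
    show "filterlim (\<lambda>N. 2 * N) at_top sequentially"
      by (rule filterlim_subseq) (simp add: strict_mono_def)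
    show "filterlim (\<lambda>N. nat (j + int N)) at_top sequentially"
      unfolding filterlim_at_top
    proof
      fix Z show "\<forall>\<^sub>F N in sequentially. Z \<le> nat (j + int N)"
        using eventually_ge_at_top[of "Z + nat \<bar>j\<bar>"] by eventually_elim linarith
    qed
    show "filterlim (\<lambda>N. nat (int N - j)) at_top sequentially"
      unfolding filterlim_at_top
    proof
      fix Z show "\<forall>\<^sub>F N in sequentially. Z \<le> nat (int N - j)"
        using eventually_ge_at_top[of "Z + nat \<bar>j\<bar>"] by eventually_elim linarith
    qed
  qed (use euler_nonzero in auto)
  moreover have "\<forall>\<^sub>F N in sequentially. ?f (2 * N) / (?f (nat (j + int N)) * ?f (nat (int N - j))) = triple_coeff N j"
    using eventually_ge_at_top[of "nat \<bar>j\<bar>"]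
  proof eventually_elim
    case (elim N)
    then have "\<bar>j\<bar> \<le> int N" "nat (j + int N) \<le> 2 * N" "2 * N - nat (j + int N) = nat (int N - j)"
      by auto
    then show ?case by (simp add: triple_coeff_def q_binomial_def)
  qed
  ultimately have "(\<lambda>N. triple_coeff N j) \<longlonglongrightarrow> euler / (euler * euler)"
    by (rule Lim_transform_eventually)
  then show ?thesis using euler_nonzero by simp
qed

text \<open>Supplies the dominating constant for the termwise limit: the q-factorials tend to a
  nonzero limit, so they and their inverses are bounded.\<close>

lemma triple_coeff_bounded: "\<exists>B. \<forall>N j. norm (triple_coeff N j) \<le> B"
proof -
  let ?f = "q_factorial (nome\<^sup>2)"
  have "Bseq ?f" using q_factorial_tendsto by (auto intro: convergent_imp_Bseq convergentI)
  then obtain B1 where B1: "B1 > 0" "\<And>n. norm (?f n) \<le> B1" by (elim BseqE) auto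
  have "(\<lambda>n. inverse (?f n)) \<longlonglongrightarrow> inverse euler"
    using q_factorial_tendsto euler_nonzero by (rule tendsto_inverse)
  then have "Bseq (\<lambda>n. inverse (?f n))" by (auto intro: convergent_imp_Bseq convergentI)
  then obtain B2 where B2: "B2 > 0" "\<And>n. norm (inverse (?f n)) \<le> B2" by (elim BseqE) auto
  have "norm (triple_coeff N j) \<le> B1 * (B2 * B2)" for N j
  proof (cases "\<bar>j\<bar> \<le> int N")
    case True
    then have "nat (j + int N) \<le> 2 * N" by auto
    then have "triple_coeff N j = ?f (2 * N) * (inverse (?f (nat (j + int N))) * inverse (?f (2 * N - nat (j + int N))))"
      using True by (simp add: triple_coeff_def q_binomial_def field_simps)
    also have "norm \<dots> \<le> B1 * (B2 * B2)"
      unfolding norm_mult using B1 B2 by (intro mult_mono) (auto simp: less_imp_le)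
    finally show ?thesis .
  next
    case False
    then show ?thesis using B1 B2 by (simp add: triple_coeff_def)
  qed
  then show ?thesis by blast
qed

theorem triple_product:
  "theta3 z \<tau> = euler * linear_prod odd_nome (w_exp z) * linear_prod odd_nome (w_exp (- z))"
proof -
  obtain B where B: "\<And>N j. norm (triple_coeff N j) \<le> B" using triple_coeff_bounded by blast
  have "(\<lambda>N. \<Sum>\<^sub>\<infinity>j. triple_coeff N j * theta_term j z) \<longlonglongrightarrow> 1 / euler * theta3 z \<tau>"
  \<comment> \<open>Dominated convergence: the partial sums over \<open>j\<close> converge uniformly
    in \<open>N\<close>.\<close>
  proof (rule swap_uniform_limit')
    show "\<forall>\<^sub>F X in finite_subsets_at_top UNIV. ((\<lambda>N. \<Sum>j\<in>X. triple_coeff N j * theta_term j z) \<longlongrightarrow> (\<Sum>j\<in>X. 1 / euler * theta_term j z)) sequentially"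
      by (intro always_eventually allI tendsto_intros triple_coeff_tendsto)
    show "((\<lambda>X. \<Sum>j\<in>X. 1 / euler * theta_term j z) \<longlongrightarrow> 1 / euler * theta3 z \<tau>) (finite_subsets_at_top UNIV)"
      using has_sum_cmult_right[OF theta3_has_sum, of "1 / euler" z] by (simp add: has_sum_def)
    have "norm (triple_coeff N j * theta_term j z) \<le>
        B * exp (pi * ((2 * \<bar>Im z\<bar> + 1)\<^sup>2 / (4 * Im \<tau>))) * exp (- pi * \<bar>real_of_int j\<bar>)" for N j
      unfolding norm_mult mult.assoc
      using B norm_theta_term_le[of z "\<bar>Im z\<bar>" j] order.trans[OF norm_ge_zero B] by (intro mult_mono) auto
    then show "uniform_limit UNIV (\<lambda>X N. \<Sum>j\<in>X. triple_coeff N j * theta_term j z) (\<lambda>N. \<Sum>\<^sub>\<infinity>j. triple_coeff N j * theta_term j z) (finite_subsets_at_top UNIV)"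
      by (intro Weierstrass_m_test_general[OF _ summable_theta_bound]) auto
  qed auto
  then have "(\<lambda>N. partial_triple N z) \<longlonglongrightarrow> 1 / euler * theta3 z \<tau>"
    by (simp only: partial_triple_infsum)
  moreover have "(\<lambda>N. partial_triple N z) \<longlonglongrightarrow> linear_prod odd_nome (w_exp z) * linear_prod odd_nome (w_exp (- z))"
    unfolding partial_triple_def by (intro tendsto_intros linear_prod_tendsto summable_odd_nome)
  ultimately have "1 / euler * theta3 z \<tau> = linear_prod odd_nome (w_exp z) * linear_prod odd_nome (w_exp (- z))"
    by (rule LIMSEQ_unique)
  then show ?thesis using euler_nonzero by (simp add: field_simps)
qed

end

section \<open>Zeros and quasi-periods of the theta functions\<close>

lemma exp_pi_i_shift: "exp (pi * \<i> + z) = - exp z" "exp (z + pi * \<i>) = - exp z"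
  by (simp_all add: exp_add)

context upper_half_plane
begin

text \<open>By the triple product a zero must be the zero of a single factor, and these all lie at
  \<open>1 / 2 + \<tau> / 2\<close> modulo the lattice.\<close>

lemma theta3_nonzero:
  assumes "z - 1 / 2 - \<tau> / 2 \<notin> lattice"
  shows "theta3 z \<tau> \<noteq> 0"
proof -
  have w: "1 + odd_nome k * w_exp x \<noteq> 0" if x: "x = z \<or> x = - z" for x k
  proof
    assume "1 + odd_nome k * w_exp x = 0"
    then have "odd_nome k * w_exp x = - 1" by (simp add: add_eq_0_iff)
    then have "exp (pi * \<i> + (of_nat (2 * k + 1) * (pi * \<i> * \<tau>) + 2 * pi * \<i> * x)) = exp 0"
      by (simp only: odd_nome_def w_exp_def nome_power exp_add) simp
    then obtain n :: int where n: "pi * \<i> + (of_nat (2 * k + 1) * (pi * \<i> * \<tau>) + 2 * pi * \<i> * x) = 0 + of_int (2 * n) * pi * \<i>"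
      unfolding exp_eq by (auto simp: mult_ac)
    then have "(pi * \<i>) * (1 + (2 * of_nat k + 1) * \<tau> + 2 * x) = (pi * \<i>) * (2 * of_int n)"
      by (simp add: algebra_simps)
    then have "1 + (2 * of_nat k + 1) * \<tau> + 2 * x = 2 * of_int n" by simp
    then have "2 * (x + 1 / 2 + \<tau> / 2) = 2 * (of_int n + of_int (- int k) * \<tau>)"
      by (simp add: algebra_simps)
    then have n: "x + 1 / 2 + \<tau> / 2 = of_int n + of_int (- int k) * \<tau>"
      by (simp only: mult_cancel_left zero_neq_numeral[symmetric] simp_thms)
    from x have "z - 1 / 2 - \<tau> / 2 \<in> lattice"
    proof
      assume "x = z"
      then have "z - 1 / 2 - \<tau> / 2 = (x + 1 / 2 + \<tau> / 2) - 1 - \<tau>" by simp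
      then show ?thesis unfolding n by (simp only: lattice_diff latticeI lattice_1 lattice_tau)
    next
      assume "x = - z"
      then have "z - 1 / 2 - \<tau> / 2 = - (x + 1 / 2 + \<tau> / 2)" by simp
      then show ?thesis unfolding n by (simp only: lattice_uminus latticeI)
    qed
    with assms show False ..
  qed
  then show ?thesis unfolding triple_product
    using euler_nonzero w by (simp add: linear_prod_nonzero summable_odd_nome)
qed

text \<open>This is \<open>\<i>\<close> times the classical odd theta function.\<close>

definition theta1 :: "complex \<Rightarrow> complex" where
  "theta1 z = exp (pi * \<i> * \<tau> / 4 + pi * \<i> * z) * theta3 (z + 1 / 2 + \<tau> / 2) \<tau>"

text \<open>The multiplier for translation by \<open>\<tau>\<close>; it is the same for all four
  theta functions up to sign, so squares of their quotients are elliptic.\<close>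

definition quasi :: "complex \<Rightarrow> complex" where
  "quasi z = exp (- pi * \<i> * \<tau> - 2 * pi * \<i> * z)"

lemma quasi_nonzero [simp]: "quasi z \<noteq> 0"
  by (simp add: quasi_def)

lemma theta3_comp_holomorphic: "f holomorphic_on A \<Longrightarrow> (\<lambda>z. theta3 (f z) \<tau>) holomorphic_on A"
  using holomorphic_on_compose_gen[OF _ theta3_holomorphic, of f A] by (simp add: o_def)

lemma theta_holomorphic:
  "theta1 holomorphic_on UNIV" "(\<lambda>z. theta2 z \<tau>) holomorphic_on UNIV" "(\<lambda>z. theta4 z \<tau>) holomorphic_on UNIV"
  unfolding theta1_def[abs_def] theta2_def theta4_def
  by (intro holomorphic_intros theta3_comp_holomorphic; simp)+

lemma theta3_add_tau': "theta3 (z + \<tau>) \<tau> = quasi z * theta3 z \<tau>"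
  by (simp add: theta3_add_tau quasi_def)

lemma theta1_minus: "theta1 (- z) = - theta1 z"
proof -
  have "theta3 (z + 1 / 2 + \<tau> / 2) \<tau> = theta3 (z + 1 / 2 - \<tau> / 2 + \<tau>) \<tau>"
    by (simp add: algebra_simps)
  also have "\<dots> = quasi (z + 1 / 2 - \<tau> / 2) * theta3 (z - 1 / 2 - \<tau> / 2 + 1) \<tau>"
    unfolding theta3_add_tau' by (simp add: algebra_simps)
  also have "\<dots> = quasi (z + 1 / 2 - \<tau> / 2) * theta3 (- z + 1 / 2 + \<tau> / 2) \<tau>"
    unfolding theta3_add_1 using theta3_minus[of "z - 1 / 2 - \<tau> / 2"] by (simp add: algebra_simps)
  finally have "theta1 z = exp (pi * \<i> * \<tau> / 4 + pi * \<i> * z) * quasi (z + 1 / 2 - \<tau> / 2) * theta3 (- z + 1 / 2 + \<tau> / 2) \<tau>"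
    by (simp add: theta1_def)
  also have "exp (pi * \<i> * \<tau> / 4 + pi * \<i> * z) * quasi (z + 1 / 2 - \<tau> / 2) = - exp (pi * \<i> * \<tau> / 4 + pi * \<i> * (- z))"
  proof -
    have "pi * \<i> * \<tau> / 4 + pi * \<i> * z + (- pi * \<i> * \<tau> - 2 * pi * \<i> * (z + 1 / 2 - \<tau> / 2)) + pi * \<i> =
        pi * \<i> * \<tau> / 4 + pi * \<i> * (- z)" by (simp add: field_simps)
    then show ?thesis using exp_pi_i_shift(2) by (metis exp_add minus_minus quasi_def)
  qed
  finally show ?thesis by (simp add: theta1_def)
qed

lemma theta2_minus: "theta2 (- z) \<tau> = theta2 z \<tau>"
proof -
  have "theta3 (z + \<tau> / 2) \<tau> = theta3 (z - \<tau> / 2 + \<tau>) \<tau>" by (simp add: algebra_simps)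
  also have "\<dots> = quasi (z - \<tau> / 2) * theta3 (- z + \<tau> / 2) \<tau>"
    unfolding theta3_add_tau' using theta3_minus[of "z - \<tau> / 2"] by (simp add: algebra_simps)
  finally have "theta2 z \<tau> = exp (pi * \<i> * \<tau> / 4 + pi * \<i> * z) * quasi (z - \<tau> / 2) * theta3 (- z + \<tau> / 2) \<tau>"
    by (simp add: theta2_def)
  also have "exp (pi * \<i> * \<tau> / 4 + pi * \<i> * z) * quasi (z - \<tau> / 2) = exp (pi * \<i> * \<tau> / 4 + pi * \<i> * (- z))"
    unfolding quasi_def exp_add[symmetric] by (rule arg_cong[where f=exp]) (simp add: field_simps)
  finally show ?thesis by (simp add: theta2_def)
qed

lemma theta4_minus: "theta4 (- z) \<tau> = theta4 z \<tau>"
  using theta3_add_1[of "- z - 1 / 2"] theta3_minus[of "z + 1 / 2"] by (simp add: theta4_def algebra_simps)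

lemma theta1_add_1: "theta1 (z + 1) = - theta1 z"
  using theta3_add_1[of "z + 1 / 2 + \<tau> / 2"] exp_pi_i_shift(2)[of "pi * \<i> * \<tau> / 4 + pi * \<i> * z"]
  by (simp add: theta1_def algebra_simps)

lemma theta2_add_1: "theta2 (z + 1) \<tau> = - theta2 z \<tau>"
  using theta3_add_1[of "z + \<tau> / 2"] exp_pi_i_shift(2)[of "pi * \<i> * \<tau> / 4 + pi * \<i> * z"]
  by (simp add: theta2_def algebra_simps)

lemma theta4_add_1: "theta4 (z + 1) \<tau> = theta4 z \<tau>"
  using theta3_add_1[of "z + 1 / 2"] by (simp add: theta4_def algebra_simps)

lemma quasi_add_half: "quasi (z + 1 / 2) = - quasi z"
proof -
  have "quasi z = exp (- pi * \<i> * \<tau> - 2 * pi * \<i> * (z + 1 / 2) + pi * \<i>)"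
    unfolding quasi_def by (rule arg_cong[where f=exp]) (simp add: field_simps)
  then show ?thesis by (simp only: exp_pi_i_shift quasi_def minus_minus)
qed

lemma exp_mult_quasi:
  "exp (pi * \<i> * \<tau> / 4 + pi * \<i> * (z + \<tau>)) * quasi (z + \<tau> / 2) = exp (pi * \<i> * \<tau> / 4 + pi * \<i> * z) * quasi z"
  unfolding quasi_def exp_add[symmetric] by (rule arg_cong[where f=exp]) (simp add: field_simps)

lemma theta1_add_tau: "theta1 (z + \<tau>) = - quasi z * theta1 z"
proof -
  have "theta3 (z + \<tau> + 1 / 2 + \<tau> / 2) \<tau> = - quasi (z + \<tau> / 2) * theta3 (z + 1 / 2 + \<tau> / 2) \<tau>"
    using theta3_add_tau'[of "z + \<tau> / 2 + 1 / 2"] quasi_add_half[of "z + \<tau> / 2"]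
    by (simp add: add_ac)
  then show ?thesis using exp_mult_quasi[of z] by (simp add: theta1_def)
qed

lemma theta2_add_tau: "theta2 (z + \<tau>) \<tau> = quasi z * theta2 z \<tau>"
  using exp_mult_quasi[of z] theta3_add_tau'[of "z + \<tau> / 2"] by (simp add: theta2_def add_ac)

lemma theta4_add_tau: "theta4 (z + \<tau>) \<tau> = - quasi z * theta4 z \<tau>"
  using theta3_add_tau'[of "z + 1 / 2"] by (simp add: theta4_def add_ac quasi_add_half)

lemma half_notin_lattice: "1 / 2 \<notin> lattice" "\<tau> / 2 \<notin> lattice" "1 / 2 + \<tau> / 2 \<notin> lattice"
proof -
  have eq: "2 * (1 / 2) = of_int 1 + of_int 0 * \<tau>" "2 * (\<tau> / 2) = of_int 0 + of_int 1 * \<tau>"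
    "2 * (1 / 2 + \<tau> / 2) = of_int 1 + of_int 1 * \<tau>" by simp_all
  have double: "2 * (of_int m + of_int n * \<tau>) = of_int (2 * m) + of_int (2 * n) * \<tau>" for m n by simp
  show "1 / 2 \<notin> lattice" "\<tau> / 2 \<notin> lattice" "1 / 2 + \<tau> / 2 \<notin> lattice"
    unfolding lattice_iff using eq by (metis double lattice_eq_iff odd_one dvd_triv_left)+
qed

lemma theta1_nonzero: "z \<notin> lattice \<Longrightarrow> theta1 z \<noteq> 0"
  using theta3_nonzero[of "z + 1 / 2 + \<tau> / 2"] by (simp add: theta1_def)

lemma theta1_0: "theta1 0 = 0"
  using theta1_minus[of 0] by simp

lemma theta3_zero: "theta3 (1 / 2 + \<tau> / 2) \<tau> = 0"
  using theta1_0 by (simp add: theta1_def)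

lemma thetanull_nonzero: "theta2 0 \<tau> \<noteq> 0" "theta3 0 \<tau> \<noteq> 0" "theta4 0 \<tau> \<noteq> 0"
proof -
  have "- (1 / 2 + \<tau> / 2) \<notin> lattice" "- (1 / 2) \<notin> lattice" "- (\<tau> / 2) \<notin> lattice"
    using half_notin_lattice by (simp_all only: lattice_uminus_iff not_False_eq_True)
  then show "theta2 0 \<tau> \<noteq> 0" "theta3 0 \<tau> \<noteq> 0" "theta4 0 \<tau> \<noteq> 0"
    using theta3_nonzero[of "\<tau> / 2"] theta3_nonzero[of 0] theta3_nonzero[of "1 / 2"]
    by (simp_all add: theta2_def theta4_def)
qed

section \<open>The derivative of the odd theta function at 0\<close>

lemma linear_prod_nome: "linear_prod odd_nome (nome * y) = linear_prod even_nome y"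
  unfolding linear_prod_def by (simp add: odd_nome_def even_nome_def power_mult power2_eq_square power_mult_distrib mult_ac)

text \<open>Lowering the odd exponents by one gives the even exponents from \<open>0\<close> on; the
  exponent \<open>0\<close> accounts for the factor \<open>1 + y\<close>.\<close>

lemma linear_prod_nome_inverse: "linear_prod odd_nome (y / nome) = (1 + y) * linear_prod even_nome y"
proof -
  have "(\<lambda>N. \<Prod>k<Suc N. 1 + odd_nome k * (y / nome)) \<longlonglongrightarrow> linear_prod odd_nome (y / nome)"
    using linear_prod_tendsto[OF summable_odd_nome] by (rule LIMSEQ_Suc)
  moreover have "(\<Prod>k<Suc N. 1 + odd_nome k * (y / nome)) = (1 + y) * (\<Prod>k<N. 1 + even_nome k * y)" for N
    unfolding prod.lessThan_Suc_shift
    by (simp add: odd_nome_def even_nome_def power_mult power2_eq_square power_mult_distrib mult_ac)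
  then have "(\<lambda>N. \<Prod>k<Suc N. 1 + odd_nome k * (y / nome)) \<longlonglongrightarrow> (1 + y) * linear_prod even_nome y"
    by (simp only:) (intro tendsto_intros linear_prod_tendsto summable_even_nome)
  ultimately show ?thesis by (rule LIMSEQ_unique)
qed

lemma w_exp_shift: "w_exp (z + \<tau> / 2) = nome * w_exp z" "w_exp (- z - \<tau> / 2) = w_exp (- z) / nome"
  "w_exp (z + 1 / 2) = - w_exp z" "w_exp (z - 1 / 2) = - w_exp z"
proof -
  show "w_exp (z + \<tau> / 2) = nome * w_exp z" "w_exp (- z - \<tau> / 2) = w_exp (- z) / nome"
    unfolding w_exp_def nome_def exp_add[symmetric] exp_diff[symmetric]
    by (rule arg_cong[where f=exp]; simp add: field_simps)+
  show h: "w_exp (z + 1 / 2) = - w_exp z" for z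
    unfolding w_exp_def exp_pi_i_shift[symmetric] by (rule arg_cong[where f=exp]) (simp add: field_simps)
  show "w_exp (z - 1 / 2) = - w_exp z" using h[of "z - 1 / 2"] by simp
qed

text \<open>Isolates the zero at \<open>0\<close> in the difference of exponentials, so that
  continuity of the product is all that the derivative at \<open>0\<close> requires.\<close>

lemma theta1_product:
  "theta1 z = exp (pi * \<i> * \<tau> / 4) * (exp (pi * \<i> * z) - exp (- pi * \<i> * z)) *
     (euler * linear_prod even_nome (- w_exp z) * linear_prod even_nome (- w_exp (- z)))"
proof -
  have "theta3 (z + 1 / 2 + \<tau> / 2) \<tau> =
      euler * linear_prod odd_nome (nome * - w_exp z) * linear_prod odd_nome (- w_exp (- z) / nome)"
    using w_exp_shift(1)[of "z + 1 / 2"] w_exp_shift(2)[of "z + 1 / 2"] w_exp_shift(3)[of z] w_exp_shift(4)[of "- z"]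
    by (simp add: triple_product algebra_simps)
  also have "\<dots> = euler * linear_prod even_nome (- w_exp z) * ((1 - w_exp (- z)) * linear_prod even_nome (- w_exp (- z)))"
    unfolding linear_prod_nome linear_prod_nome_inverse by simp
  finally have "theta1 z = exp (pi * \<i> * \<tau> / 4) * (exp (pi * \<i> * z) * (1 - w_exp (- z))) *
     (euler * linear_prod even_nome (- w_exp z) * linear_prod even_nome (- w_exp (- z)))"
    by (simp add: theta1_def exp_add mult_ac)
  also have "exp (pi * \<i> * z) * (1 - w_exp (- z)) = exp (pi * \<i> * z) - exp (- pi * \<i> * z)"
    by (simp add: w_exp_def right_diff_distrib mult_ac flip: exp_add)
  finally show ?thesis .
qed

lemma w_exp_0 [simp]: "w_exp 0 = 1"
  by (simp add: w_exp_def)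

text \<open>The product rule at a zero of one factor, where the other need only be
  continuous.\<close>

lemma DERIV_mult_isCont:
  fixes f g :: "complex \<Rightarrow> complex"
  assumes "(f has_field_derivative D) (at x)" "f x = 0" "isCont g x"
  shows "((\<lambda>z. f z * g z) has_field_derivative D * g x) (at x)"
proof -
  obtain k where k: "\<And>z. f z - f x = k z * (z - x)" "isCont k x" "k x = D"
    using assms(1) unfolding CARAT_DERIV by blast
  show ?thesis unfolding CARAT_DERIV
    by (rule exI[of _ "\<lambda>z. k z * g z"]) (use k assms in \<open>auto intro!: continuous_intros\<close>)
qed

lemma deriv_theta1_euler: "deriv theta1 0 = 2 * pi * \<i> * exp (pi * \<i> * \<tau> / 4) * euler ^ 3"
proof -
  let ?f = "\<lambda>z. exp (pi * \<i> * \<tau> / 4) * (exp (pi * \<i> * z) - exp (- pi * \<i> * z))"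
  let ?g = "\<lambda>z. euler * linear_prod even_nome (- w_exp z) * linear_prod even_nome (- w_exp (- z))"
  have 1: "(?f has_field_derivative 2 * pi * \<i> * exp (pi * \<i> * \<tau> / 4)) (at 0)"
    by (auto intro!: derivative_eq_intros)
  have 2: "isCont ?g 0"
    by (intro continuous_intros isCont_o2[OF _ linear_prod_isCont] summable_even_nome)
      (auto simp: w_exp_def intro!: continuous_intros)
  have "((\<lambda>z. ?f z * ?g z) has_field_derivative 2 * pi * \<i> * exp (pi * \<i> * \<tau> / 4) * ?g 0) (at 0)"
    by (rule DERIV_mult_isCont[OF 1 _ 2]) simp
  also have "(\<lambda>z. ?f z * ?g z) = theta1" by (simp add: fun_eq_iff theta1_product)
  finally show ?thesis by (simp add: DERIV_imp_deriv euler_def power3_eq_cube mult_ac)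
qed

text \<open>Euler's identity. Multiplied by the product of \<open>1 - q ^ (2 k)\<close> for
  \<open>k \<le> N\<close>, the finite version pairs up into differences of squares and becomes that
  same product for \<open>k \<le> 2 N\<close>; both tend to \<open>euler\<close>.\<close>

lemma linear_prod_identity:
  "linear_prod even_nome 1 * linear_prod odd_nome 1 * linear_prod odd_nome (- 1) = 1"
proof -
  let ?p = "\<lambda>N. (\<Prod>k<N. 1 + even_nome k * - 1) * ((\<Prod>k<N. 1 + even_nome k * 1) * (\<Prod>k<N. 1 + odd_nome k * 1) * (\<Prod>k<N. 1 + odd_nome k * - 1))"
  have "?p N = q_factorial (nome\<^sup>2) (2 * N)" for N
  proof (induction N)
    case (Suc N)
    have o: "(1 + odd_nome N) * (1 - odd_nome N) = 1 - (nome\<^sup>2) ^ Suc (2 * N)"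
      by (simp add: odd_nome_def algebra_simps flip: power_mult power_add power_Suc)
    have e: "(1 + even_nome N) * (1 - even_nome N) = 1 - (nome\<^sup>2) ^ Suc (Suc (2 * N))"
      by (simp add: even_nome_def algebra_simps flip: power_mult power_add power_Suc)
    have "?p (Suc N) = ?p N * ((1 + odd_nome N) * (1 - odd_nome N)) * ((1 + even_nome N) * (1 - even_nome N))"
      by (simp only: prod.lessThan_Suc mult_1_right mult_minus_right diff_conv_add_uminus) (simp only: mult_ac)
    then show ?case unfolding Suc.IH o e by (simp add: q_factorial_Suc mult_ac del: power_Suc)
  qed (simp add: q_factorial_def)
  moreover have "(\<lambda>N. q_factorial (nome\<^sup>2) (2 * N)) \<longlonglongrightarrow> euler"
    by (rule filterlim_compose[OF q_factorial_tendsto filterlim_subseq]) (simp add: strict_mono_def)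
  ultimately have "?p \<longlonglongrightarrow> euler" by simp
  moreover have "?p \<longlonglongrightarrow> euler * (linear_prod even_nome 1 * linear_prod odd_nome 1 * linear_prod odd_nome (- 1))"
    unfolding euler_def by (intro tendsto_intros linear_prod_tendsto summable_even_nome summable_odd_nome)
  ultimately have "euler * (linear_prod even_nome 1 * linear_prod odd_nome 1 * linear_prod odd_nome (- 1)) = euler"
    by (intro LIMSEQ_unique)
  then show ?thesis using euler_nonzero by simp
qed

text \<open>Jacobi's derivative formula; the factor \<open>\<i>\<close> is due to the normalization
  of \<open>theta1\<close>.\<close>

theorem deriv_theta1: "deriv theta1 0 = pi * \<i> * (theta2 0 \<tau> * theta3 0 \<tau> * theta4 0 \<tau>)"
proof -
  let ?E = "linear_prod even_nome 1" and ?L = "linear_prod odd_nome 1" and ?L' = "linear_prod odd_nome (- 1)"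
  have "theta3 (\<tau> / 2) \<tau> = euler * linear_prod odd_nome (nome * 1) * linear_prod odd_nome (1 / nome)"
    using w_exp_shift(1)[of 0] w_exp_shift(2)[of 0] by (simp add: triple_product)
  then have "theta2 0 \<tau> = exp (pi * \<i> * \<tau> / 4) * (2 * euler * ?E\<^sup>2)"
    unfolding linear_prod_nome linear_prod_nome_inverse by (simp add: theta2_def power2_eq_square)
  moreover have "theta3 0 \<tau> = euler * ?L\<^sup>2" by (simp add: triple_product power2_eq_square)
  moreover have "theta4 0 \<tau> = euler * ?L'\<^sup>2"
    using w_exp_shift(3)[of 0] w_exp_shift(4)[of 0] by (simp add: theta4_def triple_product power2_eq_square)
  ultimately have "theta2 0 \<tau> * theta3 0 \<tau> * theta4 0 \<tau> = 2 * exp (pi * \<i> * \<tau> / 4) * euler ^ 3 * (?E * ?L * ?L')\<^sup>2"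
    by (simp add: power2_eq_square power3_eq_cube mult_ac)
  then show ?thesis unfolding deriv_theta1_euler linear_prod_identity by (simp add: mult_ac)
qed

section \<open>Theta quotients as Weierstrass functions\<close>

lemma weierstrass_functions_differ:
  assumes "weierstrass_function \<tau> X h d" "weierstrass_function \<tau> X' h' d'" "z \<notin> lattice"
  shows "X z - h 0 = X' z - h' 0"
proof -
  interpret A: weierstrass_function \<tau> X h d by fact
  interpret B: weierstrass_function \<tau> X' h' d' by fact
  have "X z - X' z = h 0 - h' 0"
  proof (rule elliptic_constant[of "\<lambda>z. X z - X' z"])
    show "(\<lambda>z. X z - X' z) holomorphic_on - lattice"
      by (intro holomorphic_intros A.X_holo B.X_holo)
    have "(\<lambda>z. h z - h' z) \<midarrow>0\<rightarrow> h 0 - h' 0"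
      by (intro tendsto_intros A.holomorphic_isCont[OF A.h_holo] A.holomorphic_isCont[OF B.h_holo])
        (use A.d_pos B.d_pos in auto)
    moreover have "\<forall>\<^sub>F z in at 0. h z - h' z = X z - X' z"
    proof (rule eventually_mono[OF eventually_at_in_open[of "ball 0 (min d d')" 0]])
      fix z :: complex assume "z \<in> ball 0 (min d d') - {0}"
      then show "h z - h' z = X z - X' z" using A.X_h[of z] B.X_h[of z] by simp
    qed (use A.d_pos B.d_pos in auto)
    ultimately show "(\<lambda>z. X z - X' z) \<midarrow>0\<rightarrow> h 0 - h' 0"
      by (rule Lim_transform_eventually)
  qed (use assms(3) A.X_per B.X_per in auto)
  then show ?thesis by (simp add: algebra_simps)
qed

text \<open>Squaring absorbs the signs of the multipliers. With \<open>s\<close> for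
  \<open>theta1 z / z\<close>, the function \<open>Y\<close> is \<open>z ^ 2\<close> times the
  squared quotient; \<open>Y 0 = 1\<close>, and \<open>deriv Y 0 = 0\<close> because
  \<open>Y\<close> is even. Two difference quotients at \<open>0\<close> therefore give
  \<open>h\<close> as \<open>(Y - 1) / z ^ 2\<close>.\<close>

lemma theta_quotient_weierstrass:
  assumes F: "F holomorphic_on UNIV" "\<And>z. F (- z) = F z" "F 0 \<noteq> 0"
    and per: "\<And>z. (F (z + 1))\<^sup>2 = (F z)\<^sup>2" "\<And>z. (F (z + \<tau>))\<^sup>2 = (quasi z * F z)\<^sup>2"
  obtains h d where "weierstrass_function \<tau> (\<lambda>z. (deriv theta1 0 / F 0 * F z / theta1 z)\<^sup>2) h d"
proof -
  let ?X = "\<lambda>z. (deriv theta1 0 / F 0 * F z / theta1 z)\<^sup>2"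
  define s where "s z = (if z = 0 then deriv theta1 0 else (theta1 z - theta1 0) / (z - 0))" for z
  have s_holo: "s holomorphic_on UNIV"
    unfolding s_def[abs_def] by (rule pole_lemma_open) (use theta_holomorphic in auto)
  have s_0: "s 0 \<noteq> 0" using thetanull_nonzero by (simp add: s_def deriv_theta1)
  have s_even: "s (- z) = s z" for z by (simp add: s_def theta1_minus theta1_0)
  obtain d where d: "d > 0" "\<And>w. w \<in> lattice \<Longrightarrow> w \<noteq> 0 \<Longrightarrow> dist w 0 \<ge> d"
    using lattice_near[of 0] by metis
  have off: "z \<notin> lattice" if "z \<in> ball 0 d - {0}" for z using d(2)[of z] that by auto
  have s_nz: "s z \<noteq> 0" if "z \<in> ball 0 d" for z
    using off[of z] that s_0 theta1_nonzero[of z] by (cases "z = 0") (auto simp: s_def theta1_0)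
  define Y where "Y z = (deriv theta1 0 / F 0 * F z / s z)\<^sup>2" for z
  have Y_holo: "Y holomorphic_on ball 0 d"
    unfolding Y_def[abs_def] using s_nz
    by (intro holomorphic_intros holomorphic_on_subset[OF F(1)] holomorphic_on_subset[OF s_holo]) auto
  have Y_0: "Y 0 = 1" using s_0 F(3) by (simp add: Y_def s_def)
  have dY: "deriv Y 0 = 0"
    by (rule deriv_even_0[OF Y_holo d(1)]) (simp add: Y_def F(2) s_even)
  define Y1 where "Y1 z = (if z = 0 then deriv Y 0 else (Y z - Y 0) / (z - 0))" for z
  have Y1_holo: "Y1 holomorphic_on ball 0 d"
    unfolding Y1_def[abs_def] by (rule pole_lemma_open) (use Y_holo in auto)
  define h where "h z = (if z = 0 then deriv Y1 0 else (Y1 z - Y1 0) / (z - 0))" for z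
  have h_holo: "h holomorphic_on ball 0 d"
    unfolding h_def[abs_def] by (rule pole_lemma_open) (use Y1_holo in auto)
  have op: "open (- lattice)" by (rule open_Compl, rule closed_lattice_subset, blast)
  have "weierstrass_function \<tau> ?X h d"
  proof
    show "?X holomorphic_on - lattice"
      by (intro holomorphic_intros holomorphic_on_subset[OF F(1)] holomorphic_on_subset[OF theta_holomorphic(1)])
        (auto simp: theta1_nonzero)
    show "?X (z + 1) = ?X z" for z
      by (simp add: power_divide power_mult_distrib per theta1_add_1)
    show "?X (z + \<tau>) = ?X z" for z
      by (simp add: power_divide power_mult_distrib per theta1_add_tau)
    show "?X (- z) = ?X z" for z by (simp add: F(2) theta1_minus)
    show "z \<notin> lattice \<and> ?X z = 1 / z\<^sup>2 + h z" if "z \<in> ball 0 d - {0}" for z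
    proof
      have z: "z \<noteq> 0" using that by simp
      have "theta1 z = z * s z" using z by (simp add: s_def theta1_0)
      then have "?X z = Y z / z\<^sup>2" by (simp add: Y_def power_divide power_mult_distrib)
      also have "\<dots> = 1 / z\<^sup>2 + h z"
        using z by (simp add: h_def Y1_def Y_0 dY power2_eq_square diff_divide_distrib)
      finally show "?X z = 1 / z\<^sup>2 + h z" .
    qed (rule off[OF that])
  qed (use d h_holo in auto)
  then show ?thesis by (rule that)
qed

end

text \<open>Pairwise differences of the equations give \<open>g2\<close> and, the roots being
  distinct, \<open>x + y + z = 0\<close>; then everything is a polynomial in \<open>x\<close> and
  \<open>y\<close>.\<close>

lemma weierstrass_cubic_discriminant:
  assumes roots: "4 * x ^ 3 - g2 * x - g3 = 0" "4 * y ^ 3 - g2 * y - g3 = 0" "4 * z ^ 3 - g2 * z - g3 = (0 :: complex)"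
    and distinct: "x \<noteq> y" "x \<noteq> z" "y \<noteq> z"
  shows "g2 ^ 3 - 27 * g3\<^sup>2 = 16 * ((x - y) * (x - z) * (z - y))\<^sup>2"
proof -
  have "(x - y) * (4 * (x\<^sup>2 + x * y + y\<^sup>2) - g2) = (4 * x ^ 3 - g2 * x - g3) - (4 * y ^ 3 - g2 * y - g3)"
    "(x - z) * (4 * (x\<^sup>2 + x * z + z\<^sup>2) - g2) = (4 * x ^ 3 - g2 * x - g3) - (4 * z ^ 3 - g2 * z - g3)"
    by (simp_all add: algebra_simps power2_eq_square power3_eq_cube)
  then have 1: "4 * (x\<^sup>2 + x * y + y\<^sup>2) - g2 = 0" "4 * (x\<^sup>2 + x * z + z\<^sup>2) - g2 = 0"
    using roots distinct by simp_all
  have "(y - z) * (4 * (x + y + z)) = (4 * (x\<^sup>2 + x * y + y\<^sup>2) - g2) - (4 * (x\<^sup>2 + x * z + z\<^sup>2) - g2)"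
    by (simp add: algebra_simps power2_eq_square)
  then have "(y - z) * (4 * (x + y + z)) = 0" by (simp only: 1 diff_self)
  then have "x + y + z = 0" using distinct
    by (metis mult_eq_0_iff zero_neq_numeral right_minus_eq)
  then have z: "z = - x - y" by (simp add: algebra_simps eq_neg_iff_add_eq_0)
  have g2: "g2 = 4 * (x\<^sup>2 + x * y + y\<^sup>2)" using 1(1) by simp
  have g3: "g3 = 4 * x ^ 3 - g2 * x" using roots(1) by (simp add: algebra_simps)
  show ?thesis unfolding g3 g2 z by (simp add: algebra_simps power2_eq_square power3_eq_cube)
qed

context upper_half_plane
begin

theorem eisenstein_discriminant:
  "(60 * eisenstein 4) ^ 3 - 27 * (140 * eisenstein 6)\<^sup>2 =
     16 * pi ^ 12 * (theta2 0 \<tau> * theta3 0 \<tau> * theta4 0 \<tau>) ^ 8"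
proof -
  define a b c where "a = theta2 0 \<tau>" and "b = theta3 0 \<tau>" and "c = theta4 0 \<tau>"
  have nz: "a \<noteq> 0" "b \<noteq> 0" "c \<noteq> 0"
    using thetanull_nonzero by (simp_all add: a_def b_def c_def)
  have D: "deriv theta1 0 = pi * \<i> * (a * b * c)" by (simp add: deriv_theta1 a_def b_def c_def)
  define X2 X3 X4
    where "X2 = (\<lambda>z. (deriv theta1 0 / theta2 0 \<tau> * theta2 z \<tau> / theta1 z)\<^sup>2)"
      and "X3 = (\<lambda>z. (deriv theta1 0 / theta3 0 \<tau> * theta3 z \<tau> / theta1 z)\<^sup>2)"
      and "X4 = (\<lambda>z. (deriv theta1 0 / theta4 0 \<tau> * theta4 z \<tau> / theta1 z)\<^sup>2)"
  obtain h2 d2 where "weierstrass_function \<tau> X2 h2 d2"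
    unfolding X2_def
    by (rule theta_quotient_weierstrass[of "\<lambda>z. theta2 z \<tau>"])
      (use theta_holomorphic theta2_minus thetanull_nonzero theta2_add_1 theta2_add_tau in auto)
  then interpret W2: weierstrass_function \<tau> X2 h2 d2 .
  obtain h3 d3 where "weierstrass_function \<tau> X3 h3 d3"
    unfolding X3_def
    by (rule theta_quotient_weierstrass[of "\<lambda>z. theta3 z \<tau>"])
      (use theta3_holomorphic theta3_minus thetanull_nonzero theta3_add_1 theta3_add_tau' in auto)
  then interpret W3: weierstrass_function \<tau> X3 h3 d3 .
  obtain h4 d4 where "weierstrass_function \<tau> X4 h4 d4"
    unfolding X4_def
    by (rule theta_quotient_weierstrass[of "\<lambda>z. theta4 z \<tau>"])
      (use theta_holomorphic theta4_minus thetanull_nonzero theta4_add_1 theta4_add_tau in auto)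
  then interpret W4: weierstrass_function \<tau> X4 h4 d4 .
  have eq3: "X3 z - h3 0 = X2 z - h2 0" and eq4: "X4 z - h4 0 = X2 z - h2 0" if "z \<notin> lattice" for z
    using weierstrass_functions_differ[OF W3.weierstrass_function_axioms W2.weierstrass_function_axioms that]
      weierstrass_functions_differ[OF W4.weierstrass_function_axioms W2.weierstrass_function_axioms that] .
  \<comment> \<open>\<open>e\<close> is the Weierstrass function. Each quotient minus its constant
    equals it, so at the zero of a numerator its value is minus that constant, and differences of
    roots become values of a single quotient.\<close>
  define e where "e z = X2 z - h2 0" for z
  have root: "4 * (e z) ^ 3 - 60 * eisenstein 4 * e z - 140 * eisenstein 6 = 0"
    if "z \<notin> lattice" "2 * z \<in> lattice" for z
    using W2.weierstrass_equation[OF that(1)] W2.deriv_X_half_period[OF that] by (simp add: e_def)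
  have double: "2 * (1 / 2) \<in> lattice" "2 * (\<tau> / 2) \<in> lattice" "2 * (1 / 2 + \<tau> / 2) \<in> lattice"
    by (simp_all add: lattice_add)
  \<comment> \<open>Half periods permute the theta functions up to exponential factors, which cancel
    in the quotients.\<close>
  have t1: "theta1 (1 / 2) = \<i> * a" "theta1 (1 / 2 + \<tau> / 2) = \<i> * exp (- pi * \<i> * \<tau> / 4) * b"
  proof -
    have i: "\<i> = exp (pi * \<i> / 2)" using cis_conv_exp[of "pi / 2"] by (simp add: mult_ac)
    have "theta1 (1 / 2) = exp (pi * \<i> * \<tau> / 4 + pi * \<i> / 2) * theta3 (\<tau> / 2) \<tau>"
      using theta3_add_1[of "\<tau> / 2"] by (simp add: theta1_def add_ac)
    also have "exp (pi * \<i> * \<tau> / 4 + pi * \<i> / 2) = \<i> * exp (pi * \<i> * \<tau> / 4)"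
      unfolding exp_add i[symmetric] by (rule mult.commute)
    finally show "theta1 (1 / 2) = \<i> * a" by (simp add: a_def theta2_def)
    have "theta3 (1 / 2 + \<tau> / 2 + 1 / 2 + \<tau> / 2) \<tau> = theta3 (0 + \<tau> + 1) \<tau>"
      by (simp add: algebra_simps)
    also have "\<dots> = exp (- pi * \<i> * \<tau>) * b"
      unfolding theta3_add_1 theta3_add_tau' by (simp add: b_def quasi_def)
    finally have "theta1 (1 / 2 + \<tau> / 2) = exp (pi * \<i> * \<tau> / 4 + pi * \<i> * (1 / 2 + \<tau> / 2)) * exp (- pi * \<i> * \<tau>) * b"
      by (simp add: theta1_def)
    also have "exp (pi * \<i> * \<tau> / 4 + pi * \<i> * (1 / 2 + \<tau> / 2)) * exp (- pi * \<i> * \<tau>) =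
        exp (pi * \<i> / 2) * exp (- pi * \<i> * \<tau> / 4)"
      unfolding exp_add[symmetric] by (rule arg_cong[where f=exp]) (simp add: field_simps)
    finally show "theta1 (1 / 2 + \<tau> / 2) = \<i> * exp (- pi * \<i> * \<tau> / 4) * b"
      by (simp only: i[symmetric])
  qed
  have t2: "theta2 (1 / 2) \<tau> = 0" 
    using theta3_zero by (simp add: theta2_def)
  have t3: "theta3 (1 / 2) \<tau> = c" by (simp add: c_def theta4_def)
  have t4: "theta4 (1 / 2) \<tau> = b" "theta4 (\<tau> / 2) \<tau> = 0" "theta4 (1 / 2 + \<tau> / 2) \<tau> = exp (- pi * \<i> * \<tau> / 4) * a"
    using theta3_add_1[of 0] theta3_zero theta3_add_1[of "\<tau> / 2"]
    by (simp_all add: theta4_def theta2_def a_def b_def add_ac flip: exp_add mult.assoc)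
  have e1: "e (1 / 2) = - h2 0" using t2 by (simp add: e_def X2_def)
  have e2: "e (\<tau> / 2) = - h4 0" using t4 eq4[OF half_notin_lattice(2)] by (simp add: e_def X4_def)
  have e3: "e (1 / 2 + \<tau> / 2) = - h3 0"
    using theta3_zero eq3[OF half_notin_lattice(3)] by (simp add: e_def X3_def)
  have "e (1 / 2) - e (1 / 2 + \<tau> / 2) = X3 (1 / 2)"
    using eq3[OF half_notin_lattice(1)] unfolding e3 unfolding e_def by (simp add: algebra_simps)
  also have "\<dots> = pi\<^sup>2 * c ^ 4"
    using nz unfolding X3_def D t1 t3 b_def[symmetric] by (simp add: field_simps power2_eq_square power4_eq_xxxx)
  finally have e13: "e (1 / 2) - e (1 / 2 + \<tau> / 2) = pi\<^sup>2 * c ^ 4" .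
  have "e (1 / 2) - e (\<tau> / 2) = X4 (1 / 2)"
    using eq4[OF half_notin_lattice(1)] unfolding e2 unfolding e_def by (simp add: algebra_simps)
  also have "\<dots> = pi\<^sup>2 * b ^ 4"
    using nz unfolding X4_def D t1 t4 c_def[symmetric] by (simp add: field_simps power2_eq_square power4_eq_xxxx)
  finally have e12: "e (1 / 2) - e (\<tau> / 2) = pi\<^sup>2 * b ^ 4" .
  have "e (1 / 2 + \<tau> / 2) - e (\<tau> / 2) = X4 (1 / 2 + \<tau> / 2)"
    using eq4[OF half_notin_lattice(3)] unfolding e2 unfolding e_def by (simp add: algebra_simps)
  also have "\<dots> = pi\<^sup>2 * a ^ 4"
    using nz unfolding X4_def D t1 t4 c_def[symmetric] by (simp add: field_simps power2_eq_square power4_eq_xxxx)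
  finally have e32: "e (1 / 2 + \<tau> / 2) - e (\<tau> / 2) = pi\<^sup>2 * a ^ 4" .
  have "(60 * eisenstein 4) ^ 3 - 27 * (140 * eisenstein 6)\<^sup>2 =
      16 * ((e (1 / 2) - e (\<tau> / 2)) * (e (1 / 2) - e (1 / 2 + \<tau> / 2)) * (e (1 / 2 + \<tau> / 2) - e (\<tau> / 2)))\<^sup>2"
    by (rule weierstrass_cubic_discriminant[OF root[OF half_notin_lattice(1) double(1)]
          root[OF half_notin_lattice(2) double(2)] root[OF half_notin_lattice(3) double(3)]])
      (use e12 e13 e32 nz in auto)
  also have "\<dots> = 16 * pi ^ 12 * (a * b * c) ^ 8"
    unfolding e12 e13 e32 by (simp add: power_mult_distrib flip: power_mult power_add)
  finally show ?thesis by (simp add: a_def b_def c_def)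
qed

end

theorem lattice_discriminant:
  fixes g\<^sub>2 g\<^sub>3 \<omega>\<^sub>1 \<omega>\<^sub>2 \<tau> :: complex
  assumes "Im (\<omega>\<^sub>2 / \<omega>\<^sub>1) > 0" "\<tau> = \<omega>\<^sub>2 / \<omega>\<^sub>1"
    and "g\<^sub>2 = 60 * (\<Sum>\<^sub>\<infinity>\<omega>\<in>period_lattice \<omega>\<^sub>1 \<omega>\<^sub>2 - {0}. 1 / \<omega> ^ 4)"
    and "g\<^sub>3 = 140 * (\<Sum>\<^sub>\<infinity>\<omega>\<in>period_lattice \<omega>\<^sub>1 \<omega>\<^sub>2 - {0}. 1 / \<omega> ^ 6)"
  shows "g\<^sub>2 ^ 3 - 27 * g\<^sub>3\<^sup>2 = 16 * (pi / \<omega>\<^sub>1) ^ 12 * (theta2 0 \<tau> * theta3 0 \<tau> * theta4 0 \<tau>) ^ 8"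
proof -
  interpret upper_half_plane \<tau> by unfold_locales (use assms in simp)
  have w1: "\<omega>\<^sub>1 \<noteq> 0" using assms(1) by auto
  have w2: "\<omega>\<^sub>2 = \<omega>\<^sub>1 * \<tau>" using w1 assms(2) by simp
  have "period_lattice \<omega>\<^sub>1 \<omega>\<^sub>2 = (\<lambda>w. \<omega>\<^sub>1 * w) ` lattice"
  proof (intro equalityI subsetI)
    fix z assume "z \<in> period_lattice \<omega>\<^sub>1 \<omega>\<^sub>2"
    then obtain m n where "z = of_int m * \<omega>\<^sub>1 + of_int n * \<omega>\<^sub>2"
      by (auto simp: period_lattice_def)
    then have "z = \<omega>\<^sub>1 * (of_int m + of_int n * \<tau>)" by (simp add: w2 algebra_simps)
    then show "z \<in> (\<lambda>w. \<omega>\<^sub>1 * w) ` lattice" using latticeI by blast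
  next
    fix z assume "z \<in> (\<lambda>w. \<omega>\<^sub>1 * w) ` lattice"
    then obtain w where "w \<in> lattice" "z = \<omega>\<^sub>1 * w" by blast
    then obtain m n where "z = \<omega>\<^sub>1 * (of_int m + of_int n * \<tau>)" unfolding lattice_iff by blast
    then have "z = of_int m * \<omega>\<^sub>1 + of_int n * \<omega>\<^sub>2" by (simp add: w2 algebra_simps)
    then show "z \<in> period_lattice \<omega>\<^sub>1 \<omega>\<^sub>2" by (auto simp: period_lattice_def)
  qed
  then have image: "period_lattice \<omega>\<^sub>1 \<omega>\<^sub>2 - {0} = (\<lambda>w. \<omega>\<^sub>1 * w) ` (lattice - {0})"
    using w1 by auto
  have scale: "(\<Sum>\<^sub>\<infinity>\<omega>\<in>period_lattice \<omega>\<^sub>1 \<omega>\<^sub>2 - {0}. 1 / \<omega> ^ k) = 1 / \<omega>\<^sub>1 ^ k * eisenstein k" for k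
  proof -
    have "(\<Sum>\<^sub>\<infinity>\<omega>\<in>period_lattice \<omega>\<^sub>1 \<omega>\<^sub>2 - {0}. 1 / \<omega> ^ k) = (\<Sum>\<^sub>\<infinity>w\<in>lattice - {0}. 1 / \<omega>\<^sub>1 ^ k * (1 / w ^ k))"
      unfolding image using w1 by (subst infsum_reindex) (auto simp: inj_on_def o_def power_mult_distrib)
    then show ?thesis by (simp only: infsum_cmult_right' eisenstein_def)
  qed
  \<comment> \<open>Both terms are homogeneous of degree \<open>-12\<close> in the periods, as
    \<open>4 * 3 = 6 * 2\<close>.\<close>
  have "g\<^sub>2 ^ 3 - 27 * g\<^sub>3\<^sup>2 = 1 / \<omega>\<^sub>1 ^ 12 * ((60 * eisenstein 4) ^ 3 - 27 * (140 * eisenstein 6)\<^sup>2)"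
    unfolding assms(3,4) scale by (simp add: power_mult_distrib power_divide right_diff_distrib flip: power_mult)
  then show ?thesis unfolding eisenstein_discriminant by (simp add: power_divide)
qed

theorem theorem1p2:
  fixes \<phi> :: ternary_form
    and M :: "complex^3^3"
    and g\<^sub>2 g\<^sub>3 \<omega>\<^sub>1 \<omega>\<^sub>2 \<tau> a b c :: complex
  assumes "homogeneous 3 \<phi>"
    and "smooth_plane_curve \<phi>"
    and "invertible M"
    and "\<And>X Y Z :: complex.
           mpoly_eval (($) (M *v vector [X, Y, Z])) \<phi> =
             Y ^ 2 * Z - 4 * X ^ 3 + g\<^sub>2 * X * Z ^ 2 + g\<^sub>3 * Z ^ 3"
    and "Im (\<omega>\<^sub>2 / \<omega>\<^sub>1) > 0"
    and "g\<^sub>2 = 60 * (\<Sum>\<^sub>\<infinity>\<omega>\<in>period_lattice \<omega>\<^sub>1 \<omega>\<^sub>2 - {0}. 1 / \<omega> ^ 4)"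
    and "g\<^sub>3 = 140 * (\<Sum>\<^sub>\<infinity>\<omega>\<in>period_lattice \<omega>\<^sub>1 \<omega>\<^sub>2 - {0}. 1 / \<omega> ^ 6)"
    and "\<tau> = \<omega>\<^sub>2 / \<omega>\<^sub>1"
    and "a = theta2 0 \<tau>"
    and "b = theta3 0 \<tau>"
    and "c = theta4 0 \<tau>"
  shows "cubic_discriminant \<phi> = 2 ^ 16 / det M ^ 12 * (pi / \<omega>\<^sub>1) ^ 12 * (a * b * c) ^ 8"
proof -
  have "g\<^sub>2 ^ 3 - 27 * g\<^sub>3\<^sup>2 = 16 * (pi / \<omega>\<^sub>1) ^ 12 * (a * b * c) ^ 8"
    using lattice_discriminant[OF assms(5,8,6,7)] assms(9-11) by simp
  moreover have "cubic_discriminant \<phi> = 2 ^ 12 * (g\<^sub>2 ^ 3 - 27 * g\<^sub>3\<^sup>2) / det M ^ 12"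
    by (rule cubic_discriminant_weierstrass[OF assms(1,3,4)])
  \<comment> \<open>The constants combine as \<open>2 ^ 12 * 16 = 2 ^ 16\<close>.\<close>
  ultimately show ?thesis by simp
qed

end
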